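(* Let $H$ be a separable quaternionic Hilbert space and let $T$ be a densely defined, closed, right linear operator in $H$ (not necessarily bounded) which is normal, i.e. $TT^*=T^*T$. Then for every $\epsilon>0$ there exist a compact right linear operator $K\in\mathcal B(H)$ with $\|K\|<\epsilon$ and a diagonal operator $D$ on $H$ such that $T=D+K$.
   Context: $\mathbb H$ denotes the real quaternions. A quaternionic Hilbert space is a right $\mathbb H$-module $H$ with a map $\langle\cdot,\cdot\rangle:H\times H\to\mathbb H$ satisfying $\langle u,vp+wq\rangle=\langle u,v\rangle p+\langle u,w\rangle q$, $\langle u,v\rangle=\overline{\langle v,u\rangle}$, $\langle u,u\rangle\ge 0$ with equality iff $u=0$, and complete for $\|u\|=\langle u,u\rangle^{1/2}$. It is separable if it has a countable orthonormal basis. An operator $T:D(T)\subseteq H\to H$ on a right linear subspace $D(T)$ is right linear if it is additive and $T(xq)=(Tx)q$ for $q\in\mathbb H$. For densely defined $T$, the adjoint $T^*$ is defined on $D(T^* )=\{y: x\mapsto\langle y,Tx\rangle \text{ is continuous on } D(T)\}$ by $\langle y,Tx\rangle=\langle T^*y,x\rangle$. $\mathcal B(H)$ is the set of bounded right linear operators on $H$ with the operator norm. A bounded operator is compact if it maps bounded sets to precompact sets. A densely defined closed right linear operator $D$ is diagonal if there is an orthonormal basis $\{\phi_r:r\in\mathbb N\}$ of $H$ with each $\phi_r\in D(D)$ and a sequence $(q_r)\subset\mathbb H$ with $D\phi_r=\phi_r q_r$ for all $r$. The sum $D+K$ is defined on $D(D)\cap D(K)$ by $(D+K)x=Dx+Kx$;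 equality of operators includes equality of domains. *)

theory Defs
  imports "HOL-Analysis.Analysis"
begin

datatype quat = Quat (qre: real) (qi: real) (qj: real) (qk: real)

instantiation quat :: ring_1
begin
definition "0 = Quat 0 0 0 0"
definition "1 = Quat 1 0 0 0"
definition "p + q = Quat (qre p + qre q) (qi p + qi q) (qj p + qj q) (qk p + qk q)"
definition "- p = Quat (- qre p) (- qi p) (- qj p) (- qk p)"
definition "p - q = Quat (qre p - qre q) (qi p - qi q) (qj p - qj q) (qk p - qk q)"
definition "p * q = Quat
   (qre p * qre q - qi p * qi q - qj p * qj q - qk p * qk q)
   (qre p * qi q + qi p * qre q + qj p * qk q - qk p * qj q)
   (qre p * qj q - qi p * qk q + qj p * qre q + qk p * qi q)
   (qre p * qk q + qi p * qj q - qj p * qi q + qk p * qre q)"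
instance
  by standard (auto simp: zero_quat_def one_quat_def plus_quat_def uminus_quat_def
      minus_quat_def times_quat_def algebra_simps intro: quat.expand)
end

definition qcnj :: "quat \<Rightarrow> quat" where
  "qcnj q = Quat (qre q) (- qi q) (- qj q) (- qk q)"

definition qabs :: "quat \<Rightarrow> real" where
  "qabs q = sqrt ((qre q)\<^sup>2 + (qi q)\<^sup>2 + (qj q)\<^sup>2 + (qk q)\<^sup>2)"

definition qnonneg :: "quat \<Rightarrow> bool" where
  "qnonneg q \<longleftrightarrow> qi q = 0 \<and> qj q = 0 \<and> qk q = 0 \<and> qre q \<ge> 0"

text \<open>The space is a type 'h with its additive group structure; the right scalar
multiplication is sm x q = xq and the inner product is ip.\<close>

definition hnorm :: "('h \<Rightarrow> 'h \<Rightarrow> quat) \<Rightarrow> 'h \<Rightarrow> real" where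
  "hnorm ip u = sqrt (qre (ip u u))"

definition hconv :: "('h::ab_group_add \<Rightarrow> 'h \<Rightarrow> quat) \<Rightarrow> (nat \<Rightarrow> 'h) \<Rightarrow> 'h \<Rightarrow> bool" where
  "hconv ip X l \<longleftrightarrow> (\<lambda>n. hnorm ip (X n - l)) \<longlonglongrightarrow> 0"

definition hcauchy :: "('h::ab_group_add \<Rightarrow> 'h \<Rightarrow> quat) \<Rightarrow> (nat \<Rightarrow> 'h) \<Rightarrow> bool" where
  "hcauchy ip X \<longleftrightarrow> (\<forall>e>0. \<exists>N. \<forall>m\<ge>N. \<forall>n\<ge>N. hnorm ip (X m - X n) < e)"

definition quat_hilbert ::
  "('h::ab_group_add \<Rightarrow> quat \<Rightarrow> 'h) \<Rightarrow> ('h \<Rightarrow> 'h \<Rightarrow> quat) \<Rightarrow> bool" where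
  "quat_hilbert sm ip \<longleftrightarrow>
     \<comment> \<open>right H-module\<close>
     (\<forall>x. sm x 1 = x) \<and>
     (\<forall>x p q. sm (sm x p) q = sm x (p * q)) \<and>
     (\<forall>x y q. sm (x + y) q = sm x q + sm y q) \<and>
     (\<forall>x p q. sm x (p + q) = sm x p + sm x q) \<and>
     \<comment> \<open>inner product\<close>
     (\<forall>u v w p q. ip u (sm v p + sm w q) = ip u v * p + ip u w * q) \<and>
     (\<forall>u v. ip u v = qcnj (ip v u)) \<and>
     (\<forall>u. qnonneg (ip u u)) \<and>
     (\<forall>u. ip u u = 0 \<longleftrightarrow> u = 0) \<and>
     \<comment> \<open>completeness\<close>
     (\<forall>X. hcauchy ip X \<longrightarrow> (\<exists>l. hconv ip X l))"

definition orthonormal_basis ::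
  "('h::ab_group_add \<Rightarrow> 'h \<Rightarrow> quat) \<Rightarrow> nat set \<Rightarrow> (nat \<Rightarrow> 'h) \<Rightarrow> bool" where
  "orthonormal_basis ip I \<phi> \<longleftrightarrow>
     (\<forall>r\<in>I. \<forall>s\<in>I. ip (\<phi> r) (\<phi> s) = (if r = s then 1 else 0)) \<and>
     (\<forall>x. (\<forall>r\<in>I. ip (\<phi> r) x = 0) \<longrightarrow> x = 0)"

definition separable_qh :: "('h::ab_group_add \<Rightarrow> 'h \<Rightarrow> quat) \<Rightarrow> bool" where
  "separable_qh ip \<longleftrightarrow> (\<exists>I \<phi>. orthonormal_basis ip I \<phi>)"

definition right_subspace :: "('h::ab_group_add \<Rightarrow> quat \<Rightarrow> 'h) \<Rightarrow> 'h set \<Rightarrow> bool" where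
  "right_subspace sm D \<longleftrightarrow> 0 \<in> D \<and> (\<forall>x\<in>D. \<forall>y\<in>D. x + y \<in> D) \<and> (\<forall>x\<in>D. \<forall>q. sm x q \<in> D)"

definition right_linear_op ::
  "('h::ab_group_add \<Rightarrow> quat \<Rightarrow> 'h) \<Rightarrow> 'h set \<Rightarrow> ('h \<Rightarrow> 'h) \<Rightarrow> bool" where
  "right_linear_op sm D T \<longleftrightarrow> right_subspace sm D \<and>
     (\<forall>x\<in>D. \<forall>y\<in>D. T (x + y) = T x + T y) \<and> (\<forall>x\<in>D. \<forall>q. T (sm x q) = sm (T x) q)"

definition densely_defined :: "('h::ab_group_add \<Rightarrow> 'h \<Rightarrow> quat) \<Rightarrow> 'h set \<Rightarrow> bool" where
  "densely_defined ip D \<longleftrightarrow> (\<forall>x. \<forall>e>0. \<exists>y\<in>D. hnorm ip (x - y) < e)"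

definition closed_op :: "('h::ab_group_add \<Rightarrow> 'h \<Rightarrow> quat) \<Rightarrow> 'h set \<Rightarrow> ('h \<Rightarrow> 'h) \<Rightarrow> bool" where
  "closed_op ip D T \<longleftrightarrow> (\<forall>X x y. (\<forall>n. X n \<in> D) \<longrightarrow> hconv ip X x \<longrightarrow> hconv ip (\<lambda>n. T (X n)) y
       \<longrightarrow> x \<in> D \<and> T x = y)"

definition adj_dom :: "('h::ab_group_add \<Rightarrow> 'h \<Rightarrow> quat) \<Rightarrow> 'h set \<Rightarrow> ('h \<Rightarrow> 'h) \<Rightarrow> 'h set" where
  "adj_dom ip D T = {y. \<forall>x\<in>D. \<forall>e>0. \<exists>d>0. \<forall>x'\<in>D.
      hnorm ip (x' - x) < d \<longrightarrow> qabs (ip y (T x') - ip y (T x)) < e}"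

definition adj :: "('h::ab_group_add \<Rightarrow> 'h \<Rightarrow> quat) \<Rightarrow> 'h set \<Rightarrow> ('h \<Rightarrow> 'h) \<Rightarrow> 'h \<Rightarrow> 'h" where
  "adj ip D T y = (THE z. \<forall>x\<in>D. ip y (T x) = ip z x)"

definition normal_op :: "('h::ab_group_add \<Rightarrow> 'h \<Rightarrow> quat) \<Rightarrow> 'h set \<Rightarrow> ('h \<Rightarrow> 'h) \<Rightarrow> bool" where
  "normal_op ip D T \<longleftrightarrow>
     {y\<in>adj_dom ip D T. adj ip D T y \<in> D} = {x\<in>D. T x \<in> adj_dom ip D T} \<and>
     (\<forall>x\<in>{x\<in>D. T x \<in> adj_dom ip D T}. T (adj ip D T x) = adj ip D T (T x))"

definition bounded_op :: "('h::ab_group_add \<Rightarrow> quat \<Rightarrow> 'h) \<Rightarrow> ('h \<Rightarrow> 'h \<Rightarrow> quat) \<Rightarrow> ('h \<Rightarrow> 'h) \<Rightarrow> bool" where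
  "bounded_op sm ip K \<longleftrightarrow> right_linear_op sm UNIV K \<and> (\<exists>C. \<forall>x. hnorm ip (K x) \<le> C * hnorm ip x)"

definition op_norm :: "('h::ab_group_add \<Rightarrow> 'h \<Rightarrow> quat) \<Rightarrow> ('h \<Rightarrow> 'h) \<Rightarrow> real" where
  "op_norm ip K = Sup {hnorm ip (K x) | x. hnorm ip x \<le> 1}"

definition precompact_qh :: "('h::ab_group_add \<Rightarrow> 'h \<Rightarrow> quat) \<Rightarrow> 'h set \<Rightarrow> bool" where
  "precompact_qh ip S \<longleftrightarrow> (\<forall>X. (\<forall>n. X n \<in> S) \<longrightarrow> (\<exists>(r::nat\<Rightarrow>nat) l. strict_mono r \<and> hconv ip (X \<circ> r) l))"

definition compact_op :: "('h::ab_group_add \<Rightarrow> quat \<Rightarrow> 'h) \<Rightarrow> ('h \<Rightarrow> 'h \<Rightarrow> quat) \<Rightarrow> ('h \<Rightarrow> 'h) \<Rightarrow> bool" where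
  "compact_op sm ip K \<longleftrightarrow> bounded_op sm ip K \<and>
     (\<forall>S. (\<exists>C. \<forall>x\<in>S. hnorm ip x \<le> C) \<longrightarrow> precompact_qh ip (K ` S))"

definition diagonal_op :: "('h::ab_group_add \<Rightarrow> quat \<Rightarrow> 'h) \<Rightarrow> ('h \<Rightarrow> 'h \<Rightarrow> quat) \<Rightarrow> 'h set \<Rightarrow> ('h \<Rightarrow> 'h) \<Rightarrow> bool" where
  "diagonal_op sm ip D A \<longleftrightarrow> densely_defined ip D \<and> closed_op ip D A \<and> right_linear_op sm D A \<and>
     (\<exists>I \<phi> q. orthonormal_basis ip I \<phi> \<and> (\<forall>r\<in>I. \<phi> r \<in> D \<and> A (\<phi> r) = sm (\<phi> r) (q r)))"

end

theory Submission
  imports Defs "HOL-Library.Diagonal_Subsequence"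
begin

text \<open>
  Let \<open>S = (1 + T*T)\<^sup>-\<^sup>1\<close> and \<open>Z = T S = A + J B\<close> with commuting selfadjoint \<open>A\<close> and \<open>B \<ge> 0\<close> and an
  antiselfadjoint partial isometry \<open>J\<close>. A selfadjoint contraction has a norm convergent binary expansion
  \<open>\<Sum>i. 2\<^sup>-\<^sup>i\<^sup>-\<^sup>1 u\<^sub>i\<close> into commuting involutions, obtained by iterating the modulus; this replaces the
  spectral theorem. Choose finite-dimensional subspaces \<open>F\<^sub>0 \<subseteq> F\<^sub>1 \<subseteq> \<dots>\<close> with dense union in the domain of
  \<open>T\<close> such that \<open>F\<^sub>n\<close> is invariant under \<open>J\<close> and under the first \<open>k\<^sub>n\<close> digits of \<open>A\<close>, \<open>B\<close> and \<open>S\<close>. The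
  orthogonal difference \<open>F\<^sub>n\<^sub>+\<^sub>1 \<ominus> F\<^sub>n\<close> has the same invariance, hence an orthonormal basis of joint eigenvectors
  of these digits and of \<open>J\<close>. On it \<open>T = (A + J B) S\<^sup>-\<^sup>1\<close> differs from the diagonal operator given by the
  truncated expansions by an operator of norm at most \<open>\<epsilon> 2\<^sup>-\<^sup>n\<^sup>-\<^sup>2\<close>, if \<open>k\<^sub>n\<close> is large. The sum of these
  finite-rank errors is \<open>K\<close>.
\<close>

section \<open>Real Hilbert spaces\<close>

text \<open>Two obstacles shape the proof. First, T is unbounded: the error of cutting the
  expansions after finitely many digits is multiplied by the inverse of S. Hence the n-th subspace
  is kept inside a space \<open>L n\<close> on which this inverse is bounded by n + 1, and the
  number of digits is fixed against that bound. Finite-dimensional invariant subspaces exist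
  although T may have no eigenvector, because finitely many commuting involutions, together with a J
  satisfying J^3 = -J, carry a vector into a finite-dimensional space. Second, a right module has no
  scalar multiplication that is right linear and could turn the antiselfadjoint part C into a
  selfadjoint operator. Following C by right multiplication by i gives an operator that is
  selfadjoint but only real linear. So the spectral constructions take place in the underlying real
  Hilbert space, and right linearity is recovered as commutation with right multiplication by i and
  j.\<close>

lemma discriminant_nonpos:
  fixes a b c :: real
  assumes "\<And>t. 0 \<le> a * t\<^sup>2 + 2 * b * t + c" and "0 \<le> a"
  shows "b\<^sup>2 \<le> a * c"
proof (cases "a = 0")
  case True
  have "b = 0"
  proof (rule ccontr)
    assume "b \<noteq> 0"
    then show False
      \<comment> \<open>At this point the affine function 2 b t + c takes the value -1.\<close>
      using assms(1)[of "- (c + 1) / (2 * b)"] True by (simp add: field_simps)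
  qed
  then show ?thesis using True by simp
next
  case False
  then have "0 < a" using assms(2) by simp
  then show ?thesis
    using assms(1)[of "- b / a"] by (simp add: field_simps power2_eq_square)
qed

text \<open>The scalar counterpart of the operator iteration \<open>sqrt_iter\<close> below; being
  monotone and bounded, it supplies the Cauchy estimate there.\<close>

primrec sqrt_bound :: "nat \<Rightarrow> real" where
  "sqrt_bound 0 = 0"
| "sqrt_bound (Suc n) = (1 + (sqrt_bound n)\<^sup>2) / 2"

lemma sqrt_bound_range: "0 \<le> sqrt_bound n \<and> sqrt_bound n \<le> 1"
  by (induction n) (auto simp: power_le_one)

lemma sqrt_bound_step: "sqrt_bound n \<le> sqrt_bound (Suc n)"
proof -
  have "0 \<le> (sqrt_bound n - 1)\<^sup>2" by simp
  then show ?thesis unfolding power2_diff by simp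
qed

lemma sqrt_bound_Cauchy: "Cauchy sqrt_bound"
proof -
  have "Bseq sqrt_bound"
    using sqrt_bound_range by (auto intro!: BseqI'[of _ 1])
  then show ?thesis
    using lift_Suc_mono_le[of sqrt_bound, OF sqrt_bound_step]
    by (intro convergent_Cauchy Bseq_mono_convergent) auto
qed

text \<open>Scalars are real so that right multiplication by any quaternion is itself a linear
  operator and can be tested for commutation. The operations are parameters because the carrier type
  has only its group structure.\<close>

locale real_hilbert = vector_space sc
  for sc :: "real \<Rightarrow> 'h::ab_group_add \<Rightarrow> 'h" (infixr \<open>\<cdot>\<close> 75) +
  fixes inn :: "'h \<Rightarrow> 'h \<Rightarrow> real" (infixl \<open>\<star>\<close> 70)
  assumes inn_commute: "x \<star> y = y \<star> x"
    and inn_add_left: "(x + y) \<star> z = x \<star> z + y \<star> z"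
    and inn_sc_left: "(r \<cdot> x) \<star> y = r * (x \<star> y)"
    and inn_nonneg: "0 \<le> x \<star> x"
    and inn_eq_0: "x \<star> x = 0 \<Longrightarrow> x = 0"
    and complete: "(\<forall>e>0. \<exists>N. \<forall>m\<ge>N. \<forall>n\<ge>N. sqrt ((X m - X n) \<star> (X m - X n)) < e) \<Longrightarrow>
       \<exists>l. (\<lambda>n. sqrt ((X n - l) \<star> (X n - l))) \<longlonglongrightarrow> 0"
begin

definition nrm :: "'h \<Rightarrow> real" where "nrm x = sqrt (x \<star> x)"

definition conv :: "(nat \<Rightarrow> 'h) \<Rightarrow> 'h \<Rightarrow> bool" where
  "conv X l \<longleftrightarrow> (\<lambda>n. nrm (X n - l)) \<longlonglongrightarrow> 0"

lemma inn_add_right: "z \<star> (x + y) = z \<star> x + z \<star> y"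
  by (metis inn_add_left inn_commute)

lemma inn_sc_right: "y \<star> (r \<cdot> x) = r * (y \<star> x)"
  by (metis inn_sc_left inn_commute)

lemma inn_zero_left [simp]: "0 \<star> x = 0"
  using inn_add_left[of 0 0 x] by simp

lemma inn_zero_right [simp]: "x \<star> 0 = 0"
  by (metis inn_commute inn_zero_left)

lemma inn_minus_left: "(- x) \<star> y = - (x \<star> y)"
  using inn_add_left[of "- x" x y] by simp

lemma inn_minus_right: "y \<star> (- x) = - (y \<star> x)"
  by (metis inn_minus_left inn_commute)

lemma inn_diff_left: "(x - y) \<star> z = x \<star> z - y \<star> z"
  using inn_add_left[of x "- y" z] by (simp add: inn_minus_left)

lemma inn_diff_right: "z \<star> (x - y) = z \<star> x - z \<star> y"
  by (metis inn_diff_left inn_commute)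

lemmas inn_simps = inn_add_left inn_add_right inn_diff_left inn_diff_right
  inn_minus_left inn_minus_right inn_sc_left inn_sc_right

lemma inn_ext: "(\<And>y. x \<star> y = z \<star> y) \<Longrightarrow> x = z"
  using inn_eq_0[of "x - z"] by (simp add: inn_simps)

lemma nrm_nonneg [simp]: "0 \<le> nrm x"
  by (simp add: nrm_def inn_nonneg)

lemma nrm_sq: "(nrm x)\<^sup>2 = x \<star> x"
  by (simp add: nrm_def inn_nonneg)

lemma nrm_zero [simp]: "nrm 0 = 0"
  by (simp add: nrm_def)

lemma nrm_eq_0 [simp]: "nrm x = 0 \<longleftrightarrow> x = 0"
  using inn_eq_0 by (auto simp: nrm_def)

lemma nrm_minus [simp]: "nrm (- x) = nrm x"
  by (simp add: nrm_def inn_simps)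

lemma nrm_diff_commute: "nrm (x - y) = nrm (y - x)"
  by (metis minus_diff_eq nrm_minus)

lemma nrm_sc: "nrm (r \<cdot> x) = \<bar>r\<bar> * nrm x"
  by (simp add: nrm_def inn_simps real_sqrt_mult flip: mult.assoc)

lemma cauchy_schwarz: "\<bar>x \<star> y\<bar> \<le> nrm x * nrm y"
proof -
  have "(x \<star> y)\<^sup>2 \<le> (y \<star> y) * (x \<star> x)"
  proof (rule discriminant_nonpos)
    fix t :: real
    have "0 \<le> (x + t \<cdot> y) \<star> (x + t \<cdot> y)" by (rule inn_nonneg)
    then show "0 \<le> y \<star> y * t\<^sup>2 + 2 * (x \<star> y) * t + x \<star> x"
      by (simp add: inn_simps inn_commute[of y x] power2_eq_square algebra_simps)
  qed (rule inn_nonneg)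
  then have "(x \<star> y)\<^sup>2 \<le> (nrm x * nrm y)\<^sup>2"
    by (simp add: power_mult_distrib nrm_sq mult.commute)
  then show ?thesis
    by (metis abs_le_square_iff abs_of_nonneg mult_nonneg_nonneg nrm_nonneg)
qed

lemma inn_le_nrm: "x \<star> y \<le> nrm x * nrm y"
  using cauchy_schwarz[of x y] by linarith

lemma nrm_triangle: "nrm (x + y) \<le> nrm x + nrm y"
proof (rule power2_le_imp_le)
  show "(nrm (x + y))\<^sup>2 \<le> (nrm x + nrm y)\<^sup>2"
    using inn_le_nrm[of x y]
    by (simp add: power2_sum nrm_sq inn_simps inn_commute[of y x])
qed simp

lemma nrm_triangle_diff: "nrm (x - y) \<le> nrm x + nrm y"
  using nrm_triangle[of x "- y"] by simp

lemma nrm_triangle_sub: "nrm x \<le> nrm y + nrm (x - y)"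
  using nrm_triangle[of y "x - y"] by simp

lemma nrm_triangle_mid: "nrm (x - z) \<le> nrm (x - y) + nrm (y - z)"
  using nrm_triangle[of "x - y" "y - z"] by simp

lemma conv_unique: assumes "conv X a" "conv X b" shows "a = b"
proof -
  have "(\<lambda>n. nrm (X n - a) + nrm (X n - b)) \<longlonglongrightarrow> 0 + 0"
    using assms unfolding conv_def by (intro tendsto_add)
  moreover have "nrm (a - b) \<le> nrm (X n - a) + nrm (X n - b)" for n
    using nrm_triangle_mid[of a b "X n"] by (simp add: nrm_diff_commute[of a])
  ultimately have "nrm (a - b) \<le> 0"
    by (metis (no_types, lifting) LIMSEQ_le_const add_0)
  then show ?thesis by (metis eq_iff_diff_eq_0 nrm_eq_0 nrm_nonneg order_antisym)
qed

lemma conv_const: "conv (\<lambda>n. x) x"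
  by (simp add: conv_def)

lemma conv_squeeze:
  assumes "\<And>n. nrm (X n - l) \<le> f n" and "f \<longlonglongrightarrow> 0"
  shows "conv X l"
  unfolding conv_def
  by (rule tendsto_sandwich[OF _ _ tendsto_const assms(2)]) (auto simp: assms(1))

lemma conv_add: assumes "conv X a" "conv Y b" shows "conv (\<lambda>n. X n + Y n) (a + b)"
proof (rule conv_squeeze)
  show "nrm (X n + Y n - (a + b)) \<le> nrm (X n - a) + nrm (Y n - b)" for n
    using nrm_triangle[of "X n - a" "Y n - b"] by (simp add: algebra_simps)
  show "(\<lambda>n. nrm (X n - a) + nrm (Y n - b)) \<longlonglongrightarrow> 0"
    using tendsto_add[OF assms[unfolded conv_def]] by simp
qed

lemma conv_sc: assumes "conv X a" shows "conv (\<lambda>n. r \<cdot> X n) (r \<cdot> a)"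
proof (rule conv_squeeze)
  show "nrm (r \<cdot> X n - r \<cdot> a) \<le> \<bar>r\<bar> * nrm (X n - a)" for n
    by (simp add: nrm_sc flip: scale_right_diff_distrib)
  show "(\<lambda>n. \<bar>r\<bar> * nrm (X n - a)) \<longlonglongrightarrow> 0"
    using tendsto_mult_left[OF assms[unfolded conv_def], of "\<bar>r\<bar>"] by simp
qed

lemma conv_minus: "conv X a \<Longrightarrow> conv (\<lambda>n. - X n) (- a)"
  using conv_sc[of X a "- 1"] by simp

lemma conv_diff: "conv X a \<Longrightarrow> conv Y b \<Longrightarrow> conv (\<lambda>n. X n - Y n) (a - b)"
  using conv_add[of X a "\<lambda>n. - Y n" "- b"] conv_minus[of Y b] by simp

lemma conv_inn: assumes "conv X a" shows "(\<lambda>n. X n \<star> y) \<longlonglongrightarrow> a \<star> y"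
proof -
  have "(\<lambda>n. nrm (X n - a) * nrm y) \<longlonglongrightarrow> 0"
    using tendsto_mult_right[OF assms[unfolded conv_def], of "nrm y"] by simp
  moreover have "norm (X n \<star> y - a \<star> y) \<le> nrm (X n - a) * nrm y" for n
    using cauchy_schwarz[of "X n - a" y] by (simp add: inn_simps)
  ultimately have "(\<lambda>n. X n \<star> y - a \<star> y) \<longlonglongrightarrow> 0"
    by (metis (no_types, lifting) Lim_null_comparison always_eventually)
  then show ?thesis by (simp add: LIM_zero_iff)
qed

lemma conv_inn_right: "conv X a \<Longrightarrow> (\<lambda>n. y \<star> X n) \<longlonglongrightarrow> y \<star> a"
  using conv_inn[of X a y] by (simp add: inn_commute)

lemma conv_nrm: assumes "conv X a" shows "(\<lambda>n. nrm (X n)) \<longlonglongrightarrow> nrm a"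
proof -
  have "norm (nrm (X n) - nrm a) \<le> nrm (X n - a)" for n
    using nrm_triangle_sub[of "X n" a] nrm_triangle_sub[of a "X n"] nrm_diff_commute[of a "X n"]
    by (simp add: abs_le_iff)
  then have "(\<lambda>n. nrm (X n) - nrm a) \<longlonglongrightarrow> 0"
    using assms[unfolded conv_def] by (metis (no_types, lifting) Lim_null_comparison always_eventually)
  then show ?thesis by (simp add: LIM_zero_iff)
qed

lemma cauchy_conv:
  assumes "\<And>e. 0 < e \<Longrightarrow> \<exists>N. \<forall>m\<ge>N. \<forall>n\<ge>N. nrm (X m - X n) < e"
  shows "\<exists>l. conv X l"
  using complete[of X] assms unfolding conv_def nrm_def by blast

section \<open>Bounded real-linear operators\<close>

definition lin :: "('h \<Rightarrow> 'h) \<Rightarrow> bool" where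
  "lin f \<longleftrightarrow> (\<forall>x y. f (x + y) = f x + f y) \<and> (\<forall>r x. f (r \<cdot> x) = r \<cdot> f x)"

definition bop :: "('h \<Rightarrow> 'h) \<Rightarrow> bool" where
  "bop f \<longleftrightarrow> lin f \<and> (\<exists>C. \<forall>x. nrm (f x) \<le> C * nrm x)"

lemma linD:
  assumes "lin f"
  shows "f (x + y) = f x + f y" "f (r \<cdot> x) = r \<cdot> f x" "f (x - y) = f x - f y"
    "f (- x) = - f x" "f 0 = 0"
proof -
  show a: "f (x + y) = f x + f y" and s: "f (r \<cdot> x) = r \<cdot> f x" for x y r
    using assms by (auto simp: lin_def)
  show z: "f 0 = 0" using a[of 0 0] by simp
  show m: "f (- x) = - f x" for x
    using a[of x "- x"] z by (simp add: eq_neg_iff_add_eq_0 add.commute)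
  show "f (x - y) = f x - f y" using a[of x "- y"] m by simp
qed

lemma lin_sum: "lin f \<Longrightarrow> f (sum g A) = (\<Sum>a\<in>A. f (g a))"
  by (induction A rule: infinite_finite_induct) (auto simp: linD)

lemma bop_lin: "bop f \<Longrightarrow> lin f"
  by (simp add: bop_def)

lemmas bopD = linD[OF bop_lin]

lemma bop_bound: assumes "bop f" obtains C where "0 \<le> C" "\<And>x. nrm (f x) \<le> C * nrm x"
proof -
  obtain C where C: "\<And>x. nrm (f x) \<le> C * nrm x" using assms by (auto simp: bop_def)
  have "nrm (f x) \<le> max 0 C * nrm x" for x
    using C[of x] mult_right_mono[of C "max 0 C" "nrm x"] by force
  then show ?thesis using that[of "max 0 C"] by simp
qed

lemma bop_conv: assumes "bop f" "conv X a" shows "conv (\<lambda>n. f (X n)) (f a)"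
proof -
  obtain C where C: "0 \<le> C" "\<And>x. nrm (f x) \<le> C * nrm x" using bop_bound[OF assms(1)] by blast
  show ?thesis
  proof (rule conv_squeeze)
    show "nrm (f (X n) - f a) \<le> C * nrm (X n - a)" for n
      using C(2)[of "X n - a"] by (simp add: bopD[OF assms(1)])
    show "(\<lambda>n. C * nrm (X n - a)) \<longlonglongrightarrow> 0"
      using tendsto_mult_left[OF assms(2)[unfolded conv_def], of C] by simp
  qed
qed

lemma bopI:
  assumes "\<And>x y. f (x + y) = f x + f y" "\<And>r x. f (r \<cdot> x) = r \<cdot> f x"
    "\<And>x. nrm (f x) \<le> C * nrm x"
  shows "bop f"
  using assms unfolding bop_def lin_def by blast

lemma bop_id: "bop (\<lambda>x. x)"
  by (rule bopI[where C = 1]) auto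

lemma bop_add: assumes "bop f" "bop g" shows "bop (\<lambda>x. f x + g x)"
proof -
  obtain C where C: "\<And>x. nrm (f x) \<le> C * nrm x" using bop_bound[OF assms(1)] by blast
  obtain D where D: "\<And>x. nrm (g x) \<le> D * nrm x" using bop_bound[OF assms(2)] by blast
  show ?thesis
  proof (rule bopI)
    show "nrm (f x + g x) \<le> (C + D) * nrm x" for x
      using nrm_triangle[of "f x" "g x"] C[of x] D[of x] by (simp add: algebra_simps)
  qed (simp_all add: bopD[OF assms(1)] bopD[OF assms(2)] algebra_simps)
qed

lemma bop_sc: assumes "bop f" shows "bop (\<lambda>x. r \<cdot> f x)"
proof -
  obtain C where C: "\<And>x. nrm (f x) \<le> C * nrm x" using bop_bound[OF assms] by blast
  show ?thesis
  proof (rule bopI)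
    show "nrm (r \<cdot> f x) \<le> (\<bar>r\<bar> * C) * nrm x" for x
      using mult_left_mono[OF C[of x], of "\<bar>r\<bar>"] by (simp add: nrm_sc mult.assoc)
  qed (simp_all add: bopD[OF assms] algebra_simps)
qed

lemma bop_minus: "bop f \<Longrightarrow> bop (\<lambda>x. - f x)"
  using bop_sc[of f "- 1"] by simp

lemma bop_diff: "bop f \<Longrightarrow> bop g \<Longrightarrow> bop (\<lambda>x. f x - g x)"
  using bop_add[of f "\<lambda>x. - g x"] bop_minus[of g] by simp

lemma bop_comp: assumes "bop f" "bop g" shows "bop (\<lambda>x. f (g x))"
proof -
  obtain C where C: "0 \<le> C" "\<And>x. nrm (f x) \<le> C * nrm x" using bop_bound[OF assms(1)] by blast
  obtain D where D: "\<And>x. nrm (g x) \<le> D * nrm x" using bop_bound[OF assms(2)] by blast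
  show ?thesis
  proof (rule bopI)
    show "nrm (f (g x)) \<le> (C * D) * nrm x" for x
      using C(2)[of "g x"] mult_left_mono[OF D[of x] C(1)] by (simp add: mult.assoc)
  qed (simp_all add: bopD[OF assms(1)] bopD[OF assms(2)])
qed

lemma bop_sum: "(\<And>a. a \<in> A \<Longrightarrow> bop (f a)) \<Longrightarrow> bop (\<lambda>x. \<Sum>a\<in>A. f a x)"
proof (induction A rule: infinite_finite_induct)
  case (insert a A)
  then show ?case using bop_add[of "f a" "\<lambda>x. \<Sum>a\<in>A. f a x"] by simp
qed (auto intro: bopI[where C = 0])

text \<open>Minimising \<open>b x x - 2 f x\<close> over the domain; the minimising sequence is Cauchy
  by the parallelogram law.\<close>

lemma riesz_sequence:
  fixes b :: "'h \<Rightarrow> 'h \<Rightarrow> real" and f :: "'h \<Rightarrow> real"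
  assumes D: "0 \<in> D" "\<And>x y. x \<in> D \<Longrightarrow> y \<in> D \<Longrightarrow> x + y \<in> D" "\<And>r x. x \<in> D \<Longrightarrow> r \<cdot> x \<in> D"
    and b_add: "\<And>x y z. x \<in> D \<Longrightarrow> y \<in> D \<Longrightarrow> z \<in> D \<Longrightarrow> b (x + y) z = b x z + b y z"
    and b_sc: "\<And>r x y. x \<in> D \<Longrightarrow> y \<in> D \<Longrightarrow> b (r \<cdot> x) y = r * b x y"
    and b_comm: "\<And>x y. x \<in> D \<Longrightarrow> y \<in> D \<Longrightarrow> b x y = b y x"
    and b_nonneg: "\<And>x. x \<in> D \<Longrightarrow> 0 \<le> b x x"
    and f_add: "\<And>x y. x \<in> D \<Longrightarrow> y \<in> D \<Longrightarrow> f (x + y) = f x + f y"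
    and f_sc: "\<And>r x. x \<in> D \<Longrightarrow> f (r \<cdot> x) = r * f x"
    and f_bound: "\<And>x. x \<in> D \<Longrightarrow> \<bar>f x\<bar> \<le> C * sqrt (b x x)"
  shows "\<exists>X. (\<forall>n. X n \<in> D) \<and>
    (\<forall>e>0. \<exists>N. \<forall>m\<ge>N. \<forall>n\<ge>N. b (X m - X n) (X m - X n) < e) \<and>
    (\<forall>y\<in>D. (\<lambda>n. b (X n) y) \<longlonglongrightarrow> f y)"
proof -
  define \<Phi> where "\<Phi> x = b x x - 2 * f x" for x
  define m where "m = Inf (\<Phi> ` D)"
  have b_add2: "b z (x + y) = b z x + b z y" if "x \<in> D" "y \<in> D" "z \<in> D" for x y z
    using b_add[of x y z] b_comm[of z "x + y"] b_comm[of z x] b_comm[of z y] D that by simp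
  have b_sc2: "b y (r \<cdot> x) = r * b y x" if "x \<in> D" "y \<in> D" for x y r
    using b_sc[of x y r] b_comm[of y "r \<cdot> x"] b_comm[of y x] D that by simp
  have below: "- C\<^sup>2 \<le> \<Phi> x" if "x \<in> D" for x
  proof -
    have "0 \<le> (sqrt (b x x) - C)\<^sup>2" by simp
    then have "2 * (C * sqrt (b x x)) \<le> b x x + C\<^sup>2"
      by (simp add: power2_diff b_nonneg that algebra_simps)
    then show ?thesis using f_bound[OF that] by (simp add: \<Phi>_def)
  qed
  have bdd: "bdd_below (\<Phi> ` D)" using below by (auto intro!: bdd_belowI2)
  have m_le: "m \<le> \<Phi> x" if "x \<in> D" for x
    unfolding m_def using that bdd by (auto intro: cInf_lower)
  have "\<exists>x\<in>D. \<Phi> x < m + inverse (Suc n)" for n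
  proof -
    have "Inf (\<Phi> ` D) < m + inverse (Suc n)" by (simp add: m_def)
    then show ?thesis using cInf_lessD[of "\<Phi> ` D"] D(1) by fastforce
  qed
  then obtain X where X: "\<And>n. X n \<in> D" "\<And>n. \<Phi> (X n) < m + inverse (Suc n)" by metis
  have close: "b (x - y) (x - y) \<le> 2 * (\<Phi> x - m) + 2 * (\<Phi> y - m)" if "x \<in> D" "y \<in> D" for x y
  proof -
    have mD: "(- 1) \<cdot> y \<in> D" using D(3)[OF that(2), of "- 1"] by simp
    have "m \<le> \<Phi> ((1/2) \<cdot> (x + y))" using m_le D that by blast
    also have "\<dots> = (b x x + 2 * b x y + b y y) / 4 - (f x + f y)"
      using D that b_comm[of y x]
      by (simp add: \<Phi>_def b_sc b_sc2 b_add b_add2 f_add f_sc field_simps del: scale_right_distrib)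
    finally have 1: "m \<le> (b x x + 2 * b x y + b y y) / 4 - (f x + f y)" .
    have "b (x - y) (x - y) = b (x + (- 1) \<cdot> y) (x + (- 1) \<cdot> y)" by simp
    also have "\<dots> = b x x - 2 * b x y + b y y"
      using that mD b_comm[of y x] D by (simp only: b_sc b_sc2 b_add b_add2) simp
    finally show ?thesis using 1 unfolding \<Phi>_def by argo
  qed
  have "\<exists>N. \<forall>k\<ge>N. \<forall>n\<ge>N. b (X k - X n) (X k - X n) < e" if "e > 0" for e
  proof -
    obtain N where N: "inverse (real (Suc N)) < e / 4"
      using reals_Archimedean[of "e / 4"] \<open>e > 0\<close> by auto
    have small: "\<Phi> (X k) - m < e / 4" if "k \<ge> N" for k
    proof -
      have "inverse (real (Suc k)) \<le> inverse (real (Suc N))" using that by (simp add: field_simps)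
      then have "inverse (real (Suc k)) < e / 4" using N by (rule le_less_trans)
      then show ?thesis using X(2)[of k] by linarith
    qed
    have "b (X k - X n) (X k - X n) < e" if "k \<ge> N" "n \<ge> N" for k n
      using close[OF X(1) X(1), of k n] small[OF that(1)] small[OF that(2)] by argo
    then show ?thesis by blast
  qed
  moreover have "(\<lambda>n. b (X n) y) \<longlonglongrightarrow> f y" if "y \<in> D" for y
  proof -
    \<comment> \<open>\<open>X n\<close> minimises \<open>\<Phi>\<close> up to
      \<open>inverse (Suc n)\<close>, so moving along y cannot lower the value by more; the
      discriminant of the resulting quadratic bounds the defect in the weak equation.\<close>
    have sq: "(b (X n) y - f y)\<^sup>2 \<le> b y y * inverse (Suc n)" for n
    proof (rule discriminant_nonpos)
      fix t :: real
      have "m \<le> \<Phi> (X n + t \<cdot> y)" using m_le D that X(1) by blast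
      also have "\<dots> = \<Phi> (X n) + 2 * t * (b (X n) y - f y) + t\<^sup>2 * b y y"
        using D that X(1)[of n] b_comm[of y "X n"]
        by (simp add: \<Phi>_def b_sc b_sc2 b_add b_add2 f_add f_sc algebra_simps power2_eq_square)
      finally show "0 \<le> b y y * t\<^sup>2 + 2 * (b (X n) y - f y) * t + inverse (Suc n)"
        using X(2)[of n] by (simp add: algebra_simps)
    qed (use b_nonneg that in auto)
    have "(\<lambda>n. (b (X n) y - f y)\<^sup>2) \<longlonglongrightarrow> 0"
    proof (rule tendsto_sandwich[OF _ _ tendsto_const])
      show "(\<lambda>n. b y y * inverse (Suc n)) \<longlonglongrightarrow> 0"
        using tendsto_mult_left[OF LIMSEQ_inverse_real_of_nat, of "b y y"] by simp
    qed (use sq in auto)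
    then have "(\<lambda>n. b (X n) y - f y) \<longlonglongrightarrow> 0"
      using tendsto_real_sqrt[of "\<lambda>n. (b (X n) y - f y)\<^sup>2" 0] by (simp add: tendsto_rabs_zero_iff)
    then show ?thesis by (simp add: LIM_zero_iff)
  qed
  ultimately show ?thesis using X(1) by blast
qed

subsection \<open>Projections and bicommutants\<close>

definition clsub :: "'h set \<Rightarrow> bool" where
  "clsub M \<longleftrightarrow> 0 \<in> M \<and> (\<forall>x\<in>M. \<forall>y\<in>M. x + y \<in> M) \<and> (\<forall>r. \<forall>x\<in>M. r \<cdot> x \<in> M) \<and>
    (\<forall>X l. (\<forall>n. X n \<in> M) \<longrightarrow> conv X l \<longrightarrow> l \<in> M)"

definition proj :: "'h set \<Rightarrow> 'h \<Rightarrow> 'h" where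
  "proj M x = (SOME z. z \<in> M \<and> (\<forall>y\<in>M. z \<star> y = x \<star> y))"

text \<open>The projection of x is the Riesz representative on M of the functional given by x;
  closedness of M keeps the limit inside M.\<close>

lemma proj_ex:
  assumes "clsub M"
  shows "\<exists>z. z \<in> M \<and> (\<forall>y\<in>M. z \<star> y = x \<star> y)"
proof -
  have "\<exists>X. (\<forall>n. X n \<in> M) \<and>
    (\<forall>e>0. \<exists>N. \<forall>m\<ge>N. \<forall>n\<ge>N. (X m - X n) \<star> (X m - X n) < e) \<and>
    (\<forall>y\<in>M. (\<lambda>n. X n \<star> y) \<longlonglongrightarrow> x \<star> y)"
    using assms cauchy_schwarz
    by (intro riesz_sequence[where C = "nrm x"]) (auto simp: clsub_def inn_simps inn_nonneg nrm_def intro: inn_commute)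
  then obtain X where X: "\<And>n. X n \<in> M"
    "\<And>e. e > 0 \<Longrightarrow> \<exists>N. \<forall>m\<ge>N. \<forall>n\<ge>N. (X m - X n) \<star> (X m - X n) < e"
    "\<And>y. y \<in> M \<Longrightarrow> (\<lambda>n. X n \<star> y) \<longlonglongrightarrow> x \<star> y" by blast
  have "\<exists>l. conv X l"
  proof (rule cauchy_conv)
    fix e :: real assume "0 < e"
    then obtain N where "\<forall>m\<ge>N. \<forall>n\<ge>N. (X m - X n) \<star> (X m - X n) < e\<^sup>2"
      using X(2)[of "e\<^sup>2"] by auto
    then have "\<forall>m\<ge>N. \<forall>n\<ge>N. nrm (X m - X n) < e"
      using \<open>0 < e\<close> by (simp add: nrm_def real_less_lsqrt)
    then show "\<exists>N. \<forall>m\<ge>N. \<forall>n\<ge>N. nrm (X m - X n) < e" by blast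
  qed
  then obtain l where l: "conv X l" by blast
  then have "l \<in> M" using assms X(1) unfolding clsub_def by blast
  moreover have "l \<star> y = x \<star> y" if "y \<in> M" for y
    using conv_inn[OF l, of y] X(3)[OF that] LIMSEQ_unique by blast
  ultimately show ?thesis by blast
qed

context
  fixes M assumes M: "clsub M"
begin

lemma proj_in: "proj M x \<in> M" and proj_inn: "y \<in> M \<Longrightarrow> proj M x \<star> y = x \<star> y"
  using someI_ex[OF proj_ex[OF M, of x]] unfolding proj_def by auto

lemma proj_unique:
  assumes "z \<in> M" "\<And>y. y \<in> M \<Longrightarrow> z \<star> y = x \<star> y"
  shows "proj M x = z"
proof -
  have "z + (- 1) \<cdot> proj M x \<in> M"
    using M assms(1) proj_in[of x] unfolding clsub_def by blast
  then have *: "z - proj M x \<in> M" by simp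
  have "(z - proj M x) \<star> (z - proj M x) = 0"
    using assms(2)[OF *] proj_inn[OF *, of x] by (simp add: inn_diff_left)
  then show ?thesis using inn_eq_0 by (metis eq_iff_diff_eq_0)
qed

lemma proj_fix: "x \<in> M \<Longrightarrow> proj M x = x"
  by (rule proj_unique) auto

lemma proj_idem: "proj M (proj M x) = proj M x"
  by (simp add: proj_fix proj_in)

lemma proj_inn_right: "y \<in> M \<Longrightarrow> y \<star> proj M x = y \<star> x"
  by (metis proj_inn inn_commute)

lemma proj_sym: "proj M x \<star> y = x \<star> proj M y"
  using proj_inn[OF proj_in, of x y] proj_inn_right[OF proj_in, of x y] by simp

lemma proj_contr: "nrm (proj M x) \<le> nrm x"
proof -
  have "nrm (proj M x) * nrm (proj M x) = proj M x \<star> proj M x"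
    by (simp flip: nrm_sq add: power2_eq_square)
  also have "\<dots> = x \<star> proj M x" by (simp add: proj_inn proj_in)
  also have "\<dots> \<le> nrm x * nrm (proj M x)" by (rule inn_le_nrm)
  finally show ?thesis
    by (metis mult_le_cancel_right nrm_nonneg order_le_less)
qed

lemma proj_bop: "bop (proj M)"
proof (rule bopI[where C = 1])
  show "proj M (x + y) = proj M x + proj M y" for x y
    by (rule proj_unique) (use M proj_in in \<open>auto simp: clsub_def inn_add_left proj_inn\<close>)
  show "proj M (r \<cdot> x) = r \<cdot> proj M x" for r x
    by (rule proj_unique) (use M proj_in in \<open>auto simp: clsub_def inn_sc_left proj_inn\<close>)
qed (simp add: proj_contr)

end

text \<open>For y in N the vector U y lies in M, so U can be moved across the inner product and
  back. The case M = N yields commutation with a projection; distinct M and N serve an operator that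
  exchanges two eigenspaces.\<close>

lemma proj_intertwine:
  assumes "clsub M" "clsub N" "\<And>x. x \<in> M \<Longrightarrow> U x \<in> N" "\<And>x. x \<in> N \<Longrightarrow> U x \<in> M"
    and "\<And>x y. U x \<star> y = \<eta> * (x \<star> U y)"
  shows "proj N (U x) = U (proj M x)"
  using assms by (intro proj_unique) (auto simp: proj_in proj_inn)

lemma clsub_ker: assumes "bop f" shows "clsub {x. f x = 0}"
proof -
  have "f l = 0" if "\<And>n. f (X n) = 0" "conv X l" for X l
    using bop_conv[OF assms that(2)] that(1) conv_const[of 0] conv_unique by fastforce
  then show ?thesis by (auto simp: clsub_def bopD[OF assms])
qed

section \<open>Bicommutants in place of a functional calculus\<close>

definition selfadj :: "('h \<Rightarrow> 'h) \<Rightarrow> bool" where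
  "selfadj f \<longleftrightarrow> bop f \<and> (\<forall>x y. f x \<star> y = x \<star> f y)"

definition contr :: "('h \<Rightarrow> 'h) \<Rightarrow> bool" where
  "contr f \<longleftrightarrow> (\<forall>x. nrm (f x) \<le> nrm x)"

text \<open>Testing the commutant only on operators whose adjoint is a multiple of themselves avoids
  constructing adjoints; selfadjoint operators and multiplication by imaginary units are of this kind.\<close>

definition adjpm :: "('h \<Rightarrow> 'h) \<Rightarrow> bool" where
  "adjpm f \<longleftrightarrow> bop f \<and> (\<exists>\<eta>. \<forall>x y. f x \<star> y = \<eta> * (x \<star> f y))"

definition cmt :: "('h \<Rightarrow> 'h) \<Rightarrow> ('h \<Rightarrow> 'h) \<Rightarrow> bool" where
  "cmt f g \<longleftrightarrow> (\<forall>x. f (g x) = g (f x))"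

definition bicom :: "('h \<Rightarrow> 'h) \<Rightarrow> ('h \<Rightarrow> 'h) \<Rightarrow> bool" where
  "bicom W f \<longleftrightarrow> (\<forall>U. adjpm U \<longrightarrow> cmt U W \<longrightarrow> cmt U f)"

lemma selfadj_bop: "selfadj f \<Longrightarrow> bop f"
  by (simp add: selfadj_def)

lemma selfadj_adjpm: "selfadj f \<Longrightarrow> adjpm f"
  unfolding selfadj_def adjpm_def by (metis mult_1)

lemma adjpm_bop: "adjpm f \<Longrightarrow> bop f"
  by (simp add: adjpm_def)

lemma selfadj_inn: "selfadj f \<Longrightarrow> f x \<star> y = x \<star> f y"
  by (simp add: selfadj_def)

lemma bicomD: "bicom W f \<Longrightarrow> adjpm U \<Longrightarrow> cmt U W \<Longrightarrow> U (f x) = f (U x)"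
  by (simp add: bicom_def cmt_def)

lemma bicom_self: "bicom W W"
  by (simp add: bicom_def)

lemma bicom_trans: "bicom W f \<Longrightarrow> bicom f g \<Longrightarrow> bicom W g"
  by (simp add: bicom_def)

lemma bicom_id: "bicom W (\<lambda>x. x)"
  by (simp add: bicom_def cmt_def)

lemma bicom_add: "bicom W f \<Longrightarrow> bicom W g \<Longrightarrow> bicom W (\<lambda>x. f x + g x)"
  by (simp add: bicom_def cmt_def bopD[OF adjpm_bop])

lemma bicom_diff: "bicom W f \<Longrightarrow> bicom W g \<Longrightarrow> bicom W (\<lambda>x. f x - g x)"
  by (simp add: bicom_def cmt_def bopD[OF adjpm_bop])

lemma bicom_sc: "bicom W f \<Longrightarrow> bicom W (\<lambda>x. r \<cdot> f x)"
  by (simp add: bicom_def cmt_def bopD[OF adjpm_bop])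

lemma bicom_comp: "bicom W f \<Longrightarrow> bicom W g \<Longrightarrow> bicom W (\<lambda>x. f (g x))"
  by (simp add: bicom_def cmt_def)

text \<open>The bicommutant is used twice: Y commutes with X, hence with f; then f commutes with Y,
  hence with g. So functions of two commuting selfadjoint operators commute.\<close>

lemma bicom_cross:
  assumes "selfadj Y" "cmt Y X" "bicom X f" "selfadj f" "bicom Y g"
  shows "f (g x) = g (f x)"
proof -
  have "cmt f Y" using assms(1-3) by (simp add: bicom_def cmt_def selfadj_adjpm)
  then show ?thesis using bicomD[OF assms(5) selfadj_adjpm[OF assms(4)]] by simp
qed

lemma bicom_cmt:
  assumes "bicom W f" "bicom W g" "selfadj W" "selfadj f"
  shows "f (g x) = g (f x)"
  using bicom_cross[OF assms(3) _ assms(1,4,2)] by (simp add: cmt_def)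

lemma selfadj_id: "selfadj (\<lambda>x. x)"
  by (simp add: selfadj_def bop_id)

lemma selfadj_add: "selfadj f \<Longrightarrow> selfadj g \<Longrightarrow> selfadj (\<lambda>x. f x + g x)"
  by (simp add: selfadj_def bop_add inn_simps)

lemma selfadj_diff: "selfadj f \<Longrightarrow> selfadj g \<Longrightarrow> selfadj (\<lambda>x. f x - g x)"
  by (simp add: selfadj_def bop_diff inn_simps)

lemma selfadj_sc: "selfadj f \<Longrightarrow> selfadj (\<lambda>x. r \<cdot> f x)"
  by (simp add: selfadj_def bop_sc inn_simps)

lemma selfadj_comp:
  "selfadj f \<Longrightarrow> selfadj g \<Longrightarrow> (\<And>x. f (g x) = g (f x)) \<Longrightarrow> selfadj (\<lambda>x. f (g x))"
  by (simp add: selfadj_def bop_comp)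

lemma selfadj_sq: "selfadj f \<Longrightarrow> selfadj (\<lambda>x. f (f x))"
  by (rule selfadj_comp) auto

lemma selfadj_proj: "clsub M \<Longrightarrow> selfadj (proj M)"
  by (simp add: selfadj_def proj_bop proj_sym)

subsection \<open>Square roots, moduli and signs\<close>

text \<open>The iteration increases to \<open>1 - sqrt (1 - X)\<close>. It converges in norm because its increments are
  dominated by those of the scalar iteration \<open>sqrt_bound\<close>, the case \<open>X = 1\<close>.\<close>

primrec sqrt_iter :: "('h \<Rightarrow> 'h) \<Rightarrow> nat \<Rightarrow> 'h \<Rightarrow> 'h" where
  "sqrt_iter X 0 = (\<lambda>x. 0)"
| "sqrt_iter X (Suc n) = (\<lambda>x. (1/2) \<cdot> (X x + sqrt_iter X n (sqrt_iter X n x)))"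

lemma selfadj_sqrt_iter: "selfadj X \<Longrightarrow> selfadj (sqrt_iter X n)"
proof (induction n)
  case 0
  show ?case by (auto simp: selfadj_def intro: bopI[where C = 0])
next
  case (Suc n)
  then show ?case unfolding sqrt_iter.simps by (intro selfadj_sc selfadj_add selfadj_sq)
qed

lemma bicom_sqrt_iter: "selfadj X \<Longrightarrow> bicom X (sqrt_iter X n)"
proof (induction n)
  case 0
  show ?case by (auto simp: bicom_def cmt_def bopD[OF adjpm_bop])
next
  case (Suc n)
  then show ?case unfolding sqrt_iter.simps
    by (intro bicom_sc bicom_add bicom_comp[of X "sqrt_iter X n" "sqrt_iter X n"] bicom_self)
qed

lemma sqrt_iter_bound:
  assumes "selfadj X" "contr X"
  shows "nrm (sqrt_iter X n x) \<le> sqrt_bound n * nrm x"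
proof (induction n arbitrary: x)
  case (Suc n)
  have "nrm (sqrt_iter X n (sqrt_iter X n x)) \<le> sqrt_bound n * (sqrt_bound n * nrm x)"
    using Suc[of "sqrt_iter X n x"] mult_left_mono[OF Suc[of x], of "sqrt_bound n"] sqrt_bound_range[of n]
    by linarith
  moreover have "nrm (X x) \<le> nrm x" using assms(2) by (simp add: contr_def)
  ultimately show ?case
    using nrm_triangle[of "X x" "sqrt_iter X n (sqrt_iter X n x)"]
    by (simp add: nrm_sc power2_eq_square mult.assoc distrib_right del: scale_right_distrib)
qed simp

lemma sqrt_iter_step:
  assumes "selfadj X" "contr X"
  shows "nrm (sqrt_iter X (Suc n) x - sqrt_iter X n x) \<le> (sqrt_bound (Suc n) - sqrt_bound n) * nrm x"
proof (induction n arbitrary: x)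
  case 0
  have "nrm (X x) \<le> nrm x" using assms(2) by (simp add: contr_def)
  then show ?case by (simp add: nrm_sc)
next
  case (Suc n)
  let ?Y = "sqrt_iter X (Suc n)" and ?Z = "sqrt_iter X n"
  let ?a = "sqrt_bound (Suc n)" and ?b = "sqrt_bound n"
  have lin: "?Y (u - v) = ?Y u - ?Y v" for u v
    by (rule bopD[OF selfadj_bop[OF selfadj_sqrt_iter[OF assms(1)]]])
  have "sqrt_iter X (Suc (Suc n)) x - ?Y x = (1/2) \<cdot> (X x + ?Y (?Y x)) - (1/2) \<cdot> (X x + ?Z (?Z x))"
    by simp
  also have "\<dots> = (1/2) \<cdot> (?Y (?Y x) - ?Z (?Z x))"
    by (simp only: flip: scale_right_diff_distrib) simp
  \<comment> \<open>With Y and Z the two iterates, Y^2 - Z^2 = Y (Y - Z) + (Y - Z) Z, matching a^2 -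
    b^2 = a (a - b) + (a - b) b for the scalar bounds.\<close>
  also have "\<dots> = (1/2) \<cdot> (?Y (?Y x - ?Z x) + (?Y (?Z x) - ?Z (?Z x)))"
    by (simp only: lin) simp
  finally have eq: "sqrt_iter X (Suc (Suc n)) x - ?Y x
      = (1/2) \<cdot> (?Y (?Y x - ?Z x) + (?Y (?Z x) - ?Z (?Z x)))" .
  have d: "0 \<le> ?a - ?b" using sqrt_bound_step[of n] by simp
  have "nrm (?Y (?Y x - ?Z x)) \<le> ?a * ((?a - ?b) * nrm x)"
    using sqrt_iter_bound[OF assms, of "Suc n" "?Y x - ?Z x"] mult_left_mono[OF Suc[of x], of ?a]
      sqrt_bound_range[of "Suc n"] by linarith
  moreover have "nrm (?Y (?Z x) - ?Z (?Z x)) \<le> (?a - ?b) * (?b * nrm x)"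
    using Suc[of "?Z x"] mult_left_mono[OF sqrt_iter_bound[OF assms, of n x] d] by linarith
  ultimately have "nrm (?Y (?Y x - ?Z x) + (?Y (?Z x) - ?Z (?Z x)))
      \<le> ?a * ((?a - ?b) * nrm x) + (?a - ?b) * (?b * nrm x)"
    using nrm_triangle[of "?Y (?Y x - ?Z x)" "?Y (?Z x) - ?Z (?Z x)"] by linarith
  also have "\<dots> = (?a\<^sup>2 - ?b\<^sup>2) * nrm x"
    by (simp add: power2_eq_square algebra_simps del: sqrt_bound.simps)
  finally have 1: "nrm (sqrt_iter X (Suc (Suc n)) x - ?Y x) \<le> (1/2) * ((?a\<^sup>2 - ?b\<^sup>2) * nrm x)"
    unfolding eq nrm_sc by simp
  have 2: "sqrt_bound (Suc (Suc n)) - ?a = (?a\<^sup>2 - ?b\<^sup>2) / 2"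
    by (simp only: sqrt_bound.simps) (simp add: field_simps)
  show ?case using 1 unfolding 2 by (simp del: sqrt_iter.simps sqrt_bound.simps)
qed

lemma sqrt_iter_diff:
  assumes "selfadj X" "contr X" "n \<le> m"
  shows "nrm (sqrt_iter X m x - sqrt_iter X n x) \<le> (sqrt_bound m - sqrt_bound n) * nrm x"
  using assms(3)
proof (induction m rule: dec_induct)
  case (step m)
  then show ?case
    using nrm_triangle_mid[of "sqrt_iter X (Suc m) x" "sqrt_iter X n x" "sqrt_iter X m x"]
      sqrt_iter_step[OF assms(1,2), of m x]
    by (simp add: algebra_simps)
qed simp

text \<open>The equation 2 Y = X + Y^2 means (1 - Y)^2 = 1 - X, so 1 - Y is a square root of 1 -
  X.\<close>

lemma sqrt_exists:
  assumes "selfadj X" "contr X"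
  shows "\<exists>Y. selfadj Y \<and> contr Y \<and> (\<forall>x. 2 \<cdot> Y x = X x + Y (Y x)) \<and> bicom X Y"
proof -
  have "\<exists>l. conv (\<lambda>n. sqrt_iter X n x) l" for x
  proof (rule cauchy_conv)
    fix e :: real assume "0 < e"
    then have "0 < e / (nrm x + 1)" by (simp add: add_nonneg_pos)
    then obtain N where N: "\<And>m n. m \<ge> N \<Longrightarrow> n \<ge> N \<Longrightarrow> \<bar>sqrt_bound m - sqrt_bound n\<bar> < e / (nrm x + 1)"
      using sqrt_bound_Cauchy unfolding Cauchy_def dist_real_def by metis
    have "nrm (sqrt_iter X m x - sqrt_iter X n x) < e" if "m \<ge> N" "n \<ge> N" for m n
    proof -
      have "nrm (sqrt_iter X m x - sqrt_iter X n x) \<le> \<bar>sqrt_bound m - sqrt_bound n\<bar> * nrm x"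
      proof (cases "n \<le> m")
        case True
        then show ?thesis using sqrt_iter_diff[OF assms True, of x]
          by (meson abs_ge_self dual_order.trans mult_right_mono nrm_nonneg)
      next
        case False
        then have "m \<le> n" by simp
        then show ?thesis using sqrt_iter_diff[OF assms \<open>m \<le> n\<close>, of x]
          by (metis abs_ge_self abs_minus_commute dual_order.trans mult_right_mono nrm_nonneg nrm_diff_commute)
      qed
      also have "\<dots> \<le> e / (nrm x + 1) * nrm x"
        using N[OF that] by (intro mult_right_mono) auto
      also have "\<dots> < e" using \<open>0 < e\<close> by (simp add: field_simps add_pos_nonneg)
      finally show ?thesis .
    qed
    then show "\<exists>N. \<forall>m\<ge>N. \<forall>n\<ge>N. nrm (sqrt_iter X m x - sqrt_iter X n x) < e" by blast
  qed
  then obtain Y where Y: "\<And>x. conv (\<lambda>n. sqrt_iter X n x) (Y x)" by metis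
  have it: "selfadj (sqrt_iter X n)" for n by (rule selfadj_sqrt_iter[OF assms(1)])
  have itb: "nrm (sqrt_iter X n x) \<le> nrm x" for n x
    using sqrt_iter_bound[OF assms, of n x] sqrt_bound_range[of n]
      mult_right_mono[of "sqrt_bound n" 1 "nrm x"] by simp
  have contrY: "nrm (Y x) \<le> nrm x" for x
    using LIMSEQ_le_const2[OF conv_nrm[OF Y[of x]]] itb by blast
  have "Y (x + y) = Y x + Y y" for x y
    using conv_unique[OF Y[of "x + y"]] conv_add[OF Y[of x] Y[of y]] by (simp add: bopD[OF selfadj_bop[OF it]])
  moreover have "Y (r \<cdot> x) = r \<cdot> Y x" for r x
    using conv_unique[OF Y[of "r \<cdot> x"]] conv_sc[OF Y[of x]] by (simp add: bopD[OF selfadj_bop[OF it]])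
  ultimately have bopY: "bop Y" using contrY by (intro bopI[where C = 1]) auto
  have "Y x \<star> y = x \<star> Y y" for x y
    using LIMSEQ_unique[OF conv_inn[OF Y[of x], of y]] conv_inn_right[OF Y[of y], of x]
    by (simp add: selfadj_inn[OF it])
  then have selfY: "selfadj Y" using bopY by (simp add: selfadj_def)
  have "bicom X Y"
    unfolding bicom_def cmt_def
  proof (intro allI impI)
    fix U x assume U: "adjpm U" "\<forall>x. U (X x) = X (U x)"
    then have "U (sqrt_iter X n x) = sqrt_iter X n (U x)" for n
      using bicomD[OF bicom_sqrt_iter[OF assms(1)]] by (simp add: cmt_def)
    then show "U (Y x) = Y (U x)"
      using conv_unique[OF bop_conv[OF adjpm_bop[OF U(1)] Y[of x]]] Y[of "U x"] by simp
  qed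
  moreover have "2 \<cdot> Y x = X x + Y (Y x)" for x
  proof -
    have "conv (\<lambda>n. sqrt_iter X n (sqrt_iter X n x)) (Y (Y x))"
    proof (rule conv_squeeze)
      show "nrm (sqrt_iter X n (sqrt_iter X n x) - Y (Y x)) \<le>
          nrm (sqrt_iter X n x - Y x) + nrm (sqrt_iter X n (Y x) - Y (Y x))" for n
        using nrm_triangle_mid[of "sqrt_iter X n (sqrt_iter X n x)" "Y (Y x)" "sqrt_iter X n (Y x)"]
          itb[of n "sqrt_iter X n x - Y x"] by (simp add: bopD[OF selfadj_bop[OF it]])
      show "(\<lambda>n. nrm (sqrt_iter X n x - Y x) + nrm (sqrt_iter X n (Y x) - Y (Y x))) \<longlonglongrightarrow> 0"
        using tendsto_add[OF Y[of x, unfolded conv_def] Y[of "Y x", unfolded conv_def]] by simp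
    qed
    then have "conv (\<lambda>n. sqrt_iter X (Suc n) x) ((1/2) \<cdot> (X x + Y (Y x)))"
      using conv_sc[OF conv_add[OF conv_const]] by simp
    moreover have "conv (\<lambda>n. sqrt_iter X (Suc n) x) (Y x)"
      using Y[of x] unfolding conv_def by (rule LIMSEQ_Suc)
    ultimately have "Y x = (1/2) \<cdot> (X x + Y (Y x))" using conv_unique by blast
    then have "2 \<cdot> Y x = 2 \<cdot> (1/2) \<cdot> (X x + Y (Y x))" by (rule arg_cong)
    then show ?thesis by (simp del: scale_right_distrib)
  qed
  ultimately show ?thesis using selfY contrY unfolding contr_def by blast
qed

text \<open>R is the square root of W^2 = 1 - (1 - W^2). A further root Q of R shows that R is
  nonnegative and that R^2 is at most R, which makes 2 R - 1 a contraction. The bicommutant is that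
  of W^2 because R must also commute with operators that anticommute with W.\<close>

lemma abs_exists:
  assumes W: "selfadj W" "contr W"
  shows "\<exists>R. selfadj R \<and> contr R \<and> bicom (\<lambda>x. W (W x)) R \<and> (\<forall>x. R (R x) = W (W x)) \<and>
    (\<forall>x. 0 \<le> R x \<star> x) \<and> contr (\<lambda>x. 2 \<cdot> R x - x)"
proof -
  have ct: "contr (\<lambda>x. x - f (f x))" if "selfadj f" "contr f" for f
    unfolding contr_def
  proof
    fix x
    have "(nrm (x - f (f x)))\<^sup>2 = (nrm x)\<^sup>2 - 2 * (nrm (f x))\<^sup>2 + (nrm (f (f x)))\<^sup>2"
      by (simp add: nrm_sq inn_simps inn_commute[of "f (f x)" x] selfadj_inn[OF that(1), of x "f x"])
    moreover have "(nrm (f (f x)))\<^sup>2 \<le> (nrm (f x))\<^sup>2" using that(2) by (simp add: contr_def)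
    moreover have "0 \<le> (nrm (f x))\<^sup>2" by simp
    ultimately have "(nrm (x - f (f x)))\<^sup>2 \<le> (nrm x)\<^sup>2" by linarith
    then show "nrm (x - f (f x)) \<le> nrm x" by (rule power2_le_imp_le) simp
  qed
  have root: "\<exists>Q. selfadj Q \<and> contr (\<lambda>x. x - Q x) \<and> (\<forall>x. Q (Q x) = x - X x) \<and> bicom X Q"
    if X: "selfadj X" "contr X" for X
  proof -
    obtain Y where Y: "selfadj Y" "contr Y" "\<And>x. 2 \<cdot> Y x = X x + Y (Y x)" "bicom X Y"
      using sqrt_exists[OF X] by blast
    have two: "(2::real) \<cdot> x = x + x" for x
      using scale_left_distrib[of 1 1 x] by simp
    have "(x - Y x) - Y (x - Y x) = x - X x" for x
      using Y(3)[of x] by (simp add: bopD[OF selfadj_bop[OF Y(1)]] two algebra_simps)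
    then show ?thesis
      using Y selfadj_diff[OF selfadj_id Y(1)] bicom_diff[OF bicom_id Y(4)]
      by (intro exI[of _ "\<lambda>x. x - Y x"]) auto
  qed
  let ?X = "\<lambda>x. x - W (W x)"
  have sX: "selfadj ?X" using W(1) by (intro selfadj_diff selfadj_id selfadj_sq)
  obtain R where R: "selfadj R" "contr (\<lambda>x. x - R x)" "\<And>x. R (R x) = W (W x)" "bicom ?X R"
    using root[OF sX ct[OF W]] by auto
  obtain Q where Q: "selfadj Q" "\<And>x. Q (Q x) = R x"
    using root[OF selfadj_diff[OF selfadj_id R(1)] R(2)] by auto
  have nR: "nrm (R x) = nrm (W x)" for x
    unfolding nrm_def by (simp add: selfadj_inn[OF R(1), of x] selfadj_inn[OF W(1), of x] R(3))
  then have cR: "contr R" using W(2) by (simp add: contr_def)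
  have Qsq: "R x \<star> x = (nrm (Q x))\<^sup>2" for x
    using selfadj_inn[OF Q(1), of "Q x" x] Q(2) by (simp add: nrm_sq)
  have cQ: "nrm (Q x) \<le> nrm x" for x
  proof (rule power2_le_imp_le)
    have "(nrm (Q x))\<^sup>2 \<le> nrm (R x) * nrm x" unfolding Qsq[symmetric] by (rule inn_le_nrm)
    also have "\<dots> \<le> nrm x * nrm x" using cR by (intro mult_right_mono) (auto simp: contr_def)
    finally show "(nrm (Q x))\<^sup>2 \<le> (nrm x)\<^sup>2" by (simp add: power2_eq_square)
  qed simp
  have "nrm (2 \<cdot> R x - x) \<le> nrm x" for x
  proof (rule power2_le_imp_le)
    have "(nrm (2 \<cdot> R x - x))\<^sup>2 = 4 * ((nrm (R x))\<^sup>2 - R x \<star> x) + (nrm x)\<^sup>2"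
      by (simp add: nrm_sq inn_simps inn_commute[of x "R x"])
    moreover have "(nrm (R x))\<^sup>2 \<le> R x \<star> x"
      unfolding Qsq using cQ[of "Q x"] by (simp add: Q(2))
    ultimately show "(nrm (2 \<cdot> R x - x))\<^sup>2 \<le> (nrm x)\<^sup>2" by argo
  qed simp
  moreover have "bicom (\<lambda>x. W (W x)) R"
    using R(4) unfolding bicom_def cmt_def by (simp add: bopD[OF adjpm_bop])
  ultimately show ?thesis
    using R(1,3) cR Qsq unfolding contr_def by (intro exI[of _ R]) auto
qed

definition absop :: "('h \<Rightarrow> 'h) \<Rightarrow> 'h \<Rightarrow> 'h" where
  "absop W = (SOME R. selfadj R \<and> contr R \<and> bicom (\<lambda>x. W (W x)) R \<and> (\<forall>x. R (R x) = W (W x)) \<and>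
    (\<forall>x. 0 \<le> R x \<star> x) \<and> contr (\<lambda>x. 2 \<cdot> R x - x))"

text \<open>The spectral projection of W for the nonpositive half-line. Its range and that of
  \<open>nonneg_proj\<close> both contain the kernel of W, so their difference vanishes
  there.\<close>

definition nonpos_proj :: "('h \<Rightarrow> 'h) \<Rightarrow> 'h \<Rightarrow> 'h" where
  "nonpos_proj W = proj {x. absop W x + W x = 0}"

definition nonneg_proj :: "('h \<Rightarrow> 'h) \<Rightarrow> 'h \<Rightarrow> 'h" where
  "nonneg_proj W = proj {x. absop W x = W x}"

lemma two_sc: "2 \<cdot> x = x + x"
  using scale_left_distrib[of 1 1 x] by simp

lemma half_sc: "(1/2) \<cdot> (x + x) = x"
  by (simp flip: two_sc)

context
  fixes W assumes W: "selfadj W" "contr W"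
begin

lemma
  shows selfadj_absop: "selfadj (absop W)"
    and contr_absop: "contr (absop W)"
    and bicom_sq_absop: "bicom (\<lambda>x. W (W x)) (absop W)"
    and absop_sq: "absop W (absop W x) = W (W x)"
    and absop_nonneg: "0 \<le> absop W x \<star> x"
    and contr_absop_shift: "contr (\<lambda>x. 2 \<cdot> absop W x - x)"
  using someI_ex[OF abs_exists[OF W]] unfolding absop_def[symmetric] by auto

lemma bicom_absop: "bicom W (absop W)"
  using bicom_sq_absop unfolding bicom_def cmt_def by simp

lemma absop_cmt: "absop W (W x) = W (absop W x)"
  using bicom_cmt[OF bicom_absop bicom_self W(1) selfadj_absop] .

lemma clsub_nonpos: "clsub {x. absop W x + W x = 0}"
  and clsub_nonneg: "clsub {x. absop W x = W x}"
  using clsub_ker[OF bop_add[OF selfadj_bop[OF selfadj_absop] selfadj_bop[OF W(1)]]]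
    clsub_ker[OF bop_diff[OF selfadj_bop[OF selfadj_absop] selfadj_bop[OF W(1)]]] by simp_all

lemma selfadj_nonpos_proj: "selfadj (nonpos_proj W)"
  and selfadj_nonneg_proj: "selfadj (nonneg_proj W)"
  by (simp_all add: nonpos_proj_def nonneg_proj_def selfadj_proj clsub_nonpos clsub_nonneg)

lemma nonpos_proj_idem: "nonpos_proj W (nonpos_proj W x) = nonpos_proj W x"
  and nonneg_proj_idem: "nonneg_proj W (nonneg_proj W x) = nonneg_proj W x"
  by (simp_all add: nonpos_proj_def nonneg_proj_def proj_idem clsub_nonpos clsub_nonneg)

lemma bicom_nonpos_proj: "bicom W (nonpos_proj W)" and bicom_nonneg_proj: "bicom W (nonneg_proj W)"
proof -
  have "U (nonpos_proj W x) = nonpos_proj W (U x) \<and> U (nonneg_proj W x) = nonneg_proj W (U x)"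
    if U: "adjpm U" "cmt U W" for U x
  proof -
    obtain \<eta> where \<eta>: "\<And>x y. U x \<star> y = \<eta> * (x \<star> U y)" using U by (auto simp: adjpm_def)
    have c: "absop W (U x) = U (absop W x)" "W (U x) = U (W x)" for x
      using bicomD[OF bicom_absop U] U(2) by (simp_all add: cmt_def)
    have lin: "U a + U b = U (a + b)" "U a - U b = U (a - b)" "U 0 = 0" for a b
      using U by (simp_all add: bopD[OF adjpm_bop])
    show ?thesis
      unfolding nonpos_proj_def nonneg_proj_def
      using \<eta> by (intro conjI proj_intertwine[symmetric] clsub_nonpos clsub_nonneg) (auto simp: c lin)
  qed
  then show "bicom W (nonpos_proj W)" "bicom W (nonneg_proj W)"
    by (auto simp: bicom_def cmt_def)
qed

lemma nonpos_proj_eq: "absop W (nonpos_proj W x) = - W (nonpos_proj W x)"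
  using proj_in[OF clsub_nonpos, of x] by (simp add: nonpos_proj_def eq_neg_iff_add_eq_0)

lemma nonneg_proj_eq: "absop W (nonneg_proj W x) = W (nonneg_proj W x)"
  using proj_in[OF clsub_nonneg, of x] by (simp add: nonneg_proj_def)

text \<open>With R the modulus, (R + W) (R - W) = R^2 - W^2 = 0, so R x - W x lies in the range of
  the projection P; and P W = - P R.\<close>

lemma absop_diff: "absop W x - W x = 2 \<cdot> nonpos_proj W (absop W x)"
proof -
  note lin = bopD[OF selfadj_bop[OF W(1)]] bopD[OF selfadj_bop[OF selfadj_absop]]
    bopD[OF selfadj_bop[OF selfadj_nonpos_proj]]
  have "nonpos_proj W (absop W x - W x) = absop W x - W x"
    unfolding nonpos_proj_def
    by (rule proj_fix[OF clsub_nonpos]) (simp add: lin absop_sq absop_cmt)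
  moreover have "nonpos_proj W (W x) = - nonpos_proj W (absop W x)"
    using bicom_cmt[OF bicom_nonpos_proj bicom_self W(1) selfadj_nonpos_proj, of x]
      bicom_cmt[OF bicom_nonpos_proj bicom_absop W(1) selfadj_nonpos_proj, of x] nonpos_proj_eq[of x]
    by simp
  ultimately show ?thesis by (simp add: lin two_sc)
qed

lemma absop_add: "absop W x + W x = 2 \<cdot> nonneg_proj W (absop W x)"
proof -
  note lin = bopD[OF selfadj_bop[OF W(1)]] bopD[OF selfadj_bop[OF selfadj_absop]]
    bopD[OF selfadj_bop[OF selfadj_nonneg_proj]]
  have "nonneg_proj W (absop W x + W x) = absop W x + W x"
    unfolding nonneg_proj_def
    by (rule proj_fix[OF clsub_nonneg]) (simp add: lin absop_sq absop_cmt)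
  moreover have "nonneg_proj W (W x) = nonneg_proj W (absop W x)"
    using bicom_cmt[OF bicom_nonneg_proj bicom_self W(1) selfadj_nonneg_proj, of x]
      bicom_cmt[OF bicom_nonneg_proj bicom_absop W(1) selfadj_nonneg_proj, of x] nonneg_proj_eq[of x]
    by simp
  ultimately show ?thesis by (simp add: lin two_sc)
qed

lemma absop_sign_decomp: "W x = nonneg_proj W (absop W x) - nonpos_proj W (absop W x)"
proof -
  have "W x + W x = (nonneg_proj W (absop W x) - nonpos_proj W (absop W x)) +
      (nonneg_proj W (absop W x) - nonpos_proj W (absop W x))"
    using absop_diff[of x] absop_add[of x] unfolding two_sc by (simp add: algebra_simps)
  then show ?thesis by (metis half_sc)
qed

text \<open>U commutes with W^2, hence with the modulus, and so exchanges the kernels that define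
  the two projections. The later use is U = right multiplication by j and W =
  \<open>opW\<close>.\<close>

lemma anticommuting_proj:
  assumes "adjpm U" "\<And>x. U (W x) = - W (U x)"
  shows "U (nonneg_proj W x) = nonpos_proj W (U x)" "U (nonpos_proj W x) = nonneg_proj W (U x)"
    "U (absop W x) = absop W (U x)"
proof -
  obtain \<eta> where \<eta>: "\<And>x y. U x \<star> y = \<eta> * (x \<star> U y)" using assms by (auto simp: adjpm_def)
  have "cmt U (\<lambda>x. W (W x))"
    using assms(2) by (simp add: cmt_def bopD[OF selfadj_bop[OF W(1)]])
  then show c: "U (absop W x) = absop W (U x)" for x
    using bicomD[OF bicom_sq_absop assms(1)] by simp
  have a: "W (U x) = - U (W x)" for x using assms(2)[of x] by simp
  have lin: "U (a - b) = U a - U b" "U (a + b) = U a + U b" "U 0 = 0" for a b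
    using assms by (simp_all add: bopD[OF adjpm_bop])
  have "absop W (U x) = W (U x)" if "absop W x + W x = 0" for x
  proof -
    have "absop W (U x) - W (U x) = U (absop W x + W x)" by (simp add: lin c a)
    then show ?thesis using that by (simp add: lin)
  qed
  moreover have "absop W (U x) + W (U x) = 0" if "absop W x = W x" for x
    using that by (simp add: a flip: c)
  ultimately show "U (nonneg_proj W x) = nonpos_proj W (U x)" "U (nonpos_proj W x) = nonneg_proj W (U x)"
    unfolding nonpos_proj_def nonneg_proj_def
    by (auto intro!: proj_intertwine[OF _ _ _ _ \<eta>, symmetric] clsub_nonpos clsub_nonneg)
qed

end

lemma involution_nrm: "selfadj u \<Longrightarrow> (\<And>x. u (u x) = x) \<Longrightarrow> nrm (u x) = nrm x"
  by (simp add: nrm_def selfadj_inn)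

text \<open>The sign is s = 1 - 2 P with P = \<open>nonpos_proj A\<close>, so that it is an
  involution on the kernel of A as well, where it equals -1. The remainder A' = 2 R - 1, with R the
  modulus, comes from A = s R.\<close>

lemma sign_step:
  assumes "selfadj A" "contr A"
  shows "\<exists>s A'. selfadj s \<and> (\<forall>x. s (s x) = x) \<and> bicom A s \<and> selfadj A' \<and> contr A' \<and> bicom A A' \<and>
    (\<forall>x. A x = (1/2) \<cdot> (s x + s (A' x)))"
proof -
  let ?R = "absop A" and ?P = "nonpos_proj A"
  define s where "s x = x - 2 \<cdot> ?P x" for x
  define A' where "A' x = 2 \<cdot> ?R x - x" for x
  note [simp] = bopD[OF selfadj_bop[OF selfadj_nonpos_proj[OF assms]]]
  have s: "selfadj s" unfolding s_def
    by (intro selfadj_diff selfadj_id selfadj_sc selfadj_nonpos_proj assms)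
  have A': "selfadj A'" unfolding A'_def
    by (intro selfadj_diff selfadj_id selfadj_sc selfadj_absop assms)
  have "s (s x) = x" for x
    by (simp add: s_def two_sc nonpos_proj_idem[OF assms])
  moreover have "bicom A s" unfolding s_def
    by (intro bicom_diff bicom_id bicom_sc bicom_nonpos_proj assms)
  moreover have "bicom A A'" unfolding A'_def
    by (intro bicom_diff bicom_id bicom_sc bicom_absop assms)
  moreover have "contr A'" unfolding A'_def by (rule contr_absop_shift[OF assms])
  moreover have "A x = (1/2) \<cdot> (s x + s (A' x))" for x
  proof -
    have "s x + s (A' x) = s (x + A' x)" by (simp add: bopD[OF selfadj_bop[OF s]])
    also have "\<dots> = s (?R x) + s (?R x)"
      by (simp add: A'_def two_sc bopD[OF selfadj_bop[OF s]])
    also have "s (?R x) = A x" using absop_diff[OF assms, of x] by (simp add: s_def algebra_simps)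
    finally show ?thesis by (simp only: half_sc)
  qed
  ultimately show ?thesis using s A' by blast
qed

text \<open>Binary expansion of a selfadjoint contraction: in \<open>W = s \<bar>W\<bar>\<close> with a sign \<open>s\<close>, the
  operator \<open>2 \<bar>W\<bar> - 1\<close> is again a contraction, so \<open>W = s (1 + W') / 2\<close> can be iterated.\<close>

lemma binary_expansion:
  assumes W: "selfadj W" "contr W"
  shows "\<exists>u. (\<forall>i. selfadj (u i) \<and> (\<forall>x. u i (u i x) = x) \<and> bicom W (u i)) \<and>
    (\<forall>k x. nrm (W x - (\<Sum>i<k. (1 / 2 ^ Suc i) \<cdot> u i x)) \<le> nrm x / 2 ^ k)"
proof -
  \<comment> \<open>A state (A, a) holds the current remainder A and the product a of all signs so
    far, so that W minus the digits found equals a A / 2^n.\<close>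
  define P where "P n \<sigma> \<longleftrightarrow> (case \<sigma> of (A, a) \<Rightarrow> selfadj A \<and> contr A \<and> bicom W A \<and> selfadj a \<and>
    (\<forall>x. a (a x) = x) \<and> bicom W a \<and> (n = 0 \<longrightarrow> A = W \<and> a = (\<lambda>x. x)))" for n :: nat and \<sigma>
  define Q where "Q (n::nat) \<sigma> \<tau> \<longleftrightarrow> (\<forall>x. snd \<sigma> (fst \<sigma> x) = (1/2) \<cdot> (snd \<tau> x + snd \<tau> (fst \<tau> x)))"
    for n and \<sigma> \<tau> :: "('h \<Rightarrow> 'h) \<times> ('h \<Rightarrow> 'h)"
  have "\<exists>f. \<forall>n. P n (f n) \<and> Q n (f n) (f (Suc n))"
  proof (rule dependent_nat_choice)
    show "\<exists>\<sigma>. P 0 \<sigma>"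
      using W by (intro exI[of _ "(W, \<lambda>x. x)"]) (simp add: P_def bicom_self selfadj_id bicom_id)
  next
    fix \<sigma> n assume "P n \<sigma>"
    then obtain A a where \<sigma>: "\<sigma> = (A, a)" and A: "selfadj A" "contr A" "bicom W A"
      and a: "selfadj a" "\<And>x. a (a x) = x" "bicom W a"
      by (auto simp: P_def split: prod.splits)
    obtain s A' where s: "selfadj s" "\<And>x. s (s x) = x" "bicom A s" "selfadj A'" "contr A'" "bicom A A'"
      "\<And>x. A x = (1/2) \<cdot> (s x + s (A' x))" using sign_step[OF A(1,2)] by metis
    have ws: "bicom W s" by (rule bicom_trans[OF A(3) s(3)])
    have as: "a (s x) = s (a x)" for x
      by (rule bicom_cmt[OF a(3) ws W(1) a(1)])
    have "P (Suc n) (A', \<lambda>x. a (s x))"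
      using selfadj_comp[OF a(1) s(1) as] bicom_comp[OF a(3) ws] bicom_trans[OF A(3) s(6)] s a
      by (simp add: P_def as)
    moreover have "Q n \<sigma> (A', \<lambda>x. a (s x))"
      by (simp add: Q_def \<sigma> s(7) bopD[OF selfadj_bop[OF a(1)]])
    ultimately show "\<exists>\<tau>. P (Suc n) \<tau> \<and> Q n \<sigma> \<tau>" by blast
  qed
  then obtain f where f: "\<And>n. P n (f n)" "\<And>n. Q n (f n) (f (Suc n))" by blast
  define A where "A n = fst (f n)" for n
  define a where "a n = snd (f n)" for n
  have A: "contr (A n)" and a: "selfadj (a n)" "\<And>x. a n (a n x) = x" "bicom W (a n)" for n
    using f(1)[of n] by (auto simp: P_def A_def a_def split: prod.splits)
  have init: "A 0 = W" "a 0 = (\<lambda>x. x)"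
    using f(1)[of 0] by (auto simp: P_def A_def a_def split: prod.splits)
  have step: "a n (A n x) = (1/2) \<cdot> (a (Suc n) x + a (Suc n) (A (Suc n) x))" for n x
    using f(2)[of n] by (simp add: Q_def A_def a_def)
  have rem: "W x - (\<Sum>i<k. (1 / 2 ^ Suc i) \<cdot> a (Suc i) x) = (1 / 2 ^ k) \<cdot> a k (A k x)" for k x
  proof (induction k)
    case 0
    show ?case by (simp add: init)
  next
    case (Suc k)
    have "(1 / 2 ^ k) \<cdot> a k (A k x) = (1 / 2 ^ Suc k) \<cdot> a (Suc k) x + (1 / 2 ^ Suc k) \<cdot> a (Suc k) (A (Suc k) x)"
      unfolding step[of k] by (simp add: scale_right_distrib mult.commute)
    then show ?case using Suc by (simp add: algebra_simps)
  qed
  have "nrm (W x - (\<Sum>i<k. (1 / 2 ^ Suc i) \<cdot> a (Suc i) x)) \<le> nrm x / 2 ^ k" for k x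
    unfolding rem nrm_sc involution_nrm[OF a(1,2)]
    using A[of k] by (simp add: contr_def divide_right_mono)
  \<comment> \<open>\<open>a 0\<close> is the empty product of signs; the digits start at
    \<open>a 1\<close>.\<close>
  then show ?thesis using a by (intro exI[of _ "\<lambda>i. a (Suc i)"]) auto
qed

text \<open>p is the complement of the nonpositive projection of (S - c) / 2, the factor 1/2 keeping
  this operator a contraction. It acts as a spectral projection of S at the threshold c.\<close>

lemma spectral_cut:
  assumes S: "selfadj S" "contr S" and c: "0 \<le> c" "c \<le> 1"
  shows "\<exists>p. selfadj p \<and> (\<forall>x. p (p x) = p x) \<and> bicom S p \<and>
    (\<forall>x. p x = x \<longrightarrow> c * (x \<star> x) \<le> S x \<star> x) \<and> (\<forall>x. p x = 0 \<longrightarrow> S x \<star> x \<le> c * (x \<star> x))"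
proof -
  define W where "W x = (1/2) \<cdot> (S x - c \<cdot> x)" for x
  have sW: "selfadj W" unfolding W_def by (intro selfadj_sc selfadj_diff selfadj_id S)
  have cW: "contr W" unfolding contr_def
  proof
    fix x
    have "nrm (S x - c \<cdot> x) \<le> nrm (S x) + nrm (c \<cdot> x)" by (rule nrm_triangle_diff)
    also have "\<dots> \<le> nrm x + nrm x"
      using S(2) c by (intro add_mono) (auto simp: contr_def nrm_sc mult_left_le_one_le)
    finally show "nrm (W x) \<le> nrm x" unfolding W_def nrm_sc by simp
  qed
  note lin = bopD[OF selfadj_bop[OF selfadj_nonpos_proj[OF sW cW]]] bopD[OF selfadj_bop[OF S(1)]]
  have inW: "2 * (W x \<star> x) = S x \<star> x - c * (x \<star> x)" for x
    by (simp add: W_def inn_simps)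
  define p where "p x = x - nonpos_proj W x" for x
  have "selfadj p" unfolding p_def by (intro selfadj_diff selfadj_id selfadj_nonpos_proj sW cW)
  moreover have "p (p x) = p x" for x
    by (simp add: p_def lin nonpos_proj_idem[OF sW cW])
  moreover have "bicom S p"
  proof -
    have "bicom S W" unfolding W_def by (intro bicom_sc bicom_diff bicom_self bicom_id)
    then have "bicom S (nonpos_proj W)" using bicom_nonpos_proj[OF sW cW] by (rule bicom_trans)
    then show ?thesis unfolding p_def by (intro bicom_diff bicom_id)
  qed
  moreover have "c * (x \<star> x) \<le> S x \<star> x" if "p x = x" for x
  proof -
    have "nonpos_proj W x = 0" using that by (simp add: p_def)
    \<comment> \<open>The projection commutes with the modulus, so \<open>absop_diff\<close> gives W
      x = \<open>absop W x\<close>, and positivity of the modulus yields the lower bound.\<close>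
    then have "nonpos_proj W (absop W x) = 0"
      using bicom_cmt[OF bicom_nonpos_proj bicom_absop sW selfadj_nonpos_proj, OF sW cW sW cW sW cW, of x]
      by (simp add: bopD[OF selfadj_bop[OF selfadj_absop[OF sW cW]]])
    then have "W x = absop W x" using absop_diff[OF sW cW, of x] by simp
    then show ?thesis using absop_nonneg[OF sW cW, of x] inW[of x] by simp
  qed
  moreover have "S x \<star> x \<le> c * (x \<star> x)" if "p x = 0" for x
  proof -
    have "nonpos_proj W x = x" using that by (simp add: p_def)
    then have "absop W x = - W x" using nonpos_proj_eq[OF sW cW, of x] by simp
    then show ?thesis using absop_nonneg[OF sW cW, of x] inW[of x] by (simp add: inn_simps)
  qed
  ultimately show ?thesis by blast
qed

subsection \<open>Compact operators\<close>

definition seqcompact :: "('h \<Rightarrow> 'h) \<Rightarrow> bool" where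
  "seqcompact f \<longleftrightarrow> (\<forall>s C. (\<forall>n. nrm (s n) \<le> C) \<longrightarrow>
    (\<exists>r l. strict_mono (r :: nat \<Rightarrow> nat) \<and> conv (\<lambda>m. f (s (r m))) l))"

lemma conv_subseq: assumes "conv X l" "strict_mono (r :: nat \<Rightarrow> nat)" shows "conv (\<lambda>n. X (r n)) l"
  using LIMSEQ_subseq_LIMSEQ[OF assms(1)[unfolded conv_def] assms(2)] by (simp add: conv_def o_def)

lemma seqcompact_add:
  assumes "seqcompact f" "seqcompact g"
  shows "seqcompact (\<lambda>x. f x + g x)"
  unfolding seqcompact_def
proof (intro allI impI)
  fix s :: "nat \<Rightarrow> 'h" and C assume s: "\<forall>n. nrm (s n) \<le> C"
  then obtain r l where r: "strict_mono (r :: nat \<Rightarrow> nat)" "conv (\<lambda>m. f (s (r m))) l"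
    using assms(1) unfolding seqcompact_def by blast
  have "\<forall>n. nrm ((\<lambda>m. s (r m)) n) \<le> C" using s by simp
  then obtain r' l' where r': "strict_mono (r' :: nat \<Rightarrow> nat)" "conv (\<lambda>m. g (s (r (r' m)))) l'"
    using assms(2)[unfolded seqcompact_def, rule_format, of "\<lambda>m. s (r m)" C] by blast
  have "conv (\<lambda>m. f (s (r (r' m))) + g (s (r (r' m)))) (l + l')"
    using conv_subseq[OF r(2) r'(1)] r'(2) by (rule conv_add)
  moreover have "strict_mono (\<lambda>m. r (r' m))"
    using strict_mono_compose[OF r(1) r'(1)] .
  ultimately show "\<exists>r l. strict_mono (r :: nat \<Rightarrow> nat) \<and> conv (\<lambda>m. f (s (r m)) + g (s (r m))) l" by blast
qed

lemma seqcompact_zero: "seqcompact (\<lambda>x. 0)"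
  unfolding seqcompact_def using conv_const[of 0] by (auto intro!: exI[of _ "\<lambda>n. n"] simp: strict_mono_def)

lemma seqcompact_sum: "(\<And>a. a \<in> A \<Longrightarrow> seqcompact (f a)) \<Longrightarrow> seqcompact (\<lambda>x. \<Sum>a\<in>A. f a x)"
proof (induction A rule: infinite_finite_induct)
  case (insert a A)
  then show ?case using seqcompact_add[of "f a" "\<lambda>x. \<Sum>a\<in>A. f a x"] by simp
qed (auto intro: seqcompact_zero)

lemma seqcompact_rank_one:
  assumes "\<And>x. \<bar>\<phi> x\<bar> \<le> M * nrm x"
  shows "seqcompact (\<lambda>x. \<phi> x \<cdot> g)"
  unfolding seqcompact_def
proof (intro allI impI)
  fix s :: "nat \<Rightarrow> 'h" and C assume s: "\<forall>n. nrm (s n) \<le> C"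
  have "\<bar>\<phi> (s n)\<bar> \<le> \<bar>M\<bar> * C" for n
    using assms[of "s n"] s mult_mono[of M "\<bar>M\<bar>" "nrm (s n)" C] by (smt (verit) nrm_nonneg)
  then have "bounded (range (\<lambda>n. \<phi> (s n)))" by (auto simp: bounded_iff)
  then obtain l and r :: "nat \<Rightarrow> nat" where r: "strict_mono r" "(\<lambda>n. \<phi> (s (r n))) \<longlonglongrightarrow> l"
    using bounded_imp_convergent_subsequence[of "\<lambda>n. \<phi> (s n)"] by (auto simp: o_def)
  have "conv (\<lambda>n. \<phi> (s (r n)) \<cdot> g) (l \<cdot> g)"
    unfolding conv_def scale_left_diff_distrib[symmetric] nrm_sc
    using r(2) by (intro tendsto_mult_left_zero tendsto_rabs_zero LIM_zero)
  then show "\<exists>r l. strict_mono (r :: nat \<Rightarrow> nat) \<and> conv (\<lambda>m. \<phi> (s (r m)) \<cdot> g) l" using r(1) by blast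
qed

text \<open>A diagonal subsequence makes all images under the \<open>F m\<close> converge;
  approximating K by one \<open>F m\<close> then makes the images under K Cauchy.\<close>

lemma seqcompact_limit:
  assumes F: "\<And>m. seqcompact (F m)"
    and K: "\<And>m x. nrm (K x - F m x) \<le> \<eta> m * nrm x" and \<eta>: "\<eta> \<longlonglongrightarrow> 0"
  shows "seqcompact K"
  unfolding seqcompact_def
proof (intro allI impI)
  fix s :: "nat \<Rightarrow> 'h" and C assume s: "\<forall>n. nrm (s n) \<le> C"
  interpret D: subseqs "\<lambda>m r. \<exists>l. conv (\<lambda>n. F m (s (r n))) l"
  proof
    fix m and t :: "nat \<Rightarrow> nat"
    have "\<forall>n. nrm ((\<lambda>n. s (t n)) n) \<le> C" using s by simp
    then obtain r l where "strict_mono (r :: nat \<Rightarrow> nat)" "conv (\<lambda>n. F m (s (t (r n)))) l"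
      using F[of m, unfolded seqcompact_def, rule_format, of "\<lambda>n. s (t n)" C] by blast
    then show "\<exists>r. strict_mono r \<and> (\<exists>l. conv (\<lambda>n. F m (s ((t \<circ> r) n))) l)" by (auto simp: o_def)
  qed
  let ?d = "D.diagseq"
  have "\<exists>l. conv (\<lambda>n. F m (s ((?d \<circ> (+) (Suc m)) n))) l" for m
  proof (rule D.diagseq_holds)
    fix k and t r :: "nat \<Rightarrow> nat"
    assume "strict_mono r" "\<exists>l. conv (\<lambda>n. F k (s (t n))) l"
    then show "\<exists>l. conv (\<lambda>n. F k (s ((t \<circ> r) n))) l" using conv_subseq[of "\<lambda>n. F k (s (t n))"] by auto
  qed
  \<comment> \<open>Only from index \<open>Suc m\<close> on is the diagonal sequence known to be a
    subsequence of the one chosen for \<open>F m\<close>.\<close>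
  then have "\<exists>l. conv (\<lambda>n. F m (s (?d (n + Suc m)))) l" for m
    by (simp add: o_def add.commute[of _ m])
  then obtain l where "\<And>m. conv (\<lambda>n. F m (s (?d (n + Suc m)))) (l m)" by metis
  then have l: "conv (\<lambda>n. F m (s (?d n))) (l m)" for m
    unfolding conv_def by (rule LIMSEQ_offset)
  have "\<exists>k. conv (\<lambda>n. K (s (?d n))) k"
  proof (rule cauchy_conv)
    fix e :: real assume e: "0 < e"
    have "(\<lambda>m. \<bar>\<eta> m\<bar> * C) \<longlonglongrightarrow> 0" using \<eta> by (intro tendsto_mult_left_zero tendsto_rabs_zero)
    then have "\<forall>\<^sub>F m in sequentially. \<bar>\<eta> m\<bar> * C < e / 4" using e by (intro order_tendstoD(2)) auto
    then obtain m where m: "\<bar>\<eta> m\<bar> * C < e / 4" by (auto simp: eventually_sequentially)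
    have Kb: "nrm (K (s n) - F m (s n)) < e / 4" for n
    proof -
      have "nrm (K (s n) - F m (s n)) \<le> \<eta> m * nrm (s n)" by (rule K)
      also have "\<dots> \<le> \<bar>\<eta> m\<bar> * C" using s by (intro mult_mono) auto
      finally show ?thesis using m by linarith
    qed
    obtain N where N: "\<And>n. n \<ge> N \<Longrightarrow> nrm (F m (s (?d n)) - l m) < e / 4"
    proof -
      have "\<forall>\<^sub>F n in sequentially. nrm (F m (s (?d n)) - l m) < e / 4"
        using l[of m] e unfolding conv_def by (intro order_tendstoD(2)) auto
      then show thesis using that by (auto simp: eventually_sequentially)
    qed
    have "nrm (K (s (?d i)) - K (s (?d j))) < e" if "i \<ge> N" "j \<ge> N" for i j
      using nrm_triangle_mid[of "K (s (?d i))" "K (s (?d j))" "F m (s (?d i))"]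
        nrm_triangle_mid[of "F m (s (?d i))" "K (s (?d j))" "l m"]
        nrm_triangle_mid[of "l m" "K (s (?d j))" "F m (s (?d j))"]
        Kb[of "?d i"] Kb[of "?d j"] N[OF that(1)] N[OF that(2)]
        nrm_diff_commute[of "l m" "F m (s (?d j))"] nrm_diff_commute[of "F m (s (?d j))" "K (s (?d j))"]
      by linarith
    then show "\<exists>N. \<forall>i\<ge>N. \<forall>j\<ge>N. nrm (K (s (?d i)) - K (s (?d j))) < e" by blast
  qed
  then show "\<exists>r l. strict_mono (r :: nat \<Rightarrow> nat) \<and> conv (\<lambda>m. K (s (r m))) l"
    using D.subseq_diagseq by blast
qed

text \<open>The exponent n + 2 makes the tail from m on at most
  \<open>\<epsilon> / 2 ^ (m + 1)\<close>, hence the whole sum at most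
  \<open>\<epsilon> / 2\<close>, leaving room for a strict inequality.\<close>

lemma operator_series:
  assumes K: "\<And>n. bop (K n)" "\<And>n x. nrm (K n x) \<le> \<epsilon> / 2 ^ (n + 2) * nrm x" and \<epsilon>: "0 < \<epsilon>"
  shows "\<exists>S. bop S \<and> (\<forall>x. conv (\<lambda>m. \<Sum>n<m. K n x) (S x)) \<and>
    (\<forall>m x. nrm (S x - (\<Sum>n<m. K n x)) \<le> \<epsilon> / 2 ^ (m + 1) * nrm x)"
proof -
  define F where "F m x = (\<Sum>n<m. K n x)" for m x
  have bF: "bop (F m)" for m unfolding F_def[abs_def] by (intro bop_sum K)
  \<comment> \<open>The geometric sum is kept in closed form so that the induction
    telescopes.\<close>
  have diff: "nrm (F i x - F j x) \<le> (\<epsilon> / 2 ^ (j + 1) - \<epsilon> / 2 ^ (i + 1)) * nrm x" if "j \<le> i" for i j x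
    using that
  proof (induction i rule: dec_induct)
    case (step i)
    have "F (Suc i) x - F i x = K i x" by (simp add: F_def)
    then have "nrm (F (Suc i) x - F j x) \<le> \<epsilon> / 2 ^ (i + 2) * nrm x + nrm (F i x - F j x)"
      using nrm_triangle_mid[of "F (Suc i) x" "F j x" "F i x"] K(2)[of i x] by simp
    then show ?case using step.IH by (simp add: algebra_simps)
  qed simp
  have diff': "nrm (F i x - F j x) \<le> \<epsilon> / 2 ^ (j + 1) * nrm x" if "j \<le> i" for i j x
  proof -
    have "(\<epsilon> / 2 ^ (j + 1) - \<epsilon> / 2 ^ (i + 1)) * nrm x \<le> \<epsilon> / 2 ^ (j + 1) * nrm x"
      using \<epsilon> by (intro mult_right_mono) auto
    then show ?thesis using diff[OF that, of x] by linarith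
  qed
  have lim0: "(\<lambda>m. \<epsilon> / 2 ^ (m + 1) * c) \<longlonglongrightarrow> 0" for c :: real
  proof -
    have "(\<lambda>m. (\<epsilon> * c / 2) * (1 / 2) ^ m) \<longlonglongrightarrow> (\<epsilon> * c / 2) * 0"
      by (intro tendsto_mult_left LIMSEQ_power_zero) auto
    then show ?thesis by (simp add: power_divide field_simps)
  qed
  have "\<exists>l. conv (\<lambda>m. F m x) l" for x
  proof (rule cauchy_conv)
    fix e :: real assume e: "0 < e"
    have "\<forall>\<^sub>F m in sequentially. \<epsilon> / 2 ^ (m + 1) * nrm x < e / 2"
      using lim0[of "nrm x"] e by (intro order_tendstoD(2)) auto
    then obtain N where N: "\<epsilon> / 2 ^ (N + 1) * nrm x < e / 2" by (auto simp: eventually_sequentially)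
    have "nrm (F i x - F j x) < e" if "i \<ge> N" "j \<ge> N" for i j
      using nrm_triangle_mid[of "F i x" "F j x" "F N x"] diff'[OF that(1), of x] diff'[OF that(2), of x] N
        nrm_diff_commute[of "F N x" "F j x"] by linarith
    then show "\<exists>N. \<forall>i\<ge>N. \<forall>j\<ge>N. nrm (F i x - F j x) < e" by blast
  qed
  then obtain S where S: "\<And>x. conv (\<lambda>m. F m x) (S x)" by metis
  have bound: "nrm (S x - F m x) \<le> \<epsilon> / 2 ^ (m + 1) * nrm x" for m x
  proof -
    have "conv (\<lambda>i. F i x - F m x) (S x - F m x)" by (rule conv_diff[OF S conv_const])
    then have "(\<lambda>i. nrm (F i x - F m x)) \<longlonglongrightarrow> nrm (S x - F m x)" by (rule conv_nrm)
    then show ?thesis using diff' by (intro LIMSEQ_le_const2) auto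
  qed
  have "bop S"
  proof (rule bopI[where C = "\<epsilon> / 2"])
    show "nrm (S x) \<le> \<epsilon> / 2 * nrm x" for x using bound[of x 0] by (simp add: F_def)
    show "S (x + y) = S x + S y" for x y
      using conv_unique[OF S[of "x + y"]] conv_add[OF S[of x] S[of y]] by (simp add: bopD[OF bF])
    show "S (r \<cdot> x) = r \<cdot> S x" for r x
      using conv_unique[OF S[of "r \<cdot> x"]] conv_sc[OF S[of x]] by (simp add: bopD[OF bF])
  qed
  then show ?thesis using S bound unfolding F_def by blast
qed

end

section \<open>The bounded transform of a normal operator\<close>

text \<open>\<open>isadj y z\<close> says that \<open>y\<close> lies in the domain of the adjoint of \<open>T\<close>, with value \<open>z\<close>.
  The last two assumptions are the two inclusions of normality.\<close>

locale real_normal = real_hilbert sc inn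
  for sc :: "real \<Rightarrow> 'h::ab_group_add \<Rightarrow> 'h" (infixr \<open>\<cdot>\<close> 75) and inn (infixl \<open>\<star>\<close> 70) +
  fixes D :: "'h set" and T :: "'h \<Rightarrow> 'h" and isadj :: "'h \<Rightarrow> 'h \<Rightarrow> bool"
  defines "isadj y z \<equiv> (\<forall>x\<in>D. y \<star> T x = z \<star> x)"
  assumes D_zero: "0 \<in> D" and D_add: "x \<in> D \<Longrightarrow> y \<in> D \<Longrightarrow> x + y \<in> D" and D_sc: "x \<in> D \<Longrightarrow> r \<cdot> x \<in> D"
    and T_add: "x \<in> D \<Longrightarrow> y \<in> D \<Longrightarrow> T (x + y) = T x + T y"
    and T_sc: "x \<in> D \<Longrightarrow> T (r \<cdot> x) = r \<cdot> T x"
    and T_closed: "(\<And>n. X n \<in> D) \<Longrightarrow> conv X x \<Longrightarrow> conv (\<lambda>n. T (X n)) y \<Longrightarrow> x \<in> D \<and> T x = y"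
    and dense: "(\<And>y. y \<in> D \<Longrightarrow> x \<star> y = 0) \<Longrightarrow> x = 0"
    and normal1: "x \<in> D \<Longrightarrow> isadj (T x) w \<Longrightarrow> \<exists>z\<in>D. isadj x z \<and> T z = w"
    and normal2: "isadj y z \<Longrightarrow> z \<in> D \<Longrightarrow> y \<in> D \<and> isadj (T y) (T z)"
begin

lemma D_diff: "x \<in> D \<Longrightarrow> y \<in> D \<Longrightarrow> x - y \<in> D"
  using D_add[of x "- 1 \<cdot> y"] D_sc[of y "- 1"] by simp

lemma T_diff: "x \<in> D \<Longrightarrow> y \<in> D \<Longrightarrow> T (x - y) = T x - T y"
  using T_add[of x "- 1 \<cdot> y"] T_sc[of y "- 1"] D_sc[of y "- 1"] by simp

lemma isadjD: "isadj y z \<Longrightarrow> x \<in> D \<Longrightarrow> y \<star> T x = z \<star> x"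
  by (simp add: isadj_def)

lemma isadj_unique: "isadj y z \<Longrightarrow> isadj y z' \<Longrightarrow> z = z'"
  using dense[of "z - z'"] by (simp add: isadj_def inn_simps)

text \<open>Von Neumann's solution of u + T*T u = x in weak form: Riesz for the graph inner product,
  whose completeness is the closedness of T.\<close>

lemma graph_riesz: "\<exists>u. u \<in> D \<and> (\<forall>w\<in>D. u \<star> w + T u \<star> T w = x \<star> w)"
proof -
  have "\<exists>X. (\<forall>n. X n \<in> D) \<and>
    (\<forall>e>0. \<exists>N. \<forall>m\<ge>N. \<forall>n\<ge>N. (X m - X n) \<star> (X m - X n) + T (X m - X n) \<star> T (X m - X n) < e) \<and>
    (\<forall>y\<in>D. (\<lambda>n. X n \<star> y + T (X n) \<star> T y) \<longlonglongrightarrow> x \<star> y)"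
  proof (rule riesz_sequence[where C = "nrm x"])
    fix w assume "w \<in> D"
    have "\<bar>x \<star> w\<bar> \<le> nrm x * nrm w" by (rule cauchy_schwarz)
    also have "\<dots> \<le> nrm x * sqrt (w \<star> w + T w \<star> T w)"
      by (intro mult_left_mono) (auto simp: nrm_def inn_nonneg)
    finally show "\<bar>x \<star> w\<bar> \<le> nrm x * sqrt (w \<star> w + T w \<star> T w)" .
  next
    fix a b show "a \<star> b + T a \<star> T b = b \<star> a + T b \<star> T a" by (metis inn_commute)
  qed (auto simp: D_zero D_add D_sc T_add T_sc inn_simps inn_nonneg algebra_simps)
  then obtain X where X: "\<And>n. X n \<in> D"
    "\<And>e. e > 0 \<Longrightarrow> \<exists>N. \<forall>m\<ge>N. \<forall>n\<ge>N. (X m - X n) \<star> (X m - X n) + T (X m - X n) \<star> T (X m - X n) < e"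
    "\<And>y. y \<in> D \<Longrightarrow> (\<lambda>n. X n \<star> y + T (X n) \<star> T y) \<longlonglongrightarrow> x \<star> y" by blast
  have C: "\<exists>N. \<forall>m\<ge>N. \<forall>n\<ge>N. nrm (X m - X n) < e \<and> nrm (T (X m) - T (X n)) < e" if e: "0 < e" for e
  proof -
    obtain N where N: "\<forall>m\<ge>N. \<forall>n\<ge>N. (X m - X n) \<star> (X m - X n) + T (X m - X n) \<star> T (X m - X n) < e\<^sup>2"
      using X(2)[of "e\<^sup>2"] e by auto
    have "nrm (X m - X n) < e \<and> nrm (T (X m) - T (X n)) < e" if "m \<ge> N" "n \<ge> N" for m n
    proof -
      have "(X m - X n) \<star> (X m - X n) + T (X m - X n) \<star> T (X m - X n) < e\<^sup>2" using N that by blast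
      then have "(nrm (X m - X n))\<^sup>2 < e\<^sup>2" "(nrm (T (X m - X n)))\<^sup>2 < e\<^sup>2"
        unfolding nrm_sq using inn_nonneg[of "X m - X n"] inn_nonneg[of "T (X m - X n)"] by linarith+
      then show ?thesis using e power2_less_imp_less by (metis T_diff X(1) less_eq_real_def)
    qed
    then show ?thesis by blast
  qed
  obtain u where u: "conv X u" using cauchy_conv[of X] C by blast
  obtain v where v: "conv (\<lambda>n. T (X n)) v" using cauchy_conv[of "\<lambda>n. T (X n)"] C by blast
  have uD: "u \<in> D" "T u = v" using T_closed[OF X(1) u v] by auto
  have "u \<star> w + T u \<star> T w = x \<star> w" if "w \<in> D" for w
    using LIMSEQ_unique[OF tendsto_add[OF conv_inn[OF u, of w] conv_inn[OF v, of "T w"]] X(3)[OF that]] uD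
    by simp
  then show ?thesis using uD by blast
qed

text \<open>The operators \<open>S = (1 + T*T)\<^sup>-\<^sup>1\<close>, \<open>Z = T S\<close> and \<open>Z' = T* S\<close>.\<close>

definition S :: "'h \<Rightarrow> 'h" where
  "S x = (SOME u. u \<in> D \<and> (\<forall>w\<in>D. u \<star> w + T u \<star> T w = x \<star> w))"

definition Z :: "'h \<Rightarrow> 'h" where "Z x = T (S x)"

definition Z' :: "'h \<Rightarrow> 'h" where
  "Z' x = (SOME z. z \<in> D \<and> isadj (S x) z \<and> T z = x - S x)"

lemma S_in: "S x \<in> D" and S_eq: "w \<in> D \<Longrightarrow> S x \<star> w + T (S x) \<star> T w = x \<star> w"
  using someI_ex[OF graph_riesz[of x]] unfolding S_def[symmetric] by auto

lemma S_unique: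
  assumes "u \<in> D" "\<And>w. w \<in> D \<Longrightarrow> u \<star> w + T u \<star> T w = x \<star> w"
  shows "S x = u"
proof -
  let ?d = "S x - u"
  have "?d \<in> D" using D_diff S_in assms(1) by blast
  then have "?d \<star> ?d + T ?d \<star> T ?d = 0"
    using S_eq[of ?d x] assms(2)[of ?d] by (simp add: T_diff S_in assms(1) inn_diff_left)
  then have "?d \<star> ?d = 0" using inn_nonneg[of ?d] inn_nonneg[of "T ?d"] by linarith
  then show ?thesis using inn_eq_0 by (metis eq_iff_diff_eq_0)
qed

lemma isadj_Z: "isadj (Z x) (x - S x)"
  unfolding isadj_def Z_def using S_eq[of _ x] by (simp add: inn_diff_left eq_diff_eq add.commute)

text \<open>By \<open>isadj_Z\<close>, T S x lies in the domain of T* with T*T S x = x - S x.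
  Normality then puts S x into the domain of T* and gives T T* S x the same value.\<close>

lemma Z'_in: "Z' x \<in> D" and isadj_Z': "isadj (S x) (Z' x)" and T_Z': "T (Z' x) = x - S x"
proof -
  have "\<exists>z. z \<in> D \<and> isadj (S x) z \<and> T z = x - S x"
    using normal1[OF S_in isadj_Z[unfolded Z_def]] by blast
  from someI_ex[OF this] show "Z' x \<in> D" "isadj (S x) (Z' x)" "T (Z' x) = x - S x"
    unfolding Z'_def[symmetric] by auto
qed

lemma S_energy: "S x \<star> x = (nrm (S x))\<^sup>2 + (nrm (Z x))\<^sup>2"
  using S_eq[OF S_in, of x x] by (simp add: nrm_sq Z_def inn_commute)

lemma S_contr: "nrm (S x) \<le> nrm x"
proof -
  have "(nrm (S x))\<^sup>2 \<le> nrm (S x) * nrm x"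
    using S_energy[of x] inn_le_nrm[of "S x" x] zero_le_power2[of "nrm (Z x)"] by linarith
  then show ?thesis
    by (metis mult_le_cancel_left_pos nrm_nonneg order_le_less power2_eq_square)
qed

lemma Z_contr: "nrm (Z x) \<le> nrm x"
proof (rule power2_le_imp_le)
  have "(nrm (Z x))\<^sup>2 \<le> nrm (S x) * nrm x"
    using S_energy[of x] inn_le_nrm[of "S x" x] zero_le_power2[of "nrm (S x)"] by linarith
  also have "\<dots> \<le> nrm x * nrm x" by (intro mult_right_mono S_contr) simp
  finally show "(nrm (Z x))\<^sup>2 \<le> (nrm x)\<^sup>2" by (simp add: power2_eq_square)
qed simp

lemma selfadj_S: "selfadj S"
proof -
  have "S (x + y) = S x + S y" for x y
  proof (rule S_unique)
    fix w assume "w \<in> D"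
    then show "(S x + S y) \<star> w + T (S x + S y) \<star> T w = (x + y) \<star> w"
      using S_eq[of w x] S_eq[of w y] by (simp add: T_add S_in inn_add_left)
  qed (simp add: D_add S_in)
  moreover have "S (r \<cdot> x) = r \<cdot> S x" for r x
  proof (rule S_unique)
    fix w assume "w \<in> D"
    then show "(r \<cdot> S x) \<star> w + T (r \<cdot> S x) \<star> T w = (r \<cdot> x) \<star> w"
      using S_eq[of w x] by (simp add: T_sc S_in inn_sc_left flip: distrib_left)
  qed (simp add: D_sc S_in)
  ultimately have "bop S" using S_contr by (intro bopI[where C = 1]) auto
  moreover have "S x \<star> y = x \<star> S y" for x y
    using S_eq[OF S_in, of y x] S_eq[OF S_in, of x y] by (metis inn_commute)
  ultimately show ?thesis by (simp add: selfadj_def)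
qed

lemma S_inj: "S x = 0 \<Longrightarrow> x = 0"
  using S_eq[of _ x] T_sc[OF D_zero, of 0] by (intro dense) (auto simp: inn_simps)

lemma Z_bop: "bop Z"
proof (rule bopI[where C = 1])
  show "Z (x + y) = Z x + Z y" "Z (r \<cdot> x) = r \<cdot> Z x" for x y r
    by (simp_all add: Z_def bopD[OF selfadj_bop[OF selfadj_S]] T_add T_sc S_in)
qed (simp add: Z_contr)

lemma Z_adj: "Z x \<star> y = x \<star> Z' y"
proof -
  \<comment> \<open>The adjoint relation applies to S y, which lies in the domain of T*, and to y -
    S y = T (Z' y), but not directly to y.\<close>
  have "Z x \<star> y = Z x \<star> S y + Z x \<star> (y - S y)" by (simp add: inn_diff_right)
  also have "Z x \<star> S y = S x \<star> Z' y"
    using isadjD[OF isadj_Z' S_in, of y x] by (metis Z_def inn_commute)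
  also have "Z x \<star> (y - S y) = (x - S x) \<star> Z' y"
    using isadjD[OF isadj_Z Z'_in, of x y] by (simp add: T_Z')
  finally show ?thesis by (simp add: inn_diff_left)
qed

lemma Z'_adj: "Z' x \<star> y = x \<star> Z y"
  by (metis Z_adj inn_commute)

lemma Z'_contr: "nrm (Z' x) \<le> nrm x"
proof -
  have "(nrm (Z' x))\<^sup>2 \<le> nrm (Z' x) * nrm x"
    using inn_le_nrm[of "Z (Z' x)" x] Z_contr[of "Z' x"] mult_right_mono[of "nrm (Z (Z' x))" "nrm (Z' x)" "nrm x"]
    by (simp add: nrm_sq Z_adj)
  then show ?thesis
    by (metis mult_le_cancel_left_pos nrm_nonneg order_le_less power2_eq_square)
qed

lemma Z'_bop: "bop Z'"
proof (rule bopI[where C = 1])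
  show "Z' (x + y) = Z' x + Z' y" "Z' (r \<cdot> x) = r \<cdot> Z' x" for x y r
    by (rule inn_ext; simp add: Z'_adj inn_simps)+
qed (simp add: Z'_contr)

text \<open>Since T*T S^2 x = S x - S^2 x lies in D, the second inclusion of normality gives T*T (T
  S^2 x) = T (S x - S^2 x). Thus T S^2 x solves the equation that characterises S (Z x).\<close>

lemma S_Z: "S (Z x) = Z (S x)"
proof -
  let ?w = "S (S x)"
  have d: "S x - ?w \<in> D" by (simp add: D_diff S_in)
  have "isadj (T ?w) (S x - ?w)" using isadj_Z[of "S x"] by (simp add: Z_def)
  note * = normal2[OF this d]
  have "S (Z x) = T ?w"
  proof (rule S_unique)
    fix v assume "v \<in> D"
    then show "T ?w \<star> v + T (T ?w) \<star> T v = Z x \<star> v"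
      using isadjD[OF conjunct2[OF *], of v] by (simp add: T_diff S_in inn_diff_left Z_def)
  qed (use * in simp)
  then show ?thesis by (simp add: Z_def)
qed

lemma S_Z': "S (Z' x) = Z' (S x)"
  by (rule inn_ext) (simp add: selfadj_inn[OF selfadj_S] Z'_adj S_Z)

text \<open>Both sides equal S x - S^2 x: the left one is T T* S^2 x and the right one T*T S^2
  x.\<close>

lemma Z_Z': "Z (Z' x) = Z' (Z x)"
proof -
  have "Z (Z' x) = S x - S (S x)" by (simp add: Z_def S_Z' T_Z')
  moreover have "isadj (S (Z x)) (S x - S (S x))" using isadj_Z[of "S x"] by (simp add: S_Z)
  ultimately show ?thesis using isadj_unique[OF isadj_Z'] by simp
qed

context
  fixes U assumes U: "adjpm U" "\<And>x. x \<in> D \<Longrightarrow> U x \<in> D" "\<And>x. x \<in> D \<Longrightarrow> T (U x) = U (T x)"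
begin

text \<open>With U the right multiplication by i or j, this and the next two lemmas transfer right
  linearity from T to S, Z and Z'.\<close>

lemma commuting_S: "S (U x) = U (S x)"
proof -
  obtain \<eta> where \<eta>: "\<And>x y. U x \<star> y = \<eta> * (x \<star> U y)" using U by (auto simp: adjpm_def)
  show ?thesis
  proof (rule S_unique)
    fix w assume "w \<in> D"
    then show "U (S x) \<star> w + T (U (S x)) \<star> T w = U x \<star> w"
      using S_eq[OF U(2), of w x] by (simp add: \<eta> U S_in flip: distrib_left)
  qed (simp add: U S_in)
qed

lemma commuting_Z: "Z (U x) = U (Z x)"
  by (simp add: Z_def commuting_S U S_in)

lemma commuting_Z': "Z' (U x) = U (Z' x)"
proof -
  obtain \<eta> where \<eta>: "\<And>x y. U x \<star> y = \<eta> * (x \<star> U y)" using U by (auto simp: adjpm_def)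
  show ?thesis by (rule inn_ext) (simp add: Z'_adj \<eta> flip: commuting_Z)
qed

end

end

section \<open>Quaternionic Hilbert spaces\<close>

lemmas quat_defs = zero_quat_def one_quat_def plus_quat_def uminus_quat_def minus_quat_def times_quat_def

lemma quat_sel [simp]:
  "qre (p + q) = qre p + qre q" "qi (p + q) = qi p + qi q" "qj (p + q) = qj p + qj q" "qk (p + q) = qk p + qk q"
  "qre (p - q) = qre p - qre q" "qi (p - q) = qi p - qi q" "qj (p - q) = qj p - qj q" "qk (p - q) = qk p - qk q"
  "qre (- q) = - qre q" "qi (- q) = - qi q" "qj (- q) = - qj q" "qk (- q) = - qk q"
  "qre 0 = 0" "qi 0 = 0" "qj 0 = 0" "qk 0 = 0" "qre 1 = 1" "qi 1 = 0" "qj 1 = 0" "qk 1 = 0"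
  "qre (qcnj q) = qre q" "qi (qcnj q) = - qi q" "qj (qcnj q) = - qj q" "qk (qcnj q) = - qk q"
  by (simp_all add: quat_defs qcnj_def)

lemma quat_mult_sel:
  "qre (p * q) = qre p * qre q - qi p * qi q - qj p * qj q - qk p * qk q"
  "qi (p * q) = qre p * qi q + qi p * qre q + qj p * qk q - qk p * qj q"
  "qj (p * q) = qre p * qj q - qi p * qk q + qj p * qre q + qk p * qi q"
  "qk (p * q) = qre p * qk q + qi p * qj q - qj p * qi q + qk p * qre q"
  by (simp_all add: times_quat_def)

lemma quat_eqI: "qre p = qre q \<Longrightarrow> qi p = qi q \<Longrightarrow> qj p = qj q \<Longrightarrow> qk p = qk q \<Longrightarrow> p = q"
  by (rule quat.expand) auto

abbreviation (input) qreal :: "real \<Rightarrow> quat" where "qreal r \<equiv> Quat r 0 0 0"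

definition qI :: quat where "qI = Quat 0 1 0 0"
definition qJ :: quat where "qJ = Quat 0 0 1 0"

lemma qIJ_sel [simp]:
  "qre qI = 0" "qi qI = 1" "qj qI = 0" "qk qI = 0" "qre qJ = 0" "qi qJ = 0" "qj qJ = 1" "qk qJ = 0"
  by (simp_all add: qI_def qJ_def)

lemma qunit_mult:
  "qI * qI = - 1" "qJ * qJ = - 1" "qJ * qI = - (qI * qJ)"
  by (auto intro!: quat_eqI simp: quat_mult_sel)

lemma qcnj_simps:
  "qcnj (qcnj p) = p" "qcnj (p * q) = qcnj q * qcnj p" "qcnj (p + q) = qcnj p + qcnj q"
  "qcnj 0 = 0" "qcnj 1 = 1" "qcnj (- p) = - qcnj p" "qcnj (Quat r 0 0 0) = Quat r 0 0 0"
  "qcnj qI = - qI" "qcnj qJ = - qJ"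
  by (auto intro!: quat_eqI simp: quat_mult_sel algebra_simps)

lemma qre_mult_commute: "qre (p * q) = qre (q * p)"
  by (simp add: quat_mult_sel algebra_simps)

lemma qabs_nonneg [simp]: "0 \<le> qabs q"
  by (simp add: qabs_def)

lemma qabs_sq: "(qabs q)\<^sup>2 = (qre q)\<^sup>2 + (qi q)\<^sup>2 + (qj q)\<^sup>2 + (qk q)\<^sup>2"
  by (simp add: qabs_def)

lemma mult_qcnj: "q * qcnj q = qreal ((qabs q)\<^sup>2)" "qcnj q * q = qreal ((qabs q)\<^sup>2)"
  by (auto intro!: quat_eqI simp: quat_mult_sel qabs_sq simp flip: power2_eq_square)

lemma qabs_qcnj [simp]: "qabs (qcnj q) = qabs q"
  by (simp add: qabs_def)

lemma abs_qre_le: "\<bar>qre q\<bar> \<le> qabs q"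
  by (rule power2_le_imp_le) (auto simp: qabs_sq)

lemma qreal_mult: "qreal r * qreal s = qreal (r * s)"
  by (auto intro!: quat_eqI simp: quat_mult_sel)

lemma qreal_commute: "qreal r * q = q * qreal r"
  by (auto intro!: quat_eqI simp: quat_mult_sel)

lemma quat_decomp: "q = qreal (qre q) + qI * qreal (qi q) + qJ * qreal (qj q) + qI * qJ * qreal (qk q)"
  by (auto intro!: quat_eqI simp: quat_mult_sel)

lemma qreal_cases:
  assumes "qi q = 0" "qj q = 0" "qk q = 0"
  shows "q = qreal (qre q)"
  using assms by (auto intro!: quat_eqI)

locale quat_hilbert_space =
  fixes sm :: "'h::ab_group_add \<Rightarrow> quat \<Rightarrow> 'h" and ip :: "'h \<Rightarrow> 'h \<Rightarrow> quat"
  assumes quat_hilbert: "quat_hilbert sm ip"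
begin

definition rsc :: "real \<Rightarrow> 'h \<Rightarrow> 'h" (infixr \<open>\<cdot>\<close> 75) where "r \<cdot> x = sm x (qreal r)"
definition rin :: "'h \<Rightarrow> 'h \<Rightarrow> real" (infixl \<open>\<star>\<close> 70) where "x \<star> y = qre (ip x y)"

lemma
  shows sm_one [simp]: "sm x 1 = x" and sm_sm: "sm (sm x p) q = sm x (p * q)"
    and sm_add: "sm (x + y) q = sm x q + sm y q" and sm_qadd: "sm x (p + q) = sm x p + sm x q"
    and ip_comb: "ip u (sm v p + sm w q) = ip u v * p + ip u w * q"
    and ip_cnj: "ip u v = qcnj (ip v u)"
    and ip_nonneg: "qnonneg (ip u u)"
    and ip_eq_0: "ip u u = 0 \<longleftrightarrow> u = 0"
proof -
  note h = quat_hilbert[unfolded quat_hilbert_def]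
  note r = conjunct2
  show "sm x 1 = x" by (rule h[THEN conjunct1, rule_format])
  show "sm (sm x p) q = sm x (p * q)" by (rule h[THEN r, THEN conjunct1, rule_format])
  show "sm (x + y) q = sm x q + sm y q" by (rule h[THEN r, THEN r, THEN conjunct1, rule_format])
  show "sm x (p + q) = sm x p + sm x q" by (rule h[THEN r, THEN r, THEN r, THEN conjunct1, rule_format])
  note h = h[THEN r, THEN r, THEN r, THEN r]
  show "ip u (sm v p + sm w q) = ip u v * p + ip u w * q" by (rule h[THEN conjunct1, rule_format])
  show "ip u v = qcnj (ip v u)" by (rule h[THEN r, THEN conjunct1, rule_format])
  show "qnonneg (ip u u)" by (rule h[THEN r, THEN r, THEN conjunct1, rule_format])
  show "ip u u = 0 \<longleftrightarrow> u = 0" by (rule h[THEN r, THEN r, THEN r, THEN conjunct1, rule_format])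
qed

lemma sm_zero [simp]: "sm x 0 = 0"
  using sm_qadd[of x 0 0] by simp

lemma sm_zero_left [simp]: "sm 0 q = 0"
  using sm_add[of 0 0 q] by simp

lemma sm_minus: "sm x (- q) = - sm x q"
  using sm_qadd[of x "- q" q] by (simp add: eq_neg_iff_add_eq_0)

lemma sm_minus_left: "sm (- x) q = - sm x q"
  using sm_add[of "- x" x q] by (simp add: eq_neg_iff_add_eq_0)

lemma sm_diff: "sm (x - y) q = sm x q - sm y q"
  using sm_add[of x "- y" q] by (simp add: sm_minus_left)

lemma sm_sum: "sm (sum f A) q = (\<Sum>a\<in>A. sm (f a) q)"
  by (induction A rule: infinite_finite_induct) (auto simp: sm_add)

lemma ip_add: "ip u (v + w) = ip u v + ip u w"
  using ip_comb[of u v 1 w 1] by simp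

lemma ip_sm: "ip u (sm v p) = ip u v * p"
  using ip_comb[of u v p v 0] by simp

lemma ip_add_left: "ip (u + v) w = ip u w + ip v w"
  by (metis ip_cnj ip_add qcnj_simps(3))

lemma ip_sm_left: "ip (sm u p) v = qcnj p * ip u v"
  by (metis ip_cnj ip_sm qcnj_simps(2))

lemma ip_zero [simp]: "ip u 0 = 0" "ip 0 u = 0"
  using ip_add[of u 0 0] ip_add_left[of 0 0 u] by auto

lemma ip_minus: "ip u (- v) = - ip u v" "ip (- u) v = - ip u v"
  using ip_add[of u "- v" v] ip_add_left[of "- u" u v] by (auto simp: eq_neg_iff_add_eq_0)

lemma ip_diff: "ip u (v - w) = ip u v - ip u w" "ip (u - v) w = ip u w - ip v w"
  using ip_add[of u v "- w"] ip_add_left[of u "- v" w] by (auto simp: ip_minus)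

lemma ip_sum: "ip u (sum f A) = (\<Sum>a\<in>A. ip u (f a))" "ip (sum f A) u = (\<Sum>a\<in>A. ip (f a) u)"
  by (induction A rule: infinite_finite_induct; simp add: ip_add ip_add_left)+

lemma ip_self: "ip x x = qreal (x \<star> x)"
  using ip_nonneg[of x] qreal_cases[of "ip x x"] by (simp add: qnonneg_def rin_def)

lemma sm_sc: "sm (r \<cdot> x) q = r \<cdot> sm x q"
  by (simp add: rsc_def sm_sm qreal_commute)

sublocale real_hilbert rsc rin
proof
  show "r \<cdot> (x + y) = r \<cdot> x + r \<cdot> y" for r x y by (simp add: rsc_def sm_add)
  show "(r + s) \<cdot> x = r \<cdot> x + s \<cdot> x" for r s x
    using sm_qadd[of x "qreal r" "qreal s"] by (simp add: rsc_def plus_quat_def)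
  show "r \<cdot> s \<cdot> x = (r * s) \<cdot> x" for r s x
    by (simp add: rsc_def sm_sm qreal_mult mult.commute)
  show "1 \<cdot> x = x" for x using sm_one[of x] by (simp add: rsc_def one_quat_def)
  show "x \<star> y = y \<star> x" for x y unfolding rin_def by (metis ip_cnj quat_sel(21))
  show "(x + y) \<star> z = x \<star> z + y \<star> z" for x y z by (simp add: rin_def ip_add_left)
  show "(r \<cdot> x) \<star> y = r * (x \<star> y)" for r x y
    by (simp add: rin_def rsc_def ip_sm_left qcnj_simps quat_mult_sel)
  show "0 \<le> x \<star> x" for x using ip_nonneg[of x] by (simp add: rin_def qnonneg_def)
  show "x = 0" if "x \<star> x = 0" for x
    using that ip_self[of x] by (simp add: ip_eq_0 flip: zero_quat_def)
  show "\<exists>l. (\<lambda>n. sqrt ((X n - l) \<star> (X n - l))) \<longlonglongrightarrow> 0"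
    if "\<forall>e>0. \<exists>N. \<forall>m\<ge>N. \<forall>n\<ge>N. sqrt ((X m - X n) \<star> (X m - X n)) < e" for X
    using that quat_hilbert unfolding quat_hilbert_def hcauchy_def hconv_def hnorm_def rin_def by blast
qed

lemma hnorm_eq: "hnorm ip x = nrm x"
  by (simp add: hnorm_def nrm_def rin_def)

lemma hconv_eq: "hconv ip X l \<longleftrightarrow> conv X l"
  by (simp add: hconv_def conv_def hnorm_eq)

lemma sm_adj: "sm x p \<star> y = x \<star> sm y (qcnj p)"
  unfolding rin_def ip_sm ip_sm_left by (rule qre_mult_commute)

text \<open>Testing with q = 1, i, j, ij reads off the four components from real parts.\<close>

lemma ip_eqI:
  assumes "\<And>q. x \<star> sm y q = u \<star> sm v q"
  shows "ip x y = ip u v"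
proof -
  have "qre (ip x y * q) = qre (ip u v * q)" for q
    using assms[of q] by (simp add: rin_def ip_sm)
  from this[of 1] this[of qI] this[of qJ] this[of "qI * qJ"] show ?thesis
    by (intro quat_eqI) (simp_all add: quat_mult_sel)
qed

lemma nrm_sm: "nrm (sm x q) = qabs q * nrm x"
proof -
  have "sm x q \<star> sm x q = (qabs q)\<^sup>2 * (x \<star> x)"
  proof -
    have "sm x q \<star> sm x q = x \<star> ((qabs q)\<^sup>2 \<cdot> x)"
      by (simp add: sm_adj sm_sm mult_qcnj rsc_def)
    then show ?thesis by (simp add: inn_sc_right)
  qed
  then show ?thesis by (simp add: nrm_def real_sqrt_mult)
qed

lemma qabs_ip_le: "qabs (ip x y) \<le> nrm x * nrm y"
proof -
  let ?a = "ip x y"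
  \<comment> \<open>Multiplying y by the conjugate of the inner product makes that product real,
    which reduces the claim to the real Cauchy-Schwarz inequality.\<close>
  have "(qabs ?a)\<^sup>2 = x \<star> sm y (qcnj ?a)"
    by (simp add: rin_def ip_sm mult_qcnj)
  also have "\<dots> \<le> nrm x * (qabs ?a * nrm y)"
    using inn_le_nrm[of x "sm y (qcnj ?a)"] by (simp add: nrm_sm)
  finally have "qabs ?a * qabs ?a \<le> qabs ?a * (nrm x * nrm y)"
    by (simp add: power2_eq_square algebra_simps)
  then show ?thesis
    by (metis mult_le_cancel_left_pos qabs_nonneg order_le_less mult_nonneg_nonneg nrm_nonneg)
qed

lemma bop_sm: "bop (\<lambda>x. sm x q)"
  by (rule bopI[where C = "qabs q"]) (simp_all add: sm_add sm_sc nrm_sm)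

lemma adjpm_sm: "qcnj q = - q \<Longrightarrow> adjpm (\<lambda>x. sm x q)"
  unfolding adjpm_def using bop_sm[of q]
  by (auto simp: sm_adj sm_minus inn_simps intro!: exI[of _ "- 1"])

section \<open>Right linearity as commutation\<close>

definition homog :: "('h \<Rightarrow> 'h) \<Rightarrow> bool" where
  "homog f \<longleftrightarrow> (\<forall>x q. f (sm x q) = sm (f x) q)"

lemma homogD: "homog f \<Longrightarrow> f (sm x q) = sm (f x) q"
  by (simp add: homog_def)

text \<open>Real-linearity and k = ij reduce right linearity to the two units i and j.\<close>

lemma homogI:
  assumes "bop f" "\<And>x. f (sm x qI) = sm (f x) qI" "\<And>x. f (sm x qJ) = sm (f x) qJ"
  shows "homog f"
  unfolding homog_def
proof (intro allI)
  fix x q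
  have r: "f (sm x (qreal r)) = sm (f x) (qreal r)" for x r
    using bopD(2)[OF assms(1), of r x] by (simp add: rsc_def)
  have dec: "sm y q = sm y (qreal (qre q)) + sm (sm y qI) (qreal (qi q)) + sm (sm y qJ) (qreal (qj q))
     + sm (sm (sm y qI) qJ) (qreal (qk q))" for y
    unfolding sm_sm sm_qadd[symmetric] quat_decomp[symmetric] ..
  show "f (sm x q) = sm (f x) q"
    unfolding dec by (simp only: bopD[OF assms(1)] r assms(2,3))
qed

lemma homog_add: "homog f \<Longrightarrow> homog g \<Longrightarrow> homog (\<lambda>x. f x + g x)"
  by (simp add: homog_def sm_add)

lemma homog_diff: "homog f \<Longrightarrow> homog g \<Longrightarrow> homog (\<lambda>x. f x - g x)"
  by (simp add: homog_def sm_diff)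

lemma homog_sc: "homog f \<Longrightarrow> homog (\<lambda>x. r \<cdot> f x)"
  by (simp add: homog_def sm_sc)

lemma homog_sum: "(\<And>a. a \<in> A \<Longrightarrow> homog (f a)) \<Longrightarrow> homog (\<lambda>x. \<Sum>a\<in>A. f a x)"
  by (simp add: homog_def sm_sum)

lemma ip_adjoint:
  assumes "homog f" "homog g" "\<And>x y. f x \<star> y = x \<star> g y"
  shows "ip (f x) y = ip x (g y)"
  by (rule ip_eqI) (simp only: assms(3) homogD[OF assms(2), symmetric])

text \<open>Right multiplication by i and by j are test operators of \<open>bicom\<close>, so right
  linearity passes from W to its bicommutant.\<close>

lemma homog_bicom:
  assumes "bicom W f" "homog W" "bop f"
  shows "homog f"
proof (rule homogI[OF assms(3)])
  show "f (sm x qI) = sm (f x) qI" "f (sm x qJ) = sm (f x) qJ" for x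
    using bicomD[OF assms(1) adjpm_sm[of qI], of x] bicomD[OF assms(1) adjpm_sm[of qJ], of x] assms(2)
    by (simp_all add: cmt_def homog_def qcnj_simps)
qed

section \<open>Finite orthonormal systems\<close>

definition orthoset :: "'h set \<Rightarrow> bool" where
  "orthoset B \<longleftrightarrow> (\<forall>a\<in>B. \<forall>b\<in>B. ip a b = (if a = b then 1 else 0))"

definition fproj :: "'h set \<Rightarrow> 'h \<Rightarrow> 'h" where
  "fproj B x = (\<Sum>b\<in>B. sm b (ip b x))"

lemma homog_fproj: "homog (fproj B)"
  by (simp add: homog_def fproj_def ip_sm sm_sum sm_sm)

lemma fproj_ip_sym: "ip (fproj B x) y = ip x (fproj B y)"
  by (simp add: fproj_def ip_sum ip_sm ip_sm_left flip: ip_cnj)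

lemma fproj_sym: "fproj B x \<star> y = x \<star> fproj B y"
  by (simp add: rin_def fproj_ip_sym)

context
  fixes B assumes B: "finite B" "orthoset B"
begin

lemma ip_ortho_sum: "a \<in> B \<Longrightarrow> ip a (\<Sum>b\<in>B. sm b (c b)) = c a"
proof -
  assume a: "a \<in> B"
  have "ip a (\<Sum>b\<in>B. sm b (c b)) = (\<Sum>b\<in>B. if b = a then c a else 0)"
    unfolding ip_sum using B(2) a by (intro sum.cong) (auto simp: orthoset_def ip_sm)
  then show ?thesis using B(1) a by simp
qed

lemma fproj_ortho_sum: "fproj B (\<Sum>b\<in>B. sm b (c b)) = (\<Sum>b\<in>B. sm b (c b))"
  unfolding fproj_def[of B "\<Sum>b\<in>B. sm b (c b)"] by (simp add: ip_ortho_sum)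

lemma fproj_idem: "fproj B (fproj B x) = fproj B x"
  unfolding fproj_def[of B x] by (rule fproj_ortho_sum)

lemma ip_fproj: "a \<in> B \<Longrightarrow> ip a (fproj B x) = ip a x"
  unfolding fproj_def by (rule ip_ortho_sum)

lemma fproj_fix: "b \<in> B \<Longrightarrow> fproj B b = b"
proof -
  assume b: "b \<in> B"
  have "fproj B b = (\<Sum>a\<in>B. if a = b then b else 0)"
    unfolding fproj_def using B(2) b by (intro sum.cong) (auto simp: orthoset_def)
  then show ?thesis using B(1) b by simp
qed

lemma bop_fproj: "bop (fproj B)" and fproj_contr: "nrm (fproj B x) \<le> nrm x"
proof -
  show c: "nrm (fproj B x) \<le> nrm x" for x
  proof -
    have "(nrm (fproj B x))\<^sup>2 = x \<star> fproj B x"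
      by (simp add: nrm_sq fproj_sym fproj_idem)
    also have "\<dots> \<le> nrm x * nrm (fproj B x)" by (rule inn_le_nrm)
    finally show ?thesis
      by (metis mult_le_cancel_right nrm_nonneg order_le_less power2_eq_square)
  qed
  show "bop (fproj B)"
  proof (rule bopI[where C = 1])
    show "fproj B (x + y) = fproj B x + fproj B y" for x y
      by (simp add: fproj_def ip_add sm_qadd sum.distrib)
    show "fproj B (r \<cdot> x) = r \<cdot> fproj B x" for r x
      unfolding rsc_def by (rule homogD[OF homog_fproj])
  qed (simp add: c)
qed

end

text \<open>Because the adjoint of f is a multiple of f, a span invariant under f is
  reducing.\<close>

lemma fproj_cmt:
  assumes B: "finite B" "orthoset B" and f: "adjpm f" "homog f"
    and inv: "\<And>b. b \<in> B \<Longrightarrow> fproj B (f b) = f b"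
  shows "fproj B (f x) = f (fproj B x)"
proof -
  obtain \<eta> where \<eta>: "\<And>x y. f x \<star> y = \<eta> * (x \<star> f y)" using f by (auto simp: adjpm_def)
  note lin = bopD[OF adjpm_bop[OF f(1)]] bopD[OF bop_fproj[OF B]]
  have r: "fproj B (f (fproj B x)) = f (fproj B x)" for x
  proof -
    have "f (fproj B x) = (\<Sum>b\<in>B. sm (f b) (ip b x))"
      by (simp add: fproj_def lin_sum[OF bop_lin[OF adjpm_bop[OF f(1)]]] homogD[OF f(2)])
    then show ?thesis
      by (simp add: lin_sum[OF bop_lin[OF bop_fproj[OF B]]] homogD[OF homog_fproj] inv)
  qed
  show ?thesis
  proof (rule inn_ext)
    fix y
    have "fproj B (f x) \<star> y = \<eta> * (x \<star> f (fproj B y))" by (simp add: fproj_sym \<eta>)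
    also have "\<dots> = \<eta> * (x \<star> fproj B (f (fproj B y)))" by (simp add: r)
    also have "\<dots> = fproj B (f (fproj B x)) \<star> y" by (simp only: fproj_sym \<eta>)
    finally show "fproj B (f x) \<star> y = f (fproj B x) \<star> y" by (simp add: r)
  qed
qed

text \<open>A quaternionic rank-one operator is a sum of four real ones, one for each component of
  the coefficient.\<close>

lemma seqcompact_rank_one_quat: "seqcompact (\<lambda>x. sm g (ip c x))"
proof -
  have "\<bar>qi q\<bar> \<le> qabs q" "\<bar>qj q\<bar> \<le> qabs q" "\<bar>qk q\<bar> \<le> qabs q" for q
    by (rule power2_le_imp_le; simp add: qabs_sq)+
  then have "\<bar>f (ip c x)\<bar> \<le> nrm c * nrm x" if "f \<in> {qre, qi, qj, qk}" for f x
    using qabs_ip_le[of c x] abs_qre_le[of "ip c x"] that order_trans by blast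
  then have "seqcompact (\<lambda>x. f (ip c x) \<cdot> h)" if "f \<in> {qre, qi, qj, qk}" for f h
    using that by (intro seqcompact_rank_one) blast
  then have "seqcompact (\<lambda>x. qre (ip c x) \<cdot> g + qi (ip c x) \<cdot> sm g qI + qj (ip c x) \<cdot> sm g qJ
      + qk (ip c x) \<cdot> sm g (qI * qJ))"
    by (intro seqcompact_add) auto
  also have "(\<lambda>x. qre (ip c x) \<cdot> g + qi (ip c x) \<cdot> sm g qI + qj (ip c x) \<cdot> sm g qJ
      + qk (ip c x) \<cdot> sm g (qI * qJ)) = (\<lambda>x. sm g (ip c x))"
    unfolding rsc_def sm_sm sm_qadd[symmetric] quat_decomp[symmetric] ..
  finally show ?thesis .
qed

lemma homog_limit:
  assumes "\<And>m. homog (F m)" "\<And>x. conv (\<lambda>m. F m x) (S x)"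
  shows "homog S"
  unfolding homog_def
proof (intro allI)
  fix x q
  show "S (sm x q) = sm (S x) q"
    using conv_unique[OF assms(2)[of "sm x q"]] bop_conv[OF bop_sm assms(2)[of x], of q]
    by (simp add: homogD[OF assms(1)])
qed

subsection \<open>Joint eigenvectors\<close>

definition qsub :: "'h set \<Rightarrow> bool" where
  "qsub M \<longleftrightarrow> 0 \<in> M \<and> (\<forall>x\<in>M. \<forall>y\<in>M. x + y \<in> M) \<and> (\<forall>x\<in>M. \<forall>q. sm x q \<in> M)"

lemma
  assumes "qsub M"
  shows qsub_zero: "0 \<in> M" and qsub_add: "x \<in> M \<Longrightarrow> y \<in> M \<Longrightarrow> x + y \<in> M"
    and qsub_sm: "x \<in> M \<Longrightarrow> sm x q \<in> M" and qsub_sc: "x \<in> M \<Longrightarrow> r \<cdot> x \<in> M"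
    and qsub_diff: "x \<in> M \<Longrightarrow> y \<in> M \<Longrightarrow> x - y \<in> M"
proof -
  show "0 \<in> M" and a: "x \<in> M \<Longrightarrow> y \<in> M \<Longrightarrow> x + y \<in> M" and s: "x \<in> M \<Longrightarrow> sm x q \<in> M" for x y q
    using assms by (auto simp: qsub_def)
  show "x \<in> M \<Longrightarrow> r \<cdot> x \<in> M" by (simp add: s rsc_def)
  have m: "x \<in> M \<Longrightarrow> - x \<in> M" for x using s[of x "- 1"] by (simp add: sm_minus)
  show "x \<in> M \<Longrightarrow> y \<in> M \<Longrightarrow> x - y \<in> M" using a[of x "- y"] m[of y] by simp
qed

lemma qsub_sum: "qsub M \<Longrightarrow> (\<And>a. a \<in> A \<Longrightarrow> f a \<in> M) \<Longrightarrow> sum f A \<in> M"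
  by (induction A rule: infinite_finite_induct) (auto simp: qsub_zero qsub_add)

lemma fproj_in: "qsub M \<Longrightarrow> B \<subseteq> M \<Longrightarrow> fproj B x \<in> M"
  unfolding fproj_def by (intro qsub_sum qsub_sm) auto

lemma qsub_fix_fproj:
  assumes "finite B" "orthoset B" "bop f" "homog f"
  shows "qsub {z. fproj B (f z) = f z}"
  using assms by (simp add: qsub_def bopD[OF assms(3)] bopD[OF bop_fproj] homogD homog_fproj)

text \<open>Passing from y to y q conjugates an eigenvalue, and all imaginary units are conjugate,
  so the nonzero eigenvalues of J can be normalised to i.\<close>

definition eig :: "('h \<Rightarrow> 'h) set \<Rightarrow> ('h \<Rightarrow> 'h) \<Rightarrow> 'h \<Rightarrow> bool" where
  "eig V J y \<longleftrightarrow> (\<forall>u\<in>V. u y = y \<or> u y = - y) \<and> (J y = 0 \<or> J y = sm y qI)"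

definition commuting_family :: "('h \<Rightarrow> 'h) set \<Rightarrow> ('h \<Rightarrow> 'h) \<Rightarrow> bool" where
  "commuting_family V J \<longleftrightarrow>
    (\<forall>u\<in>V. selfadj u \<and> homog u \<and> (\<forall>x. u (u x) = x) \<and> (\<forall>v\<in>V. \<forall>x. u (v x) = v (u x)) \<and>
      (\<forall>x. J (u x) = u (J x))) \<and>
    adjpm J \<and> homog J \<and> (\<forall>x. J (J (J x)) = - J x)"

lemma commuting_familyD:
  assumes "commuting_family V J"
  shows "u \<in> V \<Longrightarrow> selfadj u" "u \<in> V \<Longrightarrow> homog u" "u \<in> V \<Longrightarrow> u (u x) = x"
    "u \<in> V \<Longrightarrow> v \<in> V \<Longrightarrow> u (v x) = v (u x)" "u \<in> V \<Longrightarrow> J (u x) = u (J x)"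
    "adjpm J" "homog J" "J (J (J x)) = - J x"
  using assms by (auto simp: commuting_family_def)

lemma
  assumes "commuting_family V J" "f \<in> insert J V"
  shows commuting_family_adjpm: "adjpm f" and commuting_family_homog: "homog f"
    and commuting_family_bop: "bop f"
proof -
  show a: "adjpm f" and "homog f"
    using assms by (auto simp: commuting_family_def intro: selfadj_adjpm)
  show "bop f" using a by (rule adjpm_bop)
qed

lemma commuting_family_subset: "commuting_family V' J \<Longrightarrow> V \<subseteq> V' \<Longrightarrow> commuting_family V J"
  unfolding commuting_family_def by blast

lemma eig_subset: "eig V' J y \<Longrightarrow> V \<subseteq> V' \<Longrightarrow> eig V J y"
  by (auto simp: eig_def)

text \<open>Each further involution u splits y into y + u y and y - u y, which stay eigenvectors of
  the earlier ones by commutation. The clause over all M expresses that x lies in the right linear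
  span of Y.\<close>

lemma involution_decomp:
  assumes "finite V" "commuting_family V J" "qsub L" "\<forall>u\<in>V. u ` L \<subseteq> L" "x \<in> L"
  shows "\<exists>Y. finite Y \<and> Y \<subseteq> L \<and> (\<forall>y\<in>Y. \<forall>u\<in>V. u y = y \<or> u y = - y) \<and>
    (\<forall>M. qsub M \<longrightarrow> Y \<subseteq> M \<longrightarrow> x \<in> M)"
  using assms
proof (induction V rule: finite_induct)
  case empty
  show ?case using empty(4) by (intro exI[of _ "{x}"]) auto
next
  case (insert u V)
  have "\<exists>Y. finite Y \<and> Y \<subseteq> L \<and> (\<forall>y\<in>Y. \<forall>u\<in>V. u y = y \<or> u y = - y) \<and>
    (\<forall>M. qsub M \<longrightarrow> Y \<subseteq> M \<longrightarrow> x \<in> M)"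
    using insert.prems commuting_family_subset[OF insert.prems(1)] by (intro insert.IH) auto
  then obtain Y where Y: "finite Y" "Y \<subseteq> L" "\<And>y v. y \<in> Y \<Longrightarrow> v \<in> V \<Longrightarrow> v y = y \<or> v y = - y"
    "\<And>M. qsub M \<Longrightarrow> Y \<subseteq> M \<Longrightarrow> x \<in> M" by blast
  note c = commuting_familyD[OF insert.prems(1)]
  have lin: "v (a + b) = v a + v b" "v (a - b) = v a - v b" "v (- a) = - v a" if "v \<in> insert u V" for v a b
    using bopD[OF selfadj_bop[OF c(1)[OF that]]] by auto
  let ?Y = "(\<lambda>y. y + u y) ` Y \<union> (\<lambda>y. y - u y) ` Y"
  have "v z = z \<or> v z = - z" if z: "z \<in> ?Y" and v: "v \<in> insert u V" for z v
  proof (cases "v = u")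
    case True
    then show ?thesis using z lin[of u] c(3)[of u] by auto
  next
    case False
    obtain y where y: "y \<in> Y" "z = y + u y \<or> z = y - u y" using z by auto
    have "v (u y) = u (v y)" using c(4)[of v u y] v by simp
    then show ?thesis using Y(3)[OF y(1), of v] y(2) v False lin[of v] lin(3)[of u] by fastforce
  qed
  moreover have "x \<in> M" if M: "qsub M" "?Y \<subseteq> M" for M
  proof (rule Y(4)[OF M(1)], rule subsetI)
    fix y assume "y \<in> Y"
    then have "y + u y \<in> M" "y - u y \<in> M" using M(2) by auto
    then have "(1/2) \<cdot> ((y + u y) + (y - u y)) \<in> M"
      by (rule qsub_sc[OF M(1) qsub_add[OF M(1)]])
    also have "(y + u y) + (y - u y) = y + y" by simp
    finally show "y \<in> M" unfolding half_sc .
  qed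
  moreover have "?Y \<subseteq> L"
    using Y(2) insert.prems(3) by (auto intro!: qsub_add[OF insert.prems(2)] qsub_diff[OF insert.prems(2)])
  ultimately show ?case using Y(1) by (intro exI[of _ ?Y]) auto
qed

text \<open>On the range of \<open>J\<close>, where \<open>J\<^sup>2 = -1\<close>, a vector \<open>v\<close> is half the sum of \<open>v - (J v) i\<close> and
  \<open>v + (J v) i\<close>; the first one is an eigenvector for \<open>i\<close>, and so is the second one multiplied by \<open>j\<close>.\<close>

lemma eig_decomp:
  assumes "finite V" "commuting_family V J" "qsub L" "\<forall>u\<in>V. u ` L \<subseteq> L"
    "J ` L \<subseteq> L" "x \<in> L"
  shows "\<exists>Y. finite Y \<and> Y \<subseteq> L \<and> (\<forall>y\<in>Y. eig V J y) \<and> (\<forall>M. qsub M \<longrightarrow> Y \<subseteq> M \<longrightarrow> x \<in> M)"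
proof -
  obtain Y where Y: "finite Y" "Y \<subseteq> L" "\<And>y v. y \<in> Y \<Longrightarrow> v \<in> V \<Longrightarrow> v y = y \<or> v y = - y"
    "\<And>M. qsub M \<Longrightarrow> Y \<subseteq> M \<Longrightarrow> x \<in> M"
    using involution_decomp[of V J L x, OF assms(1-4,6)] by blast
  note c = commuting_familyD[OF assms(2)]
  note J [simp] = bopD[OF adjpm_bop[OF c(6)]] homogD[OF c(7)] c(8)
  \<comment> \<open>Write y = f0 y - v with v = J (J y). Here f0 y lies in the kernel of J, and f1,
    f2 are the two eigenvectors made from v, using J v = - J y.\<close>
  define f0 where "f0 y = y + J (J y)" for y
  define f1 where "f1 y = J (J y) + sm (J y) qI" for y
  define f2 where "f2 y = sm (J (J y) - sm (J y) qI) qJ" for y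
  have J0: "J (f0 y) = 0" for y by (simp add: f0_def)
  have J1: "J (f1 y) = sm (f1 y) qI" for y
    by (simp add: f1_def sm_add sm_sm qunit_mult sm_minus add.commute)
  have J2: "J (f2 y) = sm (f2 y) qI" for y
    by (simp add: f2_def sm_diff sm_sm qunit_mult sm_minus mult.assoc)
      (simp add: qunit_mult sm_minus sm_minus_left flip: mult.assoc)
  let ?Y = "f0 ` Y \<union> f1 ` Y \<union> f2 ` Y"
  have fin: "finite ?Y" using Y(1) by simp
  have sub: "?Y \<subseteq> L"
    using Y(2) assms(5) by (auto simp: f0_def f1_def f2_def image_subset_iff subset_iff
        intro!: qsub_add qsub_diff qsub_sm assms(3))
  have ev: "u z = z \<or> u z = - z" if z: "z \<in> ?Y" and u: "u \<in> V" for z u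
  proof -
    obtain y f where y: "y \<in> Y" "z = f y" "f = f0 \<or> f = f1 \<or> f = f2" using z by blast
    have Ju: "J (u a) = u (J a)" for a by (rule c(5)[OF u])
    have comm: "u (f y) = f (u y)"
      using y(3) by (auto simp: f0_def f1_def f2_def Ju bopD[OF selfadj_bop[OF c(1)[OF u]]]
          homogD[OF c(2)[OF u]])
    have "f (- y) = - f y"
      using y(3) by (auto simp: f0_def f1_def f2_def sm_minus_left sm_add sm_diff)
    then show ?thesis using Y(3)[OF y(1) u] comm y(2) by auto
  qed
  have hull: "x \<in> M" if M: "qsub M" "?Y \<subseteq> M" for M
  proof (rule Y(4)[OF M(1)], rule subsetI)
    fix y assume "y \<in> Y"
    then have 1: "f0 y \<in> M" "f1 y \<in> M" "f2 y \<in> M" using M(2) by auto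
    have "sm (f2 y) (- qJ) = J (J y) - sm (J y) qI"
      unfolding f2_def sm_sm by (simp add: qunit_mult)
    then have "J (J y) - sm (J y) qI \<in> M" using qsub_sm[OF M(1) 1(3)] by metis
    then have "f0 y - (1/2) \<cdot> (f1 y + (J (J y) - sm (J y) qI)) \<in> M"
      by (rule qsub_diff[OF M(1) 1(1) qsub_sc[OF M(1) qsub_add[OF M(1) 1(2)]]])
    also have "f1 y + (J (J y) - sm (J y) qI) = J (J y) + J (J y)" by (simp add: f1_def)
    finally show "y \<in> M" unfolding half_sc by (simp add: f0_def)
  qed
  have "eig V J z" if "z \<in> ?Y" for z
    unfolding eig_def using ev[OF that] that J0 J1 J2 by blast
  then show ?thesis using fin sub hull by (intro exI[of _ ?Y]) blast
qed

lemma eig_decomp_set: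
  assumes "finite V" "commuting_family V J" "qsub L" "\<forall>u\<in>V. u ` L \<subseteq> L"
    "J ` L \<subseteq> L" "finite X" "X \<subseteq> L"
  shows "\<exists>Y. finite Y \<and> Y \<subseteq> L \<and> (\<forall>y\<in>Y. eig V J y) \<and> (\<forall>M. qsub M \<longrightarrow> Y \<subseteq> M \<longrightarrow> X \<subseteq> M)"
  using assms(6,7)
proof (induction X rule: finite_induct)
  case (insert x X)
  then obtain Y where Y: "finite Y" "Y \<subseteq> L" "\<forall>y\<in>Y. eig V J y" "\<forall>M. qsub M \<longrightarrow> Y \<subseteq> M \<longrightarrow> X \<subseteq> M"
    by auto
  have "x \<in> L" using insert by simp
  then obtain Y' where Y': "finite Y'" "Y' \<subseteq> L" "\<forall>y\<in>Y'. eig V J y" "\<forall>M. qsub M \<longrightarrow> Y' \<subseteq> M \<longrightarrow> x \<in> M"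
    using eig_decomp[of V J L x, OF assms(1-5)] by blast
  show ?case using Y Y' by (intro exI[of _ "Y \<union> Y'"]) auto
qed (auto intro: exI[of _ "{}"])

definition invset :: "('h \<Rightarrow> 'h) set \<Rightarrow> ('h \<Rightarrow> 'h) \<Rightarrow> 'h set \<Rightarrow> bool" where
  "invset V J B \<longleftrightarrow> finite B \<and> orthoset B \<and> (\<forall>f\<in>insert J V. \<forall>b\<in>B. fproj B (f b) = f b)"

lemma invset_cmt:
  assumes "commuting_family V J" "invset V J B" "f \<in> insert J V"
  shows "f (fproj B x) = fproj B (f x)"
  using assms
  by (intro fproj_cmt[symmetric] commuting_family_adjpm commuting_family_homog) (auto simp: invset_def)

lemma fproj_mono:
  assumes "finite B" "orthoset B" "finite B'" "orthoset B'" "B \<subseteq> B'" "fproj B z = z"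
  shows "fproj B' z = z"
proof -
  have "qsub {z. fproj B' z = z}" using qsub_fix_fproj[OF assms(3,4) bop_id] by (simp add: homog_def)
  moreover have "B \<subseteq> {z. fproj B' z = z}" using assms fproj_fix by auto
  ultimately have "fproj B z \<in> {z. fproj B' z = z}" by (rule fproj_in)
  then show ?thesis using assms(6) by simp
qed

text \<open>The projection onto an invariant span is right linear and commutes with the family, so
  subtracting from an eigenvector its projection leaves a vector with the same eigenvalues. The last
  clause confines B' to the span of B and Y.\<close>

lemma gram_schmidt:
  assumes "finite Y" "commuting_family V J" "invset V J B" "\<And>y. y \<in> Y \<Longrightarrow> eig V J y"
  shows "\<exists>B'. invset V J B' \<and> B \<subseteq> B' \<and> (\<forall>b\<in>B' - B. eig V J b) \<and> (\<forall>y\<in>Y. fproj B' y = y) \<and>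
    (\<forall>M. qsub M \<longrightarrow> B \<subseteq> M \<longrightarrow> Y \<subseteq> M \<longrightarrow> B' \<subseteq> M)"
  using assms(1,4)
proof (induction Y rule: finite_induct)
  case empty
  show ?case using assms(3) by (intro exI[of _ B]) auto
next
  case (insert y Y)
  then obtain B' where B': "invset V J B'" "B \<subseteq> B'" "\<forall>b\<in>B' - B. eig V J b" "\<forall>y\<in>Y. fproj B' y = y"
    "\<And>M. qsub M \<Longrightarrow> B \<subseteq> M \<Longrightarrow> Y \<subseteq> M \<Longrightarrow> B' \<subseteq> M" by auto
  have fo: "finite B'" "orthoset B'" using B'(1) by (auto simp: invset_def)
  show ?case
  proof (cases "fproj B' y = y")
    case True
    then show ?thesis using B' by (intro exI[of _ B']) auto
  next
    case False
    define z where "z = y - fproj B' y"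
    define r where "r = 1 / nrm z"
    \<comment> \<open>The factor is real: scaling by a quaternion would conjugate the eigenvalue
      i.\<close>
    define b where "b = r \<cdot> z"
    have zpos: "nrm z > 0" using False by (metis nrm_eq_0 nrm_nonneg order_le_less z_def eq_iff_diff_eq_0)
    have az: "ip a z = 0" if "a \<in> B'" for a
      using that by (simp add: z_def ip_diff ip_fproj[OF fo])
    have ab: "ip a b = 0" if "a \<in> B'" for a
      using az[OF that] by (simp add: b_def rsc_def ip_sm)
    then have ba: "ip b a = 0" if "a \<in> B'" for a using that by (metis ip_cnj qcnj_simps(4))
    have "nrm b = 1" using zpos by (simp add: b_def r_def nrm_sc del: nrm_eq_0)
    then have "b \<star> b = 1" by (simp flip: nrm_sq)
    then have bb: "ip b b = 1" by (simp add: ip_self one_quat_def)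
    have bnot: "b \<notin> B'" using ab bb by force
    let ?B = "insert b B'"
    have fo': "finite ?B" "orthoset ?B"
      using fo ab ba bb bnot by (auto simp: orthoset_def)
    have fz: "f z = f y - fproj B' (f y)" if "f \<in> insert J V" for f
    proof -
      have "bop f" using commuting_family_bop[OF assms(2) that] .
      then show ?thesis
        using invset_cmt[OF assms(2) B'(1) that] by (simp add: z_def bopD)
    qed
    note P = bopD[OF bop_fproj[OF fo]] homogD[OF homog_fproj]
    have eigz: "eig V J z"
    proof -
      have e: "eig V J y" using insert by simp
      have zy: "y - fproj B' y = z" by (simp add: z_def)
      have "u z = z \<or> u z = - z" if "u \<in> V" for u
      proof -
        have "u y = y \<or> u y = - y" using e that by (simp add: eig_def)
        then show ?thesis using fz[of u] that zy by (auto simp: P)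
      qed
      moreover have "J z = 0 \<or> J z = sm z qI"
      proof -
        have "J y = 0 \<or> J y = sm y qI" using e by (simp add: eig_def)
        then show ?thesis using fz[of J] by (auto simp: P zy simp flip: sm_diff)
      qed
      ultimately show ?thesis by (simp add: eig_def)
    qed
    have eigb: "eig V J b"
    proof -
      have fb: "f b = r \<cdot> f z" if "f \<in> insert J V" for f
      proof -
        have "bop f" using commuting_family_bop[OF assms(2) that] .
        then show ?thesis by (simp add: b_def bopD)
      qed
      have "u b = b \<or> u b = - b" if "u \<in> V" for u
      proof -
        have "u z = z \<or> u z = - z" using eigz that by (simp add: eig_def)
        then show ?thesis using fb[of u] that by (auto simp: b_def)
      qed
      moreover have "J b = 0 \<or> J b = sm b qI"
      proof -
        have "J z = 0 \<or> J z = sm z qI" using eigz by (simp add: eig_def)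
        then show ?thesis using fb[of J] by (auto simp: b_def sm_sc)
      qed
      ultimately show ?thesis by (simp add: eig_def)
    qed
    have inB: "fproj ?B w = w" if "fproj B' w = w" for w
      using fproj_mono[OF fo fo' _ that] by auto
    have fb: "fproj ?B b = b" using fproj_fix[OF fo'] by simp
    note P' = bopD[OF bop_fproj[OF fo']] homogD[OF homog_fproj]
    have "fproj ?B (f a) = f a" if "f \<in> insert J V" "a \<in> ?B" for f a
    proof (cases "a = b")
      case True
      then show ?thesis using eigb that(1) fb by (auto simp: eig_def P')
    next
      case False
      then have "fproj B' (f a) = f a" using that B'(1) unfolding invset_def by blast
      then show ?thesis by (rule inB)
    qed
    then have "invset V J ?B" using fo' by (simp add: invset_def)
    moreover have "fproj ?B y = y"
    proof -
      have "z = nrm z \<cdot> b" using zpos by (simp add: b_def r_def)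
      then have "fproj ?B z = z" by (metis P'(2) fb)
      moreover have "fproj ?B (fproj B' y) = fproj B' y"
        using inB fproj_idem[OF fo] by blast
      moreover have "y = z + fproj B' y" by (simp add: z_def)
      ultimately show ?thesis by (metis P'(1))
    qed
    moreover have "?B \<subseteq> M" if M: "qsub M" "B \<subseteq> M" "insert y Y \<subseteq> M" for M
    proof -
      have "B' \<subseteq> M" using B'(5)[OF M(1,2)] M(3) by simp
      then have "b \<in> M" unfolding b_def z_def
        using M by (intro qsub_sc qsub_diff fproj_in) auto
      then show ?thesis using \<open>B' \<subseteq> M\<close> by simp
    qed
    ultimately show ?thesis
      using B' inB eigb by (intro exI[of _ ?B]) auto
  qed
qed

text \<open>The new vectors are eigenvectors of the coarse family \<open>V\<close>, under which the span of \<open>B\<close> is invariant,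
  although they come from eigenvectors of the fine family \<open>V'\<close>, for which it need not be.\<close>

lemma refinement_step:
  assumes "finite V'" "commuting_family V' J" "V \<subseteq> V'" "invset V J B" "qsub L"
    "\<forall>u\<in>V'. u ` L \<subseteq> L" "J ` L \<subseteq> L" "B \<subseteq> L" "x \<in> L"
  shows "\<exists>B'. invset V' J B' \<and> B \<subseteq> B' \<and> B' \<subseteq> L \<and> (\<forall>b\<in>B' - B. eig V J b) \<and> fproj B' x = x"
proof -
  \<comment> \<open>B is decomposed along with x, so B' and Y have the same span. Being spanned by
    eigenvectors of the fine family, it is invariant under that family.\<close>
  have "finite (insert x B)" "insert x B \<subseteq> L" using assms by (auto simp: invset_def)
  then obtain Y where Y: "finite Y" "Y \<subseteq> L" "\<And>y. y \<in> Y \<Longrightarrow> eig V' J y"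
    "\<And>M. qsub M \<Longrightarrow> Y \<subseteq> M \<Longrightarrow> insert x B \<subseteq> M"
    using eig_decomp_set[of V' J L "insert x B", OF assms(1,2,5-7)] by blast
  have "\<exists>B'. invset V J B' \<and> B \<subseteq> B' \<and> (\<forall>b\<in>B' - B. eig V J b) \<and> (\<forall>y\<in>Y. fproj B' y = y) \<and>
    (\<forall>M. qsub M \<longrightarrow> B \<subseteq> M \<longrightarrow> Y \<subseteq> M \<longrightarrow> B' \<subseteq> M)"
    using gram_schmidt[OF Y(1) commuting_family_subset[OF assms(2,3)] assms(4)] eig_subset[OF Y(3) assms(3)]
    by simp
  then obtain B' where B': "invset V J B'" "B \<subseteq> B'" "\<forall>b\<in>B' - B. eig V J b" "\<And>y. y \<in> Y \<Longrightarrow> fproj B' y = y"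
    "\<And>M. qsub M \<Longrightarrow> B \<subseteq> M \<Longrightarrow> Y \<subseteq> M \<Longrightarrow> B' \<subseteq> M"
    by auto
  have fo: "finite B'" "orthoset B'" using B'(1) by (auto simp: invset_def)
  note P = bopD[OF bop_fproj[OF fo]] homogD[OF homog_fproj]
  have "fproj B' (f b) = f b" if f: "f \<in> insert J V'" and b: "b \<in> B'" for f b
  proof -
    let ?M = "{z. fproj B' (f z) = f z}"
    have M: "qsub ?M" using commuting_family_bop[OF assms(2) f] commuting_family_homog[OF assms(2) f]
      by (intro qsub_fix_fproj fo)
    have YM: "Y \<subseteq> ?M"
    proof
      fix y assume y: "y \<in> Y"
      have "f y = y \<or> f y = - y \<or> f y = 0 \<or> f y = sm y qI"
        using Y(3)[OF y] f unfolding eig_def by blast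
      then show "y \<in> ?M" using B'(4)[OF y] by (elim disjE) (simp_all add: P)
    qed
    then have "B \<subseteq> ?M" using Y(4)[OF M] by simp
    then show ?thesis using B'(5)[OF M _ YM] b by auto
  qed
  moreover have "fproj B' x = x"
  proof -
    let ?M = "{z. fproj B' z = z}"
    have M: "qsub ?M" using qsub_fix_fproj[OF fo bop_id] by (simp add: homog_def)
    have "Y \<subseteq> ?M" using B'(4) by blast
    then show ?thesis using Y(4)[OF M] by blast
  qed
  moreover have "B' \<subseteq> L" using B'(5)[OF assms(5,8) Y(2)] .
  ultimately show ?thesis using B'(2,3) fo unfolding invset_def by blast
qed

end

section \<open>Diagonalisation of normal operators\<close>

locale quat_normal = quat_hilbert_space sm ip
  for sm :: "'h::ab_group_add \<Rightarrow> quat \<Rightarrow> 'h" and ip :: "'h \<Rightarrow> 'h \<Rightarrow> quat" +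
  fixes D :: "'h set" and T :: "'h \<Rightarrow> 'h"
  assumes dense_D: "densely_defined ip D" and closed_T: "closed_op ip D T"
    and right_linear_T: "right_linear_op sm D T" and normal_T: "normal_op ip D T"
begin

section \<open>The adjoint expressed through the real inner product\<close>

lemma qsub_D: "qsub D"
  using right_linear_T by (simp add: right_linear_op_def right_subspace_def qsub_def)

lemma T_plus: "x \<in> D \<Longrightarrow> y \<in> D \<Longrightarrow> T (x + y) = T x + T y"
  and T_sm: "x \<in> D \<Longrightarrow> T (sm x q) = sm (T x) q"
  using right_linear_T by (auto simp: right_linear_op_def)

lemma T_zero: "T 0 = 0"
  using T_plus[OF qsub_zero[OF qsub_D] qsub_zero[OF qsub_D]] by simp

lemma T_rsc: "x \<in> D \<Longrightarrow> T (r \<cdot> x) = r \<cdot> T x"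
  by (simp add: rsc_def T_sm)

lemma orthogonal_D: assumes "\<And>y. y \<in> D \<Longrightarrow> x \<star> y = 0" shows "x = 0"
proof -
  have "nrm x < e" if "e > 0" for e
  proof -
    obtain y where y: "y \<in> D" "nrm (x - y) < e"
      using dense_D \<open>e > 0\<close> unfolding densely_defined_def hnorm_eq by blast
    have "(nrm x)\<^sup>2 = x \<star> (x - y)" using assms[OF y(1)] by (simp add: nrm_sq inn_simps)
    also have "\<dots> \<le> nrm x * nrm (x - y)" by (rule inn_le_nrm)
    finally have "nrm x \<le> nrm (x - y)"
      by (metis mult_le_cancel_left_pos nrm_nonneg order_le_less power2_eq_square)
    then show ?thesis using y by simp
  qed
  then have "nrm x \<le> 0" by (meson linorder_not_less order_less_irrefl)
  then show ?thesis by (metis nrm_eq_0 nrm_nonneg order_antisym)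
qed

lemma ip_from_rin:
  assumes "\<forall>x\<in>D. y \<star> T x = z \<star> x" "x \<in> D"
  shows "ip y (T x) = ip z x"
  using assms qsub_sm[OF qsub_D assms(2)] by (intro ip_eqI) (simp flip: T_sm)

lemma adj_eqI:
  assumes "\<forall>x\<in>D. y \<star> T x = z \<star> x"
  shows "y \<in> adj_dom ip D T" "adj ip D T y = z"
proof -
  have ipz: "ip y (T x) = ip z x" if "x \<in> D" for x using ip_from_rin[OF assms that] .
  show "adj ip D T y = z"
    unfolding adj_def
  proof (rule the_equality)
    fix z' assume z': "\<forall>x\<in>D. ip y (T x) = ip z' x"
    have "(z' - z) \<star> x = 0" if "x \<in> D" for x
      using z' ipz[OF that] that by (simp add: rin_def ip_diff)
    then show "z' = z" using orthogonal_D by (metis eq_iff_diff_eq_0)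
  qed (simp add: ipz)
  show "y \<in> adj_dom ip D T"
    unfolding adj_dom_def hnorm_eq
  proof (intro CollectI ballI allI impI)
    fix x and e :: real assume x: "x \<in> D" and e: "0 < e"
    have "qabs (ip y (T x') - ip y (T x)) < e" if "x' \<in> D" "nrm (x' - x) < e / (nrm z + 1)" for x'
    proof -
      have "qabs (ip y (T x') - ip y (T x)) = qabs (ip z (x' - x))"
        using ipz that x by (simp add: ip_diff)
      also have "\<dots> \<le> nrm z * nrm (x' - x)" by (rule qabs_ip_le)
      also have "\<dots> \<le> (nrm z + 1) * nrm (x' - x)" by (intro mult_right_mono) auto
      also have "\<dots> < e" using that(2) by (simp add: pos_less_divide_eq add_nonneg_pos mult.commute)
      finally show ?thesis .
    qed
    moreover have "0 < e / (nrm z + 1)" using e by (simp add: add_nonneg_pos)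
    ultimately show "\<exists>d>0. \<forall>x'\<in>D. nrm (x' - x) < d \<longrightarrow> qabs (ip y (T x') - ip y (T x)) < e"
      by blast
  qed
qed

text \<open>Continuity at 0 with tolerance 1 gives a radius d; rescaling x to norm d / 2 turns it
  into a linear bound.\<close>

lemma adj_dom_bound:
  assumes "y \<in> adj_dom ip D T"
  shows "\<exists>K. \<forall>x\<in>D. \<bar>y \<star> T x\<bar> \<le> K * nrm x"
proof -
  obtain d where d: "d > 0" "\<And>x. x \<in> D \<Longrightarrow> nrm x < d \<Longrightarrow> qabs (ip y (T x)) < 1"
  proof -
    have "\<exists>d>0. \<forall>x'\<in>D. nrm (x' - 0) < d \<longrightarrow> qabs (ip y (T x') - ip y (T 0)) < 1"
      using assms qsub_zero[OF qsub_D] unfolding adj_dom_def hnorm_eq mem_Collect_eq by (meson zero_less_one)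
    then show thesis using that by (auto simp: T_zero)
  qed
  have "\<bar>y \<star> T x\<bar> \<le> (2 / d) * nrm x" if x: "x \<in> D" for x
  proof (cases "x = 0")
    case False
    then have n: "nrm x > 0" by (metis nrm_eq_0 nrm_nonneg order_le_less)
    define r where "r = d / (2 * nrm x)"
    have r: "r > 0" "r * nrm x = d / 2" using n d(1) by (simp_all add: r_def del: nrm_eq_0)
    have "nrm (r \<cdot> x) < d" using r d(1) by (simp add: nrm_sc)
    then have "qabs (ip y (T (r \<cdot> x))) < 1" using d(2) qsub_sc[OF qsub_D x] by blast
    then have "\<bar>y \<star> T (r \<cdot> x)\<bar> < 1" using abs_qre_le[of "ip y (T (r \<cdot> x))"] by (simp add: rin_def)
    then have "r * \<bar>y \<star> T x\<bar> < 1" using r by (simp add: T_rsc x inn_simps abs_mult)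
    then have "\<bar>y \<star> T x\<bar> < 1 / r" using r by (simp add: field_simps)
    also have "1 / r = (2 / d) * nrm x" by (simp add: r_def)
    finally show ?thesis by simp
  qed (simp add: T_zero)
  then show ?thesis by blast
qed

text \<open>D need not be closed: the functional is represented by a Cauchy sequence in D, whose
  limit is taken in the whole space.\<close>

lemma adj_eqD:
  assumes "y \<in> adj_dom ip D T"
  shows "\<forall>x\<in>D. y \<star> T x = adj ip D T y \<star> x"
proof -
  obtain K where K: "\<And>x. x \<in> D \<Longrightarrow> \<bar>y \<star> T x\<bar> \<le> K * nrm x" using adj_dom_bound[OF assms] by blast
  have "\<exists>X. (\<forall>n. X n \<in> D) \<and>
    (\<forall>e>0. \<exists>N. \<forall>m\<ge>N. \<forall>n\<ge>N. (X m - X n) \<star> (X m - X n) < e) \<and>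
    (\<forall>x\<in>D. (\<lambda>n. X n \<star> x) \<longlonglongrightarrow> y \<star> T x)"
    using qsub_zero[OF qsub_D] qsub_add[OF qsub_D] qsub_sc[OF qsub_D] K
    by (intro riesz_sequence[where C = K])
      (auto simp: inn_simps inn_nonneg nrm_def T_plus T_rsc intro: inn_commute)
  then obtain X where X: "\<And>e. e > 0 \<Longrightarrow> \<exists>N. \<forall>m\<ge>N. \<forall>n\<ge>N. (X m - X n) \<star> (X m - X n) < e"
    "\<And>x. x \<in> D \<Longrightarrow> (\<lambda>n. X n \<star> x) \<longlonglongrightarrow> y \<star> T x" by blast
  have "\<exists>l. conv X l"
  proof (rule cauchy_conv)
    fix e :: real assume "0 < e"
    then obtain N where "\<forall>m\<ge>N. \<forall>n\<ge>N. (X m - X n) \<star> (X m - X n) < e\<^sup>2"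
      using X(1)[of "e\<^sup>2"] by auto
    then have "\<forall>m\<ge>N. \<forall>n\<ge>N. nrm (X m - X n) < e"
      using \<open>0 < e\<close> by (simp add: nrm_def real_less_lsqrt)
    then show "\<exists>N. \<forall>m\<ge>N. \<forall>n\<ge>N. nrm (X m - X n) < e" by blast
  qed
  then obtain l where l: "conv X l" by blast
  have "\<forall>x\<in>D. y \<star> T x = l \<star> x"
    using X(2) conv_inn[OF l] LIMSEQ_unique by blast
  then show ?thesis using adj_eqI(2) by auto
qed

lemma real_normal: "real_normal rsc rin D T"
proof unfold_locales
  show "0 \<in> D" "\<And>x y. x \<in> D \<Longrightarrow> y \<in> D \<Longrightarrow> x + y \<in> D" "\<And>x r. x \<in> D \<Longrightarrow> r \<cdot> x \<in> D"
    using qsub_D by (auto intro: qsub_zero qsub_add qsub_sc)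
  show "T (x + y) = T x + T y" if "x \<in> D" "y \<in> D" for x y using that by (rule T_plus)
  show "T (r \<cdot> x) = r \<cdot> T x" if "x \<in> D" for x r using that by (rule T_rsc)
  show "x \<in> D \<and> T x = y" if "\<And>n. X n \<in> D" "conv X x" "conv (\<lambda>n. T (X n)) y" for X x y
    using closed_T that unfolding closed_op_def hconv_eq by blast
  show "x = 0" if "\<And>y. y \<in> D \<Longrightarrow> x \<star> y = 0" for x using that by (rule orthogonal_D)
  have dom: "{y \<in> adj_dom ip D T. adj ip D T y \<in> D} = {x \<in> D. T x \<in> adj_dom ip D T}"
    and val: "\<And>x. x \<in> D \<Longrightarrow> T x \<in> adj_dom ip D T \<Longrightarrow> T (adj ip D T x) = adj ip D T (T x)"
    using normal_T unfolding normal_op_def by auto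
  show "\<exists>z\<in>D. (\<forall>v\<in>D. x \<star> T v = z \<star> v) \<and> T z = w" if "x \<in> D" "\<forall>v\<in>D. T x \<star> T v = w \<star> v" for x w
  proof -
    note Tx = adj_eqI[OF that(2)]
    then have "x \<in> adj_dom ip D T" "adj ip D T x \<in> D" using dom that(1) by auto
    then show ?thesis using adj_eqD val[OF that(1)] Tx by blast
  qed
  show "y \<in> D \<and> (\<forall>v\<in>D. T y \<star> T v = T z \<star> v)" if "\<forall>v\<in>D. y \<star> T v = z \<star> v" "z \<in> D" for y z
  proof -
    note y = adj_eqI[OF that(1)]
    then have "y \<in> D" "T y \<in> adj_dom ip D T" using dom that(2) by auto
    then show ?thesis using adj_eqD[of "T y"] val y(2) by metis
  qed
qed

sublocale real_normal rsc rin D T "\<lambda>y z. \<forall>x\<in>D. y \<star> T x = z \<star> x"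
  by (rule real_normal, rule reflexive)

section \<open>Cartesian and polar decomposition of the bounded transform\<close>

lemma homog_S: "homog S" and homog_Z: "homog Z" and homog_Z': "homog Z'"
proof -
  have D: "sm x q \<in> D" "T (sm x q) = sm (T x) q" if "x \<in> D" for x q
    using that qsub_sm[OF qsub_D] T_sm by auto
  note u = adjpm_sm[of qI] adjpm_sm[of qJ]
  show "homog S"
    using u D commuting_S[of "\<lambda>x. sm x qI"] commuting_S[of "\<lambda>x. sm x qJ"]
    by (intro homogI selfadj_bop selfadj_S) (simp_all add: qcnj_simps)
  show "homog Z"
    using u D commuting_Z[of "\<lambda>x. sm x qI"] commuting_Z[of "\<lambda>x. sm x qJ"]
    by (intro homogI Z_bop) (simp_all add: qcnj_simps)
  show "homog Z'"
    using u D commuting_Z'[of "\<lambda>x. sm x qI"] commuting_Z'[of "\<lambda>x. sm x qJ"]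
    by (intro homogI Z'_bop) (simp_all add: qcnj_simps)
qed

text \<open>\<open>Z = A + C\<close> with \<open>A\<close> selfadjoint and \<open>C\<close> antiselfadjoint. The real-linear operator \<open>W\<close> is
  selfadjoint, and its sign provides the imaginary unit \<open>J\<close> in the polar decomposition \<open>C = J \<bar>W\<bar>\<close>.\<close>

definition opA :: "'h \<Rightarrow> 'h" where "opA x = (1/2) \<cdot> (Z x + Z' x)"
definition opC :: "'h \<Rightarrow> 'h" where "opC x = (1/2) \<cdot> (Z x - Z' x)"
definition opW :: "'h \<Rightarrow> 'h" where "opW x = sm (opC x) qI"
text \<open>This is minus the sign of W; the minus compensates C x = - (W x) i.\<close>

definition opP :: "'h \<Rightarrow> 'h" where "opP x = nonpos_proj opW x - nonneg_proj opW x"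
text \<open>\<open>J\<close> vanishes on the kernel of \<open>W\<close>, so only \<open>J\<^sup>3 = - J\<close> holds in general.\<close>

definition opJ :: "'h \<Rightarrow> 'h" where "opJ x = sm (opP x) qI"

lemma Z_decomp: "Z x = opA x + opC x"
proof -
  have "(1/2) \<cdot> (Z x + Z' x) + (1/2) \<cdot> (Z x - Z' x) = (1/2) \<cdot> (Z x + Z x)"
    by (simp flip: scale_right_distrib)
  then show ?thesis unfolding half_sc by (simp add: opA_def opC_def)
qed

lemma selfadj_opA: "selfadj opA"
  unfolding selfadj_def opA_def
  by (simp add: bop_sc bop_add Z_bop Z'_bop inn_simps Z_adj Z'_adj add.commute del: scale_right_distrib)

lemma bop_opC: "bop opC"
  unfolding opC_def by (intro bop_sc bop_diff Z_bop Z'_bop)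

lemma opC_anti: "opC x \<star> y = - (x \<star> opC y)"
  by (simp add: opC_def inn_simps Z_adj Z'_adj algebra_simps)

lemma adjpm_opC: "adjpm opC"
  unfolding adjpm_def using bop_opC opC_anti by (auto intro!: exI[of _ "- 1"])

lemma contr_opA: "contr opA" and contr_opC: "contr opC"
proof -
  have "nrm ((1/2) \<cdot> (Z x + Z' x)) \<le> nrm x" "nrm ((1/2) \<cdot> (Z x - Z' x)) \<le> nrm x" for x
    using nrm_triangle[of "Z x" "Z' x"] nrm_triangle_diff[of "Z x" "Z' x"] Z_contr[of x] Z'_contr[of x]
    unfolding nrm_sc by simp_all
  then show "contr opA" "contr opC" by (simp_all add: contr_def opA_def opC_def)
qed

lemma homog_opA: "homog opA" and homog_opC: "homog opC"
  unfolding opA_def opC_def by (intro homog_sc homog_add homog_diff homog_Z homog_Z')+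

text \<open>C and right multiplication by i are both antiselfadjoint, and they commute because C is
  right linear.\<close>

lemma selfadj_opW: "selfadj opW"
  unfolding selfadj_def opW_def
  using bop_comp[OF bop_sm bop_opC] homogD[OF homog_opC]
  by (simp add: sm_adj opC_anti qcnj_simps sm_minus inn_simps)

lemma qabs_qI: "qabs qI = 1"
  by (simp add: qabs_def)

lemma contr_opW: "contr opW"
  using contr_opC by (simp add: contr_def opW_def nrm_sm qabs_qI)

lemma contr_S: "contr S"
  by (simp add: contr_def S_contr)

lemma opC_eq: "opC x = - sm (opW x) qI"
  by (simp add: opW_def sm_sm qunit_mult sm_minus)

lemma cmt_base: "cmt opA S" "cmt opA opC" "cmt S opC" "cmt opA opW" "cmt S opW" "cmt opC opW"
proof -
  note l = bopD[OF Z_bop] bopD[OF Z'_bop] bopD[OF selfadj_bop[OF selfadj_S]]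
  show 1: "cmt opA S" "cmt S opC"
    by (simp_all add: cmt_def opA_def opC_def l S_Z S_Z' del: scale_right_distrib)
  show 2: "cmt opA opC"
    by (simp add: cmt_def opA_def opC_def l Z_Z' algebra_simps)
  show "cmt opA opW" "cmt S opW" "cmt opC opW"
    using 1 2 by (simp_all add: cmt_def opW_def flip: homogD[OF homog_opA] homogD[OF homog_S] homogD[OF homog_opC])
qed

lemma cmt_sym: "cmt f g \<Longrightarrow> cmt g f"
  by (simp add: cmt_def)

text \<open>Right linear functions of A, S or W. Right linearity is demanded separately because W
  itself anticommutes with right multiplication by j.\<close>

definition good :: "('h \<Rightarrow> 'h) \<Rightarrow> bool" where
  "good f \<longleftrightarrow> selfadj f \<and> homog f \<and> (bicom opA f \<or> bicom S f \<or> bicom opW f)"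

text \<open>The second operator need not be right linear, so that \<open>opP\<close> is
  covered.\<close>

lemma good_cross: "good f \<Longrightarrow> bicom opA g \<or> bicom S g \<or> bicom opW g \<Longrightarrow> f (g x) = g (f x)"
  unfolding good_def
  using bicom_cross[of opA opA f g x] bicom_cross[of opA S f g x] bicom_cross[of opA opW f g x]
    bicom_cross[of S opA f g x] bicom_cross[of S S f g x] bicom_cross[of S opW f g x]
    bicom_cross[of opW opA f g x] bicom_cross[of opW S f g x] bicom_cross[of opW opW f g x]
    selfadj_opA selfadj_S selfadj_opW cmt_base[THEN cmt_sym] cmt_base bicom_self
  by (auto simp: cmt_def)

lemma good_commute: "good f \<Longrightarrow> good g \<Longrightarrow> f (g x) = g (f x)"
  by (rule good_cross) (auto simp: good_def)

lemma good_S: "good S"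
  by (simp add: good_def selfadj_S homog_S bicom_self)

lemma good_Z: assumes "good f" shows "f (Z x) = Z (f x)"
proof -
  have "f (opC x) = opC (f x)" for x
    using assms bicomD[OF _ adjpm_opC, of _ f x] cmt_base[THEN cmt_sym] cmt_base(6)
    unfolding good_def by (metis (no_types))
  moreover have "f (opA x) = opA (f x)" for x by (rule good_cross[OF assms]) (simp add: bicom_self)
  ultimately show ?thesis
    using assms by (simp add: Z_decomp good_def bopD[OF selfadj_bop])
qed

lemmas nonpos_opW = selfadj_nonpos_proj[OF selfadj_opW contr_opW] bicom_nonpos_proj[OF selfadj_opW contr_opW]
lemmas nonneg_opW = selfadj_nonneg_proj[OF selfadj_opW contr_opW] bicom_nonneg_proj[OF selfadj_opW contr_opW]

lemma selfadj_opP: "selfadj opP" and bicom_opP: "bicom opW opP"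
  unfolding opP_def by (intro selfadj_diff bicom_diff nonpos_opW nonneg_opW)+

lemma opW_sm: "opW (sm x qI) = sm (opW x) qI" "opW (sm x qJ) = - sm (opW x) qJ"
  by (simp_all add: opW_def homogD[OF homog_opC] sm_sm qunit_mult sm_minus)

text \<open>Right multiplication by j anticommutes with W and so swaps the two projections, which
  reverses the sign of their difference.\<close>

lemma opP_sm: "opP (sm x qI) = sm (opP x) qI" "opP (sm x qJ) = - sm (opP x) qJ"
proof -
  have "cmt (\<lambda>x. sm x qI) opW" by (simp add: cmt_def opW_sm)
  from bicomD[OF bicom_opP adjpm_sm[of qI, OF qcnj_simps(8)] this, of x]
  show "opP (sm x qI) = sm (opP x) qI" by simp
  have a: "sm (opW x) qJ = - opW (sm x qJ)" for x by (simp add: opW_sm)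
  note p = anticommuting_proj[OF selfadj_opW contr_opW adjpm_sm[of qJ, OF qcnj_simps(9)] a]
  show "opP (sm x qJ) = - sm (opP x) qJ"
    by (simp add: opP_def sm_diff p)
qed

text \<open>The modulus depends on W only through W^2, so it commutes with right multiplication by j
  although W anticommutes with it.\<close>

lemma homog_absop: "homog (absop opW)"
proof (rule homogI)
  show "bop (absop opW)" by (rule selfadj_bop[OF selfadj_absop[OF selfadj_opW contr_opW]])
  have "cmt (\<lambda>x. sm x qI) opW" by (simp add: cmt_def opW_sm)
  from bicomD[OF bicom_absop[OF selfadj_opW contr_opW] adjpm_sm[of qI, OF qcnj_simps(8)] this]
  show "absop opW (sm x qI) = sm (absop opW x) qI" for x by simp
  have a: "sm (opW x) qJ = - opW (sm x qJ)" for x by (simp add: opW_sm)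
  from anticommuting_proj(3)[OF selfadj_opW contr_opW adjpm_sm[of qJ, OF qcnj_simps(9)] a]
  show "absop opW (sm x qJ) = sm (absop opW x) qJ" for x by simp
qed

lemma bop_opJ: "bop opJ"
  unfolding opJ_def by (rule bop_comp[OF bop_sm selfadj_bop[OF selfadj_opP]])

text \<open>\<open>opP\<close> and right multiplication by i both anticommute with right
  multiplication by j, so their product commutes with it.\<close>

lemma homog_opJ: "homog opJ"
  by (rule homogI[OF bop_opJ]) (simp_all add: opJ_def opP_sm sm_sm sm_minus_left qunit_mult sm_minus)

lemma opJ_anti: "opJ x \<star> y = - (x \<star> opJ y)"
  by (simp add: opJ_def sm_adj qcnj_simps sm_minus inn_simps selfadj_inn[OF selfadj_opP] opP_sm)

lemma adjpm_opJ: "adjpm opJ"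
  unfolding adjpm_def using bop_opJ opJ_anti by (auto intro!: exI[of _ "- 1"])

lemma opP_cube: "opP (opP (opP x)) = opP x"
proof -
  note l = bopD[OF selfadj_bop[OF nonpos_opW(1)]] bopD[OF selfadj_bop[OF nonneg_opW(1)]]
  have c: "nonpos_proj opW (nonneg_proj opW x) = nonneg_proj opW (nonpos_proj opW x)" for x
    by (rule bicom_cmt[OF nonpos_opW(2) nonneg_opW(2) selfadj_opW nonpos_opW(1)])
  show ?thesis
    by (simp add: opP_def l c nonpos_proj_idem[OF selfadj_opW contr_opW] nonneg_proj_idem[OF selfadj_opW contr_opW])
qed

lemma opJ_cube: "opJ (opJ (opJ x)) = - opJ x"
  by (simp add: opJ_def opP_sm opP_cube sm_sm qunit_mult sm_minus sm_minus_left bopD[OF selfadj_bop[OF selfadj_opP]])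

lemma opC_polar: "opC x = opJ (absop opW x)"
proof -
  have "opP (absop opW x) = - opW x"
    using absop_sign_decomp[OF selfadj_opW contr_opW, of x] by (simp add: opP_def)
  then show ?thesis by (simp add: opJ_def opC_eq sm_minus_left)
qed

text \<open>The factor 2 comes from a plain triangle inequality; it enters only the constant of
  \<open>block_estimate\<close>.\<close>

lemma nrm_opJ: "nrm (opJ x) \<le> 2 * nrm x"
proof -
  have "nrm (opJ x) = nrm (opP x)" by (simp add: opJ_def nrm_sm qabs_qI)
  also have "\<dots> \<le> nrm (nonpos_proj opW x) + nrm (nonneg_proj opW x)"
    unfolding opP_def by (rule nrm_triangle_diff)
  also have "\<dots> \<le> nrm x + nrm x"
    unfolding nonpos_proj_def nonneg_proj_def
    by (intro add_mono proj_contr clsub_nonpos clsub_nonneg selfadj_opW contr_opW)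
  finally show ?thesis by simp
qed

lemma good_opJ: assumes "good f" shows "opJ (f x) = f (opJ x)"
proof -
  have "f (opP x) = opP (f x)" using good_cross[OF assms] bicom_opP by simp
  moreover have "homog f" using assms by (simp add: good_def)
  ultimately show ?thesis by (simp add: opJ_def homogD)
qed

subsection \<open>Truncated expansions\<close>

definition digits :: "('h \<Rightarrow> 'h) \<Rightarrow> nat \<Rightarrow> 'h \<Rightarrow> 'h" where
  "digits X = (SOME u. (\<forall>i. selfadj (u i) \<and> (\<forall>x. u i (u i x) = x) \<and> bicom X (u i)) \<and>
    (\<forall>k x. nrm (X x - (\<Sum>i<k. (1 / 2 ^ Suc i) \<cdot> u i x)) \<le> nrm x / 2 ^ k))"

definition trunc :: "('h \<Rightarrow> 'h) \<Rightarrow> nat \<Rightarrow> 'h \<Rightarrow> 'h" where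
  "trunc X k x = (\<Sum>i<k. (1 / 2 ^ Suc i) \<cdot> digits X i x)"

text \<open>The modulus stands in place of W because the digits have to be right linear.\<close>

abbreviation parts :: "('h \<Rightarrow> 'h) set" where
  "parts \<equiv> {opA, absop opW, S}"

definition bitset :: "nat \<Rightarrow> ('h \<Rightarrow> 'h) set" where
  "bitset k = (\<Union>X\<in>parts. digits X ` {..<k})"

lemma
  assumes "X \<in> parts"
  shows good_digits: "good (digits X i)" and digits_involution: "digits X i (digits X i x) = x"
    and trunc_bound: "nrm (X x - trunc X k x) \<le> nrm x / 2 ^ k"
proof -
  have X: "selfadj X" "contr X" "homog X"
    using assms selfadj_opA contr_opA homog_opA selfadj_absop[OF selfadj_opW contr_opW]
      contr_absop[OF selfadj_opW contr_opW] homog_absop selfadj_S contr_S homog_S by auto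
  have *: "\<forall>i. selfadj (digits X i) \<and> (\<forall>x. digits X i (digits X i x) = x) \<and> bicom X (digits X i)"
    and **: "\<forall>k x. nrm (X x - (\<Sum>i<k. (1 / 2 ^ Suc i) \<cdot> digits X i x)) \<le> nrm x / 2 ^ k"
    using someI_ex[OF binary_expansion[OF X(1,2)]] unfolding digits_def[symmetric] by auto
  show "digits X i (digits X i x) = x" using * by blast
  show "nrm (X x - trunc X k x) \<le> nrm x / 2 ^ k" using ** unfolding trunc_def by blast
  have b: "selfadj (digits X i)" "bicom X (digits X i)" using * by auto
  then have "homog (digits X i)" using homog_bicom X(3) selfadj_bop by blast
  then show "good (digits X i)"
    using b assms bicom_trans[OF bicom_absop[OF selfadj_opW contr_opW]] by (auto simp: good_def)
qed

lemma homog_trunc: "X \<in> parts \<Longrightarrow> homog (trunc X k)" and bop_trunc: "X \<in> parts \<Longrightarrow> bop (trunc X k)"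
proof -
  assume X: "X \<in> parts"
  have "homog (digits X i)" "bop (digits X i)" for i
    using good_digits[OF X, of i] by (auto simp: good_def selfadj_bop)
  then show "homog (trunc X k)" "bop (trunc X k)"
    unfolding trunc_def[abs_def] by (auto intro!: homog_sum homog_sc bop_sum bop_sc)
qed

lemma finite_bitset: "finite (bitset k)"
  by (simp add: bitset_def)

lemma bitset_mono: "k \<le> l \<Longrightarrow> bitset k \<subseteq> bitset l"
  unfolding bitset_def by (intro UN_mono image_mono) auto

lemma bitset_good: "u \<in> bitset k \<Longrightarrow> good u"
  using good_digits unfolding bitset_def by blast

lemma commuting_family_bitset: "commuting_family (bitset k) opJ"
proof -
  have "u (u x) = x" if "u \<in> bitset k" for u x
    using that digits_involution unfolding bitset_def by blast
  then show ?thesis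
    unfolding commuting_family_def
    using good_commute[OF bitset_good bitset_good] good_opJ[OF bitset_good] adjpm_opJ homog_opJ opJ_cube
      bitset_good good_def by blast
qed

lemma trunc_eig:
  assumes "X \<in> parts" "eig (bitset k) opJ b"
  shows "\<exists>a. trunc X k b = a \<cdot> b"
proof -
  have "\<exists>e. digits X i b = e \<cdot> b" if "i < k" for i
  proof -
    have "digits X i \<in> bitset k" using assms(1) that unfolding bitset_def by blast
    then have "digits X i b = b \<or> digits X i b = - b" using assms(2) by (simp add: eig_def)
    then have "digits X i b = 1 \<cdot> b \<or> digits X i b = (- 1) \<cdot> b" by simp
    then show ?thesis by blast
  qed
  then obtain e where "\<And>i. i < k \<Longrightarrow> digits X i b = e i \<cdot> b" by metis
  then have "trunc X k b = (\<Sum>i<k. (1 / 2 ^ Suc i * e i)) \<cdot> b"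
    unfolding trunc_def scale_sum_left by (intro sum.cong) auto
  then show ?thesis by blast
qed

text \<open>\<open>cut n\<close> plays the role of the spectral projection of \<open>S\<close> for \<open>[1 / (n + 1), 1]\<close>, and \<open>T\<close> is bounded
  on its range.\<close>

definition cut :: "nat \<Rightarrow> 'h \<Rightarrow> 'h" where
  "cut n = (SOME p. selfadj p \<and> (\<forall>x. p (p x) = p x) \<and> bicom S p \<and>
    (\<forall>x. p x = x \<longrightarrow> 1 / real (Suc n) * (x \<star> x) \<le> S x \<star> x) \<and>
    (\<forall>x. p x = 0 \<longrightarrow> S x \<star> x \<le> 1 / real (Suc n) * (x \<star> x)))"

lemma
  shows cut_idem: "cut n (cut n x) = cut n x" and good_cut: "good (cut n)"
    and cut_lower: "cut n x = x \<Longrightarrow> 1 / real (Suc n) * (x \<star> x) \<le> S x \<star> x"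
    and cut_upper: "cut n x = 0 \<Longrightarrow> S x \<star> x \<le> 1 / real (Suc n) * (x \<star> x)"
proof -
  have "\<exists>p. selfadj p \<and> (\<forall>x. p (p x) = p x) \<and> bicom S p \<and>
    (\<forall>x. p x = x \<longrightarrow> 1 / real (Suc n) * (x \<star> x) \<le> S x \<star> x) \<and>
    (\<forall>x. p x = 0 \<longrightarrow> S x \<star> x \<le> 1 / real (Suc n) * (x \<star> x))"
    by (rule spectral_cut[OF selfadj_S contr_S]) auto
  from someI_ex[OF this] have *: "selfadj (cut n) \<and> (\<forall>x. cut n (cut n x) = cut n x) \<and> bicom S (cut n) \<and>
    (\<forall>x. cut n x = x \<longrightarrow> 1 / real (Suc n) * (x \<star> x) \<le> S x \<star> x) \<and>
    (\<forall>x. cut n x = 0 \<longrightarrow> S x \<star> x \<le> 1 / real (Suc n) * (x \<star> x))"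
    unfolding cut_def[symmetric] .
  show "cut n (cut n x) = cut n x" "cut n x = x \<Longrightarrow> 1 / real (Suc n) * (x \<star> x) \<le> S x \<star> x"
    "cut n x = 0 \<Longrightarrow> S x \<star> x \<le> 1 / real (Suc n) * (x \<star> x)" using * by blast+
  show "good (cut n)"
    unfolding good_def using * homog_bicom[OF _ homog_S] selfadj_bop by blast
qed

lemma bop_cut: "bop (cut n)" and homog_cut: "homog (cut n)" and selfadj_cut: "selfadj (cut n)"
  using good_cut by (auto simp: good_def selfadj_bop)

text \<open>The cuts are chosen independently, so monotonicity needs an argument: z = x -
  \<open>cut m x\<close> lies in the range of \<open>cut n\<close> and the kernel of
  \<open>cut m\<close>, and the two bounds on S contradict each other unless z = 0.\<close>

lemma cut_mono:
  assumes "cut n x = x" "n \<le> m"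
  shows "cut m x = x"
proof (cases "n = m")
  case False
  then have nm: "n < m" using assms by simp
  define z where "z = x - cut m x"
  have "cut m z = 0" by (simp add: z_def bopD[OF bop_cut] cut_idem)
  then have u: "S z \<star> z \<le> 1 / real (Suc m) * (z \<star> z)" by (rule cut_upper)
  have "cut n z = z"
    using assms(1) good_commute[OF good_cut good_cut, of n m x] by (simp add: z_def bopD[OF bop_cut])
  then have "1 / real (Suc n) * (z \<star> z) \<le> S z \<star> z" by (rule cut_lower)
  then have le: "1 / real (Suc n) * (z \<star> z) \<le> 1 / real (Suc m) * (z \<star> z)" using u by linarith
  have "z \<star> z = 0"
  proof (rule ccontr)
    assume "z \<star> z \<noteq> 0"
    then have "0 < z \<star> z" using inn_nonneg[of z] by linarith
    then have "1 / real (Suc n) \<le> 1 / real (Suc m)" using le by (rule mult_right_le_imp_le[rotated])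
    then show False using nm by (simp add: field_simps)
  qed
  then have "z = 0" by (rule inn_eq_0)
  then show ?thesis by (simp add: z_def)
qed (use assms in simp)

text \<open>The image under S lies in D by construction, and each element is S v with T (S v) = Z v
  and v controlled by \<open>cut_S_lower\<close>.\<close>

definition L :: "nat \<Rightarrow> 'h set" where
  "L n = {S v | v. cut n v = v}"

lemma LI: "cut n v = v \<Longrightarrow> S v \<in> L n"
  by (auto simp: L_def)

lemma LE: assumes "x \<in> L n" obtains v where "x = S v" "cut n v = v"
  using assms by (auto simp: L_def)

lemma L_mono: "n \<le> m \<Longrightarrow> L n \<subseteq> L m"
  unfolding L_def using cut_mono by blast

lemma L_sub_D: "L n \<subseteq> D"
  unfolding L_def using S_in by blast

lemma qsub_L: "qsub (L n)"
proof -
  note l = bopD[OF selfadj_bop[OF selfadj_S]] bopD[OF bop_cut] homogD[OF homog_S] homogD[OF homog_cut]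
  have "S 0 \<in> L n" by (rule LI) (simp add: l)
  moreover have "x + y \<in> L n" if xy: "x \<in> L n" "y \<in> L n" for x y
  proof -
    obtain u v where "x = S u" "cut n u = u" "y = S v" "cut n v = v" using xy by (auto simp: L_def)
    then show ?thesis using LI[of n "u + v"] by (simp add: l)
  qed
  moreover have "sm x q \<in> L n" if x: "x \<in> L n" for x q
  proof -
    obtain u where "x = S u" "cut n u = u" using x by (auto simp: L_def)
    then show ?thesis using LI[of n "sm u q"] by (simp add: l)
  qed
  ultimately show ?thesis by (auto simp: qsub_def l)
qed

lemma L_good: assumes "good f" shows "f ` L n \<subseteq> L n"
proof -
  have "f (S v) \<in> L n" if "cut n v = v" for v
    using LI[of n "f v"] good_commute[OF assms good_S, of v] good_commute[OF assms good_cut, of n v] that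
    by simp
  then show ?thesis by (auto elim: LE)
qed

lemma L_opJ: "opJ ` L n \<subseteq> L n"
proof -
  have "opJ (S v) \<in> L n" if "cut n v = v" for v
    using LI[of n "opJ v"] good_opJ[OF good_S, of v] good_opJ[OF good_cut, of n v] that by simp
  then show ?thesis by (auto elim: LE)
qed

lemma cut_L: "x \<in> L n \<Longrightarrow> cut n x = x"
  using good_commute[OF good_cut good_S, of n] by (auto simp: L_def)

text \<open>The hypothesis makes every cut vanish at S x, so the form of S at S x is at most the
  squared norm of S x divided by n + 1, for all n; injectivity of S finishes.\<close>

lemma L_total:
  assumes "\<And>n v. x \<star> S (cut n v) = 0"
  shows "x = 0"
proof -
  have "S (S x) \<star> S x \<le> inverse (real (Suc n)) * (S x \<star> S x)" for n
  proof -
    have "cut n (S x) \<star> v = 0 \<star> v" for v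
      using assms[of n v] by (simp add: selfadj_inn[OF selfadj_cut] selfadj_inn[OF selfadj_S])
    then have "cut n (S x) = 0" by (rule inn_ext)
    then show ?thesis using cut_upper[of n "S x"] by (simp add: inverse_eq_divide)
  qed
  moreover have "(\<lambda>n. inverse (real (Suc n)) * (S x \<star> S x)) \<longlonglongrightarrow> 0"
    using tendsto_mult_right[OF LIMSEQ_inverse_real_of_nat, of "S x \<star> S x"] by simp
  ultimately have "S (S x) \<star> S x \<le> 0" by (intro LIMSEQ_le_const) auto
  then have "(nrm (S (S x)))\<^sup>2 \<le> 0"
    using S_energy[of "S x"] zero_le_power2[of "nrm (Z (S x))"] by linarith
  then have "S (S x) = 0" by simp
  then show ?thesis using S_inj by blast
qed

lemma cut_S_lower:
  assumes "cut n v = v"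
  shows "nrm v \<le> real (Suc n) * nrm (S v)"
proof (cases "v = 0")
  case False
  then have pos: "0 < nrm v" by (metis nrm_eq_0 nrm_nonneg order_le_less)
  have "(1 / real (Suc n) * nrm v) * nrm v \<le> nrm (S v) * nrm v"
    using cut_lower[OF assms] inn_le_nrm[of "S v" v]
    by (simp flip: nrm_sq add: power2_eq_square)
  then have "1 / real (Suc n) * nrm v \<le> nrm (S v)" using pos by (rule mult_right_le_imp_le)
  then show ?thesis by (simp add: field_simps)
qed simp

text \<open>The eigenvalue \<open>q b\<close> is the one on \<open>b\<close> of the truncation of \<open>(A + J \<bar>W\<bar>) S\<^sup>-\<^sup>1 = T\<close>.\<close>

lemma eigenvalue_exists:
  assumes b: "b \<in> L n" "eig (bitset k) opJ b" "b \<star> b = 1" and k: "2 * real (Suc n) \<le> 2 ^ k"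
  shows "\<exists>q. trunc S k (sm b q) = trunc opA k b + opJ (trunc (absop opW) k b)"
proof -
  obtain a c s where acs: "trunc opA k b = a \<cdot> b" "trunc (absop opW) k b = c \<cdot> b" "trunc S k b = s \<cdot> b"
    using trunc_eig[OF _ b(2), of opA] trunc_eig[OF _ b(2), of "absop opW"] trunc_eig[OF _ b(2), of S] by auto
  have "opJ b = sm b 0 \<or> opJ b = sm b qI" using b(2) by (simp add: eig_def)
  then obtain j where j: "opJ b = sm b j" by blast
  have nb: "nrm b = 1" using b(3) by (simp add: nrm_def)
  \<comment> \<open>The digit count makes the truncation error at most half of the lower bound for S
    on \<open>L n\<close>, so the truncated eigenvalue s stays positive.\<close>
  have "1 / real (Suc n) \<le> S b \<star> b" using cut_lower[OF cut_L[OF b(1)]] b(3) by simp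
  moreover have "(S b - trunc S k b) \<star> b \<le> 1 / 2 ^ k"
    using inn_le_nrm[of "S b - trunc S k b" b] trunc_bound[of S b k] nb by simp
  moreover have "1 / 2 ^ k \<le> 1 / (2 * real (Suc n))" using k by (intro divide_left_mono) auto
  moreover have "1 / (2 * real (Suc n)) < 1 / real (Suc n)" by (simp add: field_simps)
  ultimately have "0 < trunc S k b \<star> b" by (simp add: inn_diff_left)
  then have s: "0 < s" by (simp add: acs inn_sc_left b(3))
  \<comment> \<open>Digits act on b by signs, so a, c and s are real and only j is a genuine
    quaternion; thus the division by s raises no question of order.\<close>
  define q where "q = qreal (1 / s) * (qreal a + j * qreal c)"
  have "trunc S k (sm b q) = sm (s \<cdot> b) q" by (simp add: homogD[OF homog_trunc] acs)
  also have "\<dots> = sm b (qreal s * qreal (1 / s) * (qreal a + j * qreal c))"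
    by (simp add: rsc_def sm_sm q_def mult.assoc)
  also have "qreal s * qreal (1 / s) = 1" using s by (simp add: qreal_mult one_quat_def)
  also have "sm b (1 * (qreal a + j * qreal c)) = a \<cdot> b + c \<cdot> opJ b"
    by (simp add: sm_qadd rsc_def j sm_sm)
  finally show ?thesis by (intro exI[of _ q]) (simp add: acs bopD(2)[OF bop_opJ])
qed

text \<open>Let y be the error vector T x' - d. S y is a sum of truncation errors, and y lies in the
  range of \<open>cut n\<close>, where S can be inverted at the cost of a factor n + 1.\<close>

lemma block_estimate:
  assumes N: "finite N" "orthoset N" "N \<subseteq> L n" "\<And>b. b \<in> N \<Longrightarrow> eig (bitset k) opJ b"
    and k: "2 * real (Suc n) \<le> 2 ^ k"
  shows "\<exists>q. \<forall>x. nrm (\<Sum>b\<in>N. sm (T b - sm b (q b)) (ip b x)) \<le>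
    2 * real (Suc n) * (5 + real n) / 2 ^ k * nrm x"
proof -
  have "\<exists>q. trunc S k (sm b q) = trunc opA k b + opJ (trunc (absop opW) k b)" if "b \<in> N" for b
  proof (rule eigenvalue_exists[OF _ _ _ k])
    show "b \<star> b = 1" using N(2) that by (simp add: orthoset_def rin_def)
  qed (use N that in auto)
  then obtain q where q: "\<And>b. b \<in> N \<Longrightarrow> trunc S k (sm b (q b)) = trunc opA k b + opJ (trunc (absop opW) k b)"
    by metis
  let ?c = "real (Suc n)"
  define h :: real where "h = 1 / 2 ^ k"
  have h: "0 \<le> h" "2 * (?c * h) \<le> 1" using k by (simp_all add: h_def)
  have "nrm (\<Sum>b\<in>N. sm (T b - sm b (q b)) (ip b x)) \<le> 2 * ?c * (5 + real n) / 2 ^ k * nrm x" for x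
  proof -
    define x' where "x' = fproj N x"
    define d where "d = (\<Sum>b\<in>N. sm b (q b * ip b x))"
    define y where "y = T x' - d"
    have x': "nrm x' \<le> nrm x" unfolding x'_def by (rule fproj_contr[OF N(1,2)])
    have "x' \<in> L n" unfolding x'_def by (rule fproj_in[OF qsub_L N(3)])
    then obtain v where v: "x' = S v" "cut n v = v" by (auto simp: L_def)
    have nv: "nrm v \<le> ?c * nrm x'" using cut_S_lower[OF v(2)] v(1) by simp
    have Tx': "T x' = Z v" by (simp add: v Z_def)
    have "(\<Sum>b\<in>M. sm b (ip b x)) \<in> D \<and> T (\<Sum>b\<in>M. sm b (ip b x)) = (\<Sum>b\<in>M. sm (T b) (ip b x))"
      if "M \<subseteq> N" for M
      using finite_subset[OF that N(1)] that
    proof (induction M rule: finite_induct)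
      case empty
      show ?case by (simp add: qsub_zero[OF qsub_D] T_zero)
    next
      case (insert b M)
      then have "b \<in> D" using N(3) L_sub_D by blast
      then show ?case using insert by (simp add: qsub_add[OF qsub_D] qsub_sm[OF qsub_D] T_plus T_sm)
    qed
    then have Tsum: "T x' = (\<Sum>b\<in>N. sm (T b) (ip b x))" by (simp add: x'_def fproj_def)
    have y_eq: "(\<Sum>b\<in>N. sm (T b - sm b (q b)) (ip b x)) = y"
      by (simp add: y_def Tsum d_def sm_diff sm_sm sum_subtractf)
    have "d \<in> L n" unfolding d_def using N(3) by (intro qsub_sum[OF qsub_L] qsub_sm[OF qsub_L]) auto
    then have "cut n d = d" by (rule cut_L)
    then have "cut n y = y"
      using good_Z[OF good_cut, of n v] v(2) by (simp add: y_def Tx' bopD[OF bop_cut])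
    then have ny: "nrm y \<le> ?c * nrm (S y)" by (rule cut_S_lower)
    have "trunc S k d = (\<Sum>b\<in>N. sm (trunc opA k b + opJ (trunc (absop opW) k b)) (ip b x))"
      unfolding d_def lin_sum[OF bop_lin[OF bop_trunc[of S]], simplified]
      by (intro sum.cong refl) (simp add: homogD[OF homog_trunc] flip: q sm_sm)
    also have "\<dots> = trunc opA k x' + opJ (trunc (absop opW) k x')"
      by (simp add: x'_def fproj_def lin_sum[OF bop_lin[OF bop_trunc]] lin_sum[OF bop_lin[OF bop_opJ]]
          homogD[OF homog_trunc] homogD[OF homog_opJ] sm_add sum.distrib)
    finally have td: "trunc S k d = trunc opA k x' + opJ (trunc (absop opW) k x')" .
    have "S y = Z x' - S d" by (simp add: y_def Tx' bopD[OF selfadj_bop[OF selfadj_S]] S_Z flip: v(1))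
    also have "\<dots> = (opA x' - trunc opA k x') + opJ (absop opW x' - trunc (absop opW) k x')
        - (S d - trunc S k d)"
      by (simp add: Z_decomp opC_polar td bopD[OF bop_opJ])
    finally have Sy: "S y = (opA x' - trunc opA k x') + opJ (absop opW x' - trunc (absop opW) k x')
        - (S d - trunc S k d)" .
    have "nrm (S y) \<le> nrm (opA x' - trunc opA k x') + nrm (opJ (absop opW x' - trunc (absop opW) k x'))
        + nrm (S d - trunc S k d)"
      unfolding Sy
      using nrm_triangle_diff[of "(opA x' - trunc opA k x') + opJ (absop opW x' - trunc (absop opW) k x')" "S d - trunc S k d"]
        nrm_triangle[of "opA x' - trunc opA k x'" "opJ (absop opW x' - trunc (absop opW) k x')"]
      by linarith
    moreover have "nrm (opA x' - trunc opA k x') \<le> h * nrm x'" "nrm (S d - trunc S k d) \<le> h * nrm d"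
      using trunc_bound[of opA x' k] trunc_bound[of S d k] by (simp_all add: h_def)
    moreover have "nrm (opJ (absop opW x' - trunc (absop opW) k x')) \<le> 2 * (h * nrm x')"
      using nrm_opJ[of "absop opW x' - trunc (absop opW) k x'"] trunc_bound[of "absop opW" x' k]
      by (simp add: h_def)
    ultimately have "nrm (S y) \<le> h * (3 * nrm x' + nrm d)" by (simp add: algebra_simps)
    \<comment> \<open>The diagonal part d has no bound of its own yet; it is compared with T x' at
      the price of y itself.\<close>
    moreover have "nrm d \<le> nrm y + ?c * nrm x'"
      using nrm_triangle_diff[of "T x'" y] Z_contr[of v] nv by (simp add: Tx' y_def)
    ultimately have "nrm (S y) \<le> h * ((3 + ?c) * nrm x' + nrm y)"
      using mult_left_mono[of "3 * nrm x' + nrm d" "(3 + ?c) * nrm x' + nrm y" h] h(1)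
      by (simp add: algebra_simps)
    then have "nrm y \<le> ?c * (h * ((3 + ?c) * nrm x' + nrm y))"
      using ny by (meson mult_left_mono of_nat_0_le_iff order_trans)
    also have "\<dots> = ?c * h * (3 + ?c) * nrm x' + (?c * h) * nrm y" by (simp add: algebra_simps)
    finally have "nrm y \<le> ?c * h * (3 + ?c) * nrm x' + (?c * h) * nrm y" .
    \<comment> \<open>By the choice of k, the term in y is at most half of the left side and is
      absorbed; this produces the factor 2 in the constant.\<close>
    moreover have "2 * ((?c * h) * nrm y) \<le> nrm y"
      using mult_right_mono[OF h(2), of "nrm y"] by simp
    ultimately have "nrm y \<le> 2 * (?c * h * (3 + ?c) * nrm x')" by linarith
    also have "\<dots> \<le> 2 * (?c * h * (5 + real n) * nrm x)"
      using h(1) x' by (intro mult_left_mono mult_mono) auto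
    finally show ?thesis unfolding y_eq by (simp add: h_def mult.assoc algebra_simps)
  qed
  then show ?thesis by blast
qed

subsection \<open>The compact perturbation\<close>

text \<open>The constants are those of \<open>block_estimate\<close> at level \<open>Suc n\<close>,
  since the vectors of block n lie in \<open>L (Suc n)\<close>.\<close>

lemma levels_exist:
  assumes "0 < \<epsilon>"
  shows "\<exists>k. mono k \<and> (\<forall>n. 2 * real (Suc (Suc n)) \<le> 2 ^ k n \<and>
    2 * real (Suc (Suc n)) * (5 + real (Suc n)) / 2 ^ k n \<le> \<epsilon> / 2 ^ (n + 2))"
proof -
  define c where "c n = 2 * real (Suc (Suc n)) * (5 + real (Suc n))" for n
  have "\<exists>k. max (2 * real (Suc (Suc n))) (c n * 2 ^ (n + 2) / \<epsilon>) < 2 ^ k" for n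
    by (rule real_arch_pow) simp
  then obtain k where k: "\<And>n. max (2 * real (Suc (Suc n))) (c n * 2 ^ (n + 2) / \<epsilon>) < 2 ^ k n" by metis
  \<comment> \<open>Partial sums make the choice monotone while dominating each
    \<open>k n\<close>.\<close>
  define l where "l n = (\<Sum>i\<le>n. k i)" for n
  have "mono l" unfolding l_def by (intro monoI sum_mono2) auto
  moreover have "2 * real (Suc (Suc n)) \<le> 2 ^ l n \<and> c n / 2 ^ l n \<le> \<epsilon> / 2 ^ (n + 2)" for n
  proof -
    have "k n \<le> l n" unfolding l_def by (rule member_le_sum) auto
    then have "(2::real) ^ k n \<le> 2 ^ l n" by (intro power_increasing) auto
    then have "2 * real (Suc (Suc n)) \<le> 2 ^ l n" "c n * 2 ^ (n + 2) / \<epsilon> \<le> 2 ^ l n"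
      using k[of n] by linarith+
    moreover have "c / a \<le> \<epsilon> / b" if "c * b / \<epsilon> \<le> a" "0 < a" "0 < b" for a b c :: real
      using that assms by (simp add: field_simps)
    ultimately show ?thesis by simp
  qed
  ultimately show ?thesis unfolding c_def by blast
qed

text \<open>Repeated refinement captures one vector of a total sequence at each stage. Block n is
  diagonalised with the digits under which \<open>B n\<close> is already invariant.\<close>

lemma diagonalizing_system:
  assumes e: "orthonormal_basis ip I e" and \<epsilon>: "0 < \<epsilon>"
  shows "\<exists>B q. B 0 = {} \<and> (\<forall>n. B n \<subseteq> B (Suc n)) \<and> (\<forall>n. finite (B n) \<and> orthoset (B n) \<and> B n \<subseteq> D) \<and>
    (\<forall>x. (\<forall>n. \<forall>b\<in>B n. ip b x = 0) \<longrightarrow> x = 0) \<and>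
    (\<forall>n x. nrm (\<Sum>b\<in>B (Suc n) - B n. sm (T b - sm b (q n b)) (ip b x)) \<le> \<epsilon> / 2 ^ (n + 2) * nrm x)"
proof -
  obtain k where k: "mono k" "\<And>n. 2 * real (Suc (Suc n)) \<le> 2 ^ k n"
    "\<And>n. 2 * real (Suc (Suc n)) * (5 + real (Suc n)) / 2 ^ k n \<le> \<epsilon> / 2 ^ (n + 2)"
    using levels_exist[OF \<epsilon>] by blast
  \<comment> \<open>All pairs of a cut level and a basis index are enumerated. The level coded by n
    is at most n, which places \<open>w n\<close> in \<open>L (Suc n)\<close>.\<close>
  define w where "w n = S (cut (fst (prod_decode n)) (e (snd (prod_decode n))))" for n
  have w: "w n \<in> L (Suc n)" for n
  proof -
    have "fst (prod_decode n) \<le> n"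
      using le_prod_encode_1[of "fst (prod_decode n)" "snd (prod_decode n)"] by simp
    then show ?thesis unfolding w_def using LI[OF cut_idem] L_mono le_Suc_eq by blast
  qed
  define P where "P n B \<longleftrightarrow> invset (bitset (k n)) opJ B \<and> B \<subseteq> L n \<and> (n = 0 \<longrightarrow> B = {})" for n B
  define Q where "Q n B B' \<longleftrightarrow> B \<subseteq> B' \<and> (\<forall>b\<in>B' - B. eig (bitset (k n)) opJ b) \<and>
    fproj B' (w n) = w n" for n and B B' :: "'h set"
  have "\<exists>B. \<forall>n. P n (B n) \<and> Q n (B n) (B (Suc n))"
  proof (rule dependent_nat_choice)
    show "\<exists>B. P 0 B" by (simp add: P_def invset_def orthoset_def)
  next
    fix B n assume B: "P n B"
    have "\<exists>B'. invset (bitset (k (Suc n))) opJ B' \<and> B \<subseteq> B' \<and> B' \<subseteq> L (Suc n) \<and>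
      (\<forall>b\<in>B' - B. eig (bitset (k n)) opJ b) \<and> fproj B' (w n) = w n"
    proof (rule refinement_step[OF finite_bitset commuting_family_bitset _ _ qsub_L])
      show "bitset (k n) \<subseteq> bitset (k (Suc n))" using k(1) by (intro bitset_mono) (simp add: mono_def)
      show "invset (bitset (k n)) opJ B" "B \<subseteq> L (Suc n)" using B L_mono[of n "Suc n"] by (auto simp: P_def)
      show "\<forall>u\<in>bitset (k (Suc n)). u ` L (Suc n) \<subseteq> L (Suc n)" using L_good bitset_good by blast
    qed (use L_opJ w in auto)
    then show "\<exists>B'. P (Suc n) B' \<and> Q n B B'" unfolding P_def Q_def by auto
  qed
  then obtain B where B: "\<And>n. P n (B n)" "\<And>n. Q n (B n) (B (Suc n))" by blast
  have sub: "B n \<subseteq> B (Suc n)" for n using B(2)[of n] by (simp add: Q_def)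
  have fo: "finite (B n)" "orthoset (B n)" "B n \<subseteq> L n" for n
    using B(1)[of n] by (auto simp: P_def invset_def)
  have "\<exists>q. \<forall>x. nrm (\<Sum>b\<in>B (Suc n) - B n. sm (T b - sm b (q b)) (ip b x)) \<le>
      2 * real (Suc (Suc n)) * (5 + real (Suc n)) / 2 ^ k n * nrm x" for n
  proof (rule block_estimate[OF _ _ _ _ k(2)])
    show "finite (B (Suc n) - B n)" "B (Suc n) - B n \<subseteq> L (Suc n)" using fo[of "Suc n"] by auto
    show "orthoset (B (Suc n) - B n)" using fo(2)[of "Suc n"] by (auto simp: orthoset_def)
    show "eig (bitset (k n)) opJ b" if "b \<in> B (Suc n) - B n" for b using B(2)[of n] that by (auto simp: Q_def)
  qed
  then obtain q where q: "\<And>n x. nrm (\<Sum>b\<in>B (Suc n) - B n. sm (T b - sm b (q n b)) (ip b x)) \<le>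
      2 * real (Suc (Suc n)) * (5 + real (Suc n)) / 2 ^ k n * nrm x" by metis
  have est: "nrm (\<Sum>b\<in>B (Suc n) - B n. sm (T b - sm b (q n b)) (ip b x)) \<le> \<epsilon> / 2 ^ (n + 2) * nrm x" for n x
    using q[of n x] mult_right_mono[OF k(3)[of n] nrm_nonneg[of x]] by (rule order_trans)
  have total: "x = 0" if x: "\<And>n b. b \<in> B n \<Longrightarrow> ip b x = 0" for x
  proof (rule L_total)
    fix m v
    have "ip (e i) (cut m (S x)) = 0" if "i \<in> I" for i
    proof -
      define n where "n = prod_encode (m, i)"
      have "ip (w n) x = ip (fproj (B (Suc n)) (w n)) x" using B(2)[of n] by (simp add: Q_def)
      also have "\<dots> = ip (w n) (fproj (B (Suc n)) x)" by (rule fproj_ip_sym)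
      also have "fproj (B (Suc n)) x = 0" using x by (simp add: fproj_def)
      finally have "ip (S (cut m (e i))) x = 0" by (simp add: w_def n_def)
      then show ?thesis
        by (simp add: ip_adjoint[OF homog_S homog_S selfadj_inn[OF selfadj_S]]
            ip_adjoint[OF homog_cut homog_cut selfadj_inn[OF selfadj_cut]])
    qed
    then have "cut m (S x) = 0" using e unfolding orthonormal_basis_def by blast
    then have "cut m (S x) \<star> v = 0" by simp
    then show "x \<star> S (cut m v) = 0"
      by (simp add: selfadj_inn[OF selfadj_cut] selfadj_inn[OF selfadj_S])
  qed
  have "B 0 = {}" using B(1)[of 0] by (simp add: P_def)
  moreover have "B n \<subseteq> D" for n using fo(3) L_sub_D by blast
  ultimately show ?thesis using sub fo est total by (intro exI[of _ B] exI[of _ q]) blast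
qed

text \<open>K is the sum of the block errors. On a vector of block n only the n-th summand survives,
  so T - K acts there by the chosen eigenvalue.\<close>

lemma compact_perturbation:
  assumes e: "orthonormal_basis ip I e" and \<epsilon>: "0 < \<epsilon>"
  shows "\<exists>K \<Phi> q. bop K \<and> homog K \<and> seqcompact K \<and> (\<forall>x. nrm (K x) \<le> \<epsilon> / 2 * nrm x) \<and>
    countable \<Phi> \<and> orthoset \<Phi> \<and> \<Phi> \<subseteq> D \<and> (\<forall>x. (\<forall>b\<in>\<Phi>. ip b x = 0) \<longrightarrow> x = 0) \<and>
    (\<forall>b\<in>\<Phi>. T b - K b = sm b (q b))"
proof -
  obtain B q where *: "B 0 = {} \<and> (\<forall>n. B n \<subseteq> B (Suc n)) \<and>
    (\<forall>n. finite (B n) \<and> orthoset (B n) \<and> B n \<subseteq> D) \<and>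
    (\<forall>x. (\<forall>n. \<forall>b\<in>B n. ip b x = 0) \<longrightarrow> x = 0) \<and>
    (\<forall>n x. nrm (\<Sum>b\<in>B (Suc n) - B n. sm (T b - sm b (q n b)) (ip b x)) \<le> \<epsilon> / 2 ^ (n + 2) * nrm x)"
    using diagonalizing_system[OF e \<epsilon>] by (elim exE)
  then have B: "B 0 = {}" "\<And>n. B n \<subseteq> B (Suc n)" "\<And>n. finite (B n)" "\<And>n. orthoset (B n)" "\<And>n. B n \<subseteq> D"
    "\<And>x. (\<And>n b. b \<in> B n \<Longrightarrow> ip b x = 0) \<Longrightarrow> x = 0"
    "\<And>n x. nrm (\<Sum>b\<in>B (Suc n) - B n. sm (T b - sm b (q n b)) (ip b x)) \<le> \<epsilon> / 2 ^ (n + 2) * nrm x"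
    by simp_all
  have mono: "B n \<subseteq> B m" if "n \<le> m" for n m using lift_Suc_mono_le[of B, OF B(2) that] .
  define \<Phi> where "\<Phi> = (\<Union>n. B n)"
  have ortho: "orthoset \<Phi>"
    unfolding orthoset_def
  proof (intro ballI)
    fix a b assume "a \<in> \<Phi>" "b \<in> \<Phi>"
    then obtain n m where "a \<in> B n" "b \<in> B m" by (auto simp: \<Phi>_def)
    then have "a \<in> B (max n m)" "b \<in> B (max n m)" using mono[of n "max n m"] mono[of m "max n m"] by auto
    then show "ip a b = (if a = b then 1 else 0)" using B(4)[of "max n m"] by (simp add: orthoset_def)
  qed
  define Kn where "Kn n x = (\<Sum>b\<in>B (Suc n) - B n. sm (T b - sm b (q n b)) (ip b x))" for n x
  have homogKn: "homog (Kn n)" for n by (simp add: homog_def Kn_def ip_sm sm_sum sm_sm)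
  have bopKn: "bop (Kn n)" for n
  proof (rule bopI)
    show "nrm (Kn n x) \<le> \<epsilon> / 2 ^ (n + 2) * nrm x" for x unfolding Kn_def by (rule B(7))
    show "Kn n (x + y) = Kn n x + Kn n y" for x y by (simp add: Kn_def ip_add sm_qadd sum.distrib)
    show "Kn n (r \<cdot> x) = r \<cdot> Kn n x" for r x unfolding rsc_def by (rule homogD[OF homogKn])
  qed
  have "seqcompact (Kn n)" for n
    unfolding Kn_def[abs_def] by (intro seqcompact_sum seqcompact_rank_one_quat)
  then have compF: "seqcompact (\<lambda>x. \<Sum>n<m. Kn n x)" for m by (intro seqcompact_sum)
  have "nrm (Kn n x) \<le> \<epsilon> / 2 ^ (n + 2) * nrm x" for n x unfolding Kn_def by (rule B(7))
  then obtain K where K: "bop K" "\<And>x. conv (\<lambda>m. \<Sum>n<m. Kn n x) (K x)"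
    "\<And>m x. nrm (K x - (\<Sum>n<m. Kn n x)) \<le> \<epsilon> / 2 ^ (m + 1) * nrm x"
    using operator_series[of Kn \<epsilon>, OF bopKn _ \<epsilon>] by blast
  have homogK: "homog K"
    by (rule homog_limit[of "\<lambda>m x. \<Sum>n<m. Kn n x", OF homog_sum[OF homogKn] K(2)])
  have "(\<lambda>m. \<epsilon> / 2 ^ (m + 1)) \<longlonglongrightarrow> 0"
  proof -
    have "(\<lambda>m. (\<epsilon> / 2) * (1 / 2) ^ m) \<longlonglongrightarrow> (\<epsilon> / 2) * 0"
      by (intro tendsto_mult_left LIMSEQ_power_zero) auto
    then show ?thesis by (simp add: power_divide field_simps)
  qed
  then have compK: "seqcompact K" by (rule seqcompact_limit[OF compF K(3)])
  have normK: "nrm (K x) \<le> \<epsilon> / 2 * nrm x" for x using K(3)[of x 0] by simp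
  have "\<exists>p. T b - K b = sm b p" if "b \<in> \<Phi>" for b
  proof -
    define m where "m = (LEAST m. b \<in> B m)"
    have m: "b \<in> B m" using that LeastI_ex[of "\<lambda>m. b \<in> B m"] by (auto simp: \<Phi>_def m_def)
    \<comment> \<open>\<open>B 0\<close> is empty, so the least index is a successor and b belongs
      to exactly one block.\<close>
    then obtain n where n: "m = Suc n" using B(1) by (cases m) auto
    have "b \<notin> B n" using not_less_Least[of n "\<lambda>m. b \<in> B m"] n by (simp add: m_def)
    then have bn: "b \<in> B (Suc n) - B n" using m n by simp
    have ipb: "ip c b = (if c = b then 1 else 0)" if "c \<in> B l" for c l
      using ortho that \<open>b \<in> \<Phi>\<close> unfolding orthoset_def \<Phi>_def by blast
    have Knb: "Kn l b = (if l = n then T b - sm b (q n b) else 0)" for l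
    proof -
      have "Kn l b = (\<Sum>c\<in>B (Suc l) - B l. if c = b then T b - sm b (q l b) else 0)"
        unfolding Kn_def by (intro sum.cong refl) (auto simp: ipb)
      also have "\<dots> = (if b \<in> B (Suc l) - B l then T b - sm b (q l b) else 0)"
        using B(3) by simp
      also have "b \<in> B (Suc l) - B l \<longleftrightarrow> l = n"
      proof
        assume l: "b \<in> B (Suc l) - B l"
        show "l = n"
          using l bn mono[of "Suc l" n] mono[of "Suc n" l] by (cases l n rule: linorder_cases) auto
      qed (use bn in simp)
      finally show ?thesis by auto
    qed
    \<comment> \<open>From \<open>Suc n\<close> on the partial sums at b are constant.\<close>
    have "conv (\<lambda>i. \<Sum>l<i + Suc n. Kn l b) (K b)"
      using K(2)[of b] unfolding conv_def by (rule LIMSEQ_ignore_initial_segment)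
    moreover have "(\<Sum>l<i + Suc n. Kn l b) = T b - sm b (q n b)" for i
      by (simp add: Knb del: sum.lessThan_Suc)
    ultimately have "K b = T b - sm b (q n b)" using conv_unique conv_const by force
    then show ?thesis by auto
  qed
  then obtain p where "\<And>b. b \<in> \<Phi> \<Longrightarrow> T b - K b = sm b (p b)" by metis
  moreover have "countable \<Phi>" unfolding \<Phi>_def using B(3) by (auto intro: countable_finite)
  moreover have "\<Phi> \<subseteq> D" unfolding \<Phi>_def using B(5) by blast
  moreover have "x = 0" if "\<forall>b\<in>\<Phi>. ip b x = 0" for x using B(6)[of x] that by (auto simp: \<Phi>_def)
  ultimately show ?thesis using K(1) homogK compK normK ortho
    by (intro exI[of _ K] exI[of _ \<Phi>] exI[of _ p]) blast
qed

end

theorem theorem3p4: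
  fixes sm :: "'h::ab_group_add \<Rightarrow> quat \<Rightarrow> 'h" and ip :: "'h \<Rightarrow> 'h \<Rightarrow> quat"
    and DT :: "'h set" and T :: "'h \<Rightarrow> 'h" and \<epsilon> :: real
  assumes "quat_hilbert sm ip" and "separable_qh ip"
    and "densely_defined ip DT" and "closed_op ip DT T" and "right_linear_op sm DT T"
    and "normal_op ip DT T"
    and "\<epsilon> > 0"
  shows "\<exists>K DD A. compact_op sm ip K \<and> op_norm ip K < \<epsilon> \<and> diagonal_op sm ip DD A \<and>
           DT = DD \<inter> UNIV \<and> (\<forall>x\<in>DT. T x = A x + K x)"
proof -
  interpret quat_normal sm ip DT T
    by unfold_locales (rule assms)+
  obtain I e where "orthonormal_basis ip I e" using assms(2) by (auto simp: separable_qh_def)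
  then have "\<exists>K \<Phi> q. bop K \<and> homog K \<and> seqcompact K \<and> (\<forall>x. nrm (K x) \<le> \<epsilon> / 2 * nrm x) \<and>
    countable \<Phi> \<and> orthoset \<Phi> \<and> \<Phi> \<subseteq> DT \<and> (\<forall>x. (\<forall>b\<in>\<Phi>. ip b x = 0) \<longrightarrow> x = 0) \<and>
    (\<forall>b\<in>\<Phi>. T b - K b = sm b (q b))"
    using assms(7) by (rule compact_perturbation)
  then obtain K \<Phi> q where K: "bop K" "homog K" "seqcompact K" "\<forall>x. nrm (K x) \<le> \<epsilon> / 2 * nrm x"
    and \<Phi>: "countable \<Phi>" "orthoset \<Phi>" "\<Phi> \<subseteq> DT" "\<forall>x. (\<forall>b\<in>\<Phi>. ip b x = 0) \<longrightarrow> x = 0"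
      "\<forall>b\<in>\<Phi>. T b - K b = sm b (q b)"
    by (elim exE conjE)
  \<comment> \<open>K is bounded, so T - K keeps the domain of T and remains closed.\<close>
  define A where "A x = T x - K x" for x
  have "\<exists>C. \<forall>x. nrm (K x) \<le> C * nrm x" using K(4) by blast
  then have "bounded_op sm ip K"
    unfolding bounded_op_def right_linear_op_def right_subspace_def hnorm_eq
    by (simp add: bopD[OF K(1)] homogD[OF K(2)])
  moreover have "precompact_qh ip (K ` B)" if B: "\<exists>C. \<forall>x\<in>B. hnorm ip x \<le> C" for B
    unfolding precompact_qh_def hconv_eq
  proof (intro allI impI)
    fix X :: "nat \<Rightarrow> 'h" assume "\<forall>n. X n \<in> K ` B"
    then have "\<forall>n. \<exists>y. y \<in> B \<and> X n = K y" by (simp add: image_iff Bex_def)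
    then obtain s where s: "\<forall>n. s n \<in> B \<and> X n = K (s n)" by (elim choice[THEN exE])
    obtain C where "\<forall>x\<in>B. nrm x \<le> C" using B unfolding hnorm_eq by blast
    then have "\<forall>n. nrm (s n) \<le> C" using s by blast
    then obtain r l where "strict_mono (r :: nat \<Rightarrow> nat)" "conv (\<lambda>m. K (s (r m))) l"
      using K(3) unfolding seqcompact_def by blast
    moreover have "X \<circ> r = (\<lambda>m. K (s (r m)))" using s by auto
    ultimately show "\<exists>(r::nat\<Rightarrow>nat) l. strict_mono r \<and> conv (X \<circ> r) l" by metis
  qed
  ultimately have "compact_op sm ip K" by (simp add: compact_op_def)
  moreover have "op_norm ip K < \<epsilon>"
  proof -
    have "op_norm ip K \<le> \<epsilon> / 2"
      unfolding op_norm_def hnorm_eq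
    proof (rule cSup_least)
      have "nrm 0 \<le> 1" by simp
      then show "{nrm (K x) |x. nrm x \<le> 1} \<noteq> {}" by blast
      fix t assume "t \<in> {nrm (K x) |x. nrm x \<le> 1}"
      then obtain x where "t = nrm (K x)" "nrm x \<le> 1" by blast
      then have "\<epsilon> / 2 * nrm x \<le> \<epsilon> / 2" using assms(7) by simp
      then show "t \<le> \<epsilon> / 2" using K(4) \<open>t = nrm (K x)\<close> order_trans by blast
    qed
    then show ?thesis using assms(7) by simp
  qed
  moreover have "diagonal_op sm ip DT A"
  proof -
    have "closed_op ip DT A"
      unfolding closed_op_def hconv_eq
    proof (intro allI impI)
      fix X x y assume X: "\<forall>n. X n \<in> DT" "conv X x" "conv (\<lambda>n. A (X n)) y"
      have "conv (\<lambda>n. A (X n) + K (X n)) (y + K x)"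
        by (rule conv_add[OF X(3) bop_conv[OF K(1) X(2)]])
      then have "conv (\<lambda>n. T (X n)) (y + K x)" by (simp add: A_def)
      then show "x \<in> DT \<and> A x = y" using assms(4) X unfolding closed_op_def hconv_eq A_def
        by (metis add_diff_cancel_right')
    qed
    moreover have "right_linear_op sm DT A"
      using assms(5) unfolding right_linear_op_def A_def
      by (auto simp: bopD[OF K(1)] homogD[OF K(2)] sm_diff)
    \<comment> \<open>\<open>\<Phi>\<close> may be finite, so its indices are the image of
      \<open>to_nat_on \<Phi>\<close> rather than all natural numbers.\<close>
    moreover have "orthonormal_basis ip (to_nat_on \<Phi> ` \<Phi>) (from_nat_into \<Phi>)"
      unfolding orthonormal_basis_def
    proof (intro conjI ballI allI impI)
      fix r s assume "r \<in> to_nat_on \<Phi> ` \<Phi>" "s \<in> to_nat_on \<Phi> ` \<Phi>"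
      then show "ip (from_nat_into \<Phi> r) (from_nat_into \<Phi> s) = (if r = s then 1 else 0)"
        using \<Phi>(1,2) by (auto simp: orthoset_def)
    next
      fix x assume "\<forall>r\<in>to_nat_on \<Phi> ` \<Phi>. ip (from_nat_into \<Phi> r) x = 0"
      then show "x = 0" using \<Phi>(1,4) by auto
    qed
    moreover have "from_nat_into \<Phi> r \<in> DT \<and> A (from_nat_into \<Phi> r) = sm (from_nat_into \<Phi> r) (q (from_nat_into \<Phi> r))"
      if "r \<in> to_nat_on \<Phi> ` \<Phi>" for r
      using that \<Phi>(1,3,5) by (auto simp: A_def)
    ultimately show ?thesis
      unfolding diagonal_op_def using assms(3)
      by (intro conjI exI[of _ "to_nat_on \<Phi> ` \<Phi>"] exI[of _ "from_nat_into \<Phi>"]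
          exI[of _ "\<lambda>r. q (from_nat_into \<Phi> r)"]) auto
  qed
  ultimately show ?thesis
    by (intro exI[of _ K] exI[of _ DT] exI[of _ A]) (simp add: A_def)
qed

end
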